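(* Let $d\ge3$ be fixed and $0<c<(d-2)!$. Let $G^d_n=G^d(n,c/n^{d-1})$, and let $\overline{L_c}$ be the closure in $[0,1]$ of $L_c=\{\lim_{n\to\infty}\mathbf{P}(G^d_n\models\phi)\colon\phi\text{ a first order sentence in the language of } d\text{-uniform hypergraphs}\}$. For $H\in\mathcal U$ let $p_H(c)=\lim_{n\to\infty}\mathbf{P}(\mathrm{Frag}_n\simeq H)$ and let $S_c=\{\sum_{H\in\mathcal T}p_H(c)\colon\mathcal T\subseteq\mathcal U\}$. Then $\overline{L_c}=S_c$.
   Context: $G^d(n,p)$ is the random $d$-uniform hypergraph on $\{1,\dots,n\}$ with each $d$-element edge present independently with probability $p$. The FO language of $d$-uniform hypergraphs has one $d$-ary anti-reflexive, completely symmetric relation (the edge relation). For a hypergraph $H$, $|H|$ is its number of edges and its excess is $(d-1)|H|-|V(H)|$; a unicycle is a connected hypergraph of excess $0$. $\mathcal U$ is the family of unlabeled $d$-uniform hypergraphs whose connected components are all unicycles (including the empty one). $\mathrm{Frag}_n$ is the union of the unicyclic components of $G^d_n$. *)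

theory Defs
  imports "HOL-Probability.Probability" "HOL-Probability.Product_PMF"
begin

section \<open>Hypergraphs\<close>

type_synonym 'a hypergraph = "'a set \<times> 'a set set"

abbreviation verts :: "'a hypergraph \<Rightarrow> 'a set" where "verts \<equiv> fst"
abbreviation edges :: "'a hypergraph \<Rightarrow> 'a set set" where "edges \<equiv> snd"

definition uniform_hypergraph :: "nat \<Rightarrow> 'a hypergraph \<Rightarrow> bool" where
  "uniform_hypergraph d H \<longleftrightarrow>
     finite (verts H) \<and> (\<forall>e\<in>edges H. e \<subseteq> verts H \<and> card e = d)"

definition excess :: "nat \<Rightarrow> 'a hypergraph \<Rightarrow> int" where
  "excess d H = (int d - 1) * int (card (edges H)) - int (card (verts H))"

definition linked :: "'a hypergraph \<Rightarrow> ('a \<times> 'a) set" where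
  "linked H = {(u, v). u \<in> verts H \<and> v \<in> verts H \<and>
     (u, v) \<in> {(x, y). \<exists>e\<in>edges H. x \<in> e \<and> y \<in> e}\<^sup>*}"

definition connected_hypergraph :: "'a hypergraph \<Rightarrow> bool" where
  "connected_hypergraph H \<longleftrightarrow> verts H \<noteq> {} \<and> verts H \<times> verts H \<subseteq> linked H"

definition unicycle :: "nat \<Rightarrow> 'a hypergraph \<Rightarrow> bool" where
  "unicycle d H \<longleftrightarrow> uniform_hypergraph d H \<and> connected_hypergraph H \<and> excess d H = 0"

definition components_of :: "'a hypergraph \<Rightarrow> 'a hypergraph set" where
  "components_of H = (\<lambda>W. (W, {e \<in> edges H. e \<subseteq> W})) ` (verts H // linked H)"

definition Frag :: "nat \<Rightarrow> 'a hypergraph \<Rightarrow> 'a hypergraph" where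
  "Frag d H = (\<Union>(verts ` {K \<in> components_of H. unicycle d K}),
               \<Union>(edges ` {K \<in> components_of H. unicycle d K}))"

definition iso_hypergraph :: "'a hypergraph \<Rightarrow> 'b hypergraph \<Rightarrow> bool"  (infix \<open>\<simeq>\<^sub>H\<close> 50) where
  "H \<simeq>\<^sub>H K \<longleftrightarrow> (\<exists>f. bij_betw f (verts H) (verts K) \<and> edges K = (\<lambda>e. f ` e) ` edges H)"

text \<open>
  An unlabeled hypergraph is an isomorphism class of hypergraphs with vertices in \<^typ>\<open>nat\<close>
  (every finite hypergraph has a copy there).  The empty hypergraph has no components, so its
  class belongs to \<open>unicyclic_family\<close>.
\<close>

definition unicyclic_family :: "nat \<Rightarrow> nat hypergraph set set" where
  "unicyclic_family d =
     {H. uniform_hypergraph d H \<and> (\<forall>K\<in>components_of H. unicycle d K)} // {(H, K). H \<simeq>\<^sub>H K}"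


section \<open>First order logic of \<open>d\<close>-uniform hypergraphs\<close>

text \<open>Variables are natural numbers; the remaining connectives and the universal quantifier are
  definable.\<close>

datatype fo =
    Eq nat nat
  | Edge "nat list"
  | Neg fo
  | Conj fo fo
  | Ex nat fo

primrec fo_formula :: "nat \<Rightarrow> fo \<Rightarrow> bool" where
  "fo_formula d (Eq x y) \<longleftrightarrow> True"
| "fo_formula d (Edge xs) \<longleftrightarrow> length xs = d"
| "fo_formula d (Neg \<phi>) \<longleftrightarrow> fo_formula d \<phi>"
| "fo_formula d (Conj \<phi> \<psi>) \<longleftrightarrow> fo_formula d \<phi> \<and> fo_formula d \<psi>"
| "fo_formula d (Ex x \<phi>) \<longleftrightarrow> fo_formula d \<phi>"

primrec free_vars :: "fo \<Rightarrow> nat set" where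
  "free_vars (Eq x y) = {x, y}"
| "free_vars (Edge xs) = set xs"
| "free_vars (Neg \<phi>) = free_vars \<phi>"
| "free_vars (Conj \<phi> \<psi>) = free_vars \<phi> \<union> free_vars \<psi>"
| "free_vars (Ex x \<phi>) = free_vars \<phi> - {x}"

definition fo_sentence :: "nat \<Rightarrow> fo \<Rightarrow> bool" where
  "fo_sentence d \<phi> \<longleftrightarrow> fo_formula d \<phi> \<and> free_vars \<phi> = {}"

primrec sat :: "'a hypergraph \<Rightarrow> (nat \<Rightarrow> 'a) \<Rightarrow> fo \<Rightarrow> bool" where
  "sat H \<sigma> (Eq x y) \<longleftrightarrow> \<sigma> x = \<sigma> y"
| "sat H \<sigma> (Edge xs) \<longleftrightarrow> distinct (map \<sigma> xs) \<and> set (map \<sigma> xs) \<in> edges H"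
| "sat H \<sigma> (Neg \<phi>) \<longleftrightarrow> \<not> sat H \<sigma> \<phi>"
| "sat H \<sigma> (Conj \<phi> \<psi>) \<longleftrightarrow> sat H \<sigma> \<phi> \<and> sat H \<sigma> \<psi>"
| "sat H \<sigma> (Ex x \<phi>) \<longleftrightarrow> (\<exists>a\<in>verts H. sat H (\<sigma>(x := a)) \<phi>)"

text \<open>For a sentence the assignment is irrelevant.\<close>

definition models :: "'a hypergraph \<Rightarrow> fo \<Rightarrow> bool"  (infix \<open>\<Turnstile>\<^sub>H\<close> 50) where
  "H \<Turnstile>\<^sub>H \<phi> \<longleftrightarrow> (\<forall>\<sigma>. sat H \<sigma> \<phi>)"

lemma sat_cong:
  "(\<And>x. x \<in> free_vars \<phi> \<Longrightarrow> \<sigma> x = \<tau> x) \<Longrightarrow> sat H \<sigma> \<phi> \<longleftrightarrow> sat H \<tau> \<phi>"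
proof (induction \<phi> arbitrary: \<sigma> \<tau>)
  case (Edge xs)
  then have "map \<sigma> xs = map \<tau> xs" by simp
  then show ?case by (simp only: sat.simps)
next
  case (Neg \<phi>)
  from Neg.IH[of \<sigma> \<tau>] Neg.prems show ?case by simp
next
  case (Conj \<phi> \<psi>)
  from Conj.IH(1)[of \<sigma> \<tau>] Conj.IH(2)[of \<sigma> \<tau>] Conj.prems show ?case by simp
next
  case (Ex x \<phi>)
  have "sat H (\<sigma>(x := a)) \<phi> \<longleftrightarrow> sat H (\<tau>(x := a)) \<phi>" for a
    by (rule Ex.IH) (use Ex.prems in auto)
  then show ?case by simp
qed simp

lemma models_iff_sat: "fo_sentence d \<phi> \<Longrightarrow> H \<Turnstile>\<^sub>H \<phi> \<longleftrightarrow> sat H \<sigma> \<phi>"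
proof -
  assume "fo_sentence d \<phi>"
  then have "sat H \<tau> \<phi> \<longleftrightarrow> sat H \<sigma> \<phi>" for \<tau>
    by (intro sat_cong) (simp add: fo_sentence_def)
  then show ?thesis unfolding models_def by blast
qed


section \<open>The random hypergraph\<close>

text \<open>\<^const>\<open>bernoulli_pmf\<close> truncates its parameter to the unit interval; for
  \<open>p = c / n ^ (d - 1)\<close> this concerns only finitely many \<open>n\<close>.\<close>

definition random_hypergraph :: "nat \<Rightarrow> nat \<Rightarrow> real \<Rightarrow> nat hypergraph pmf" where
  "random_hypergraph d n p =
     (let D = {e. e \<subseteq> {1..n} \<and> card e = d}
      in map_pmf (\<lambda>f. ({1..n}, {e \<in> D. f e})) (Pi_pmf D False (\<lambda>_. bernoulli_pmf p)))"

definition G :: "nat \<Rightarrow> real \<Rightarrow> nat \<Rightarrow> nat hypergraph pmf" where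
  "G d c n = random_hypergraph d n (c / real n ^ (d - 1))"

definition fo_prob :: "nat \<Rightarrow> real \<Rightarrow> fo \<Rightarrow> nat \<Rightarrow> real" where
  "fo_prob d c \<phi> n = measure_pmf.prob (G d c n) {H. H \<Turnstile>\<^sub>H \<phi>}"

definition L :: "nat \<Rightarrow> real \<Rightarrow> real set" where
  "L d c = {lim (fo_prob d c \<phi>) |\<phi>. fo_sentence d \<phi>}"

text \<open>As \<open>C\<close> is an isomorphism class, membership in \<open>C\<close> says that the fragment is isomorphic to
  the unlabeled hypergraph \<open>C\<close>.\<close>

definition frag_prob :: "nat \<Rightarrow> real \<Rightarrow> nat hypergraph set \<Rightarrow> nat \<Rightarrow> real" where
  "frag_prob d c C n = measure_pmf.prob (G d c n) {H. Frag d H \<in> C}"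

definition p_lim :: "nat \<Rightarrow> real \<Rightarrow> nat hypergraph set \<Rightarrow> real" where
  "p_lim d c C = lim (frag_prob d c C)"

definition S :: "nat \<Rightarrow> real \<Rightarrow> real set" where
  "S d c = {\<Sum>\<^sub>\<infinity>C\<in>T. p_lim d c C |T. T \<subseteq> unicyclic_family d}"

end

theory Submission
  imports Defs "HOL-Library.Nat_Bijection"
begin

text \<open>
  Write \<open>p = c / n ^ (d - 1)\<close>.  Since \<open>c < fact (d - 2)\<close>, counting lollipops (a closed walk with a
  walk attached to it) bounds the expected number of vertices in components containing a cycle,
  uniformly in \<open>n\<close>.  By Markov's inequality the size of the fragment is tight; and components of
  positive excess disappear, because there are few of bounded size and large ones are unlikely.

  Removing the fragment gives \<open>P(Frag \<simeq> H) = a * (n choose v) * p ^ k * (1 - p) ^ m * q(n - v, p)\<close> where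
  \<open>q\<close> is the probability of having no unicyclic component.  The weight in front of \<open>q\<close> converges, and
  \<open>q(n - v, p) - q(n, p)\<close> tends to \<open>0\<close> because a given vertex is unlikely to lie in a component with a
  cycle.  Summing over the classes of size at most \<open>M\<close> gives almost \<open>1\<close>, whence \<open>q(n, p)\<close> is Cauchy
  and all the probabilities converge, with limits that add up to \<open>1\<close>.

  The same removal applied to one component isomorphic to a tree \<open>T\<close> relates the probability of
  having \<open>j\<close> such components to that of having \<open>j + 1\<close>, and shows that any fixed number of them is
  exceeded with probability tending to \<open>1\<close>.  As there are finitely many types of quantifier rank \<open>k\<close>,
  an Ehrenfeucht game shows that with probability tending to \<open>1\<close> the truth of a sentence only depends
  on the fragment.  Conversely, whether a fragment with at most \<open>M\<close> vertices belongs to a given set of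
  classes is first order expressible.  Finally, the set of subsums of a convergent series is compact.
\<close>

text \<open>The bound on \<open>c\<close> acts through a single product. A walk is extended by
  choosing the next vertex, in at most \<open>n\<close> ways, and an edge through two given
  vertices, in at most \<open>n ^ (d - 2) / fact (d - 2)\<close> ways; times \<open>p\<close> this
  is exactly \<open>c / fact (d - 2) < 1\<close>, so lollipops are summed by geometric series. The
  obstacle is that q(n, p) is not known to converge beforehand. Each class probability is only a
  convergent weight times q(n, p), up to a vanishing error; it is the total mass 1, prevented by
  tightness from escaping to large fragments, that pins q down. For trees, (j + 1) P(j + 1 copies on
  n + v vertices) equals a weight times P(j copies on n vertices), with the same \<open>p\<close> on
  both sides. Negative excess makes the weight grow with n, while the left side is at most j + 1;
  hence the second probability vanishes. The closure enters because a sentence is made to prescribe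
  the class only of fragments of at most \<open>M\<close> vertices; its behaviour on larger ones is
  controlled merely through their probability.\<close>

section \<open>Closed vertex sets and components\<close>

definition induced :: "'a hypergraph \<Rightarrow> 'a set \<Rightarrow> 'a hypergraph" where
  "induced H W = (W, {e \<in> edges H. e \<subseteq> W})"

text \<open>When all edges consist of vertices, the closed sets are the unions of components, and
  the components are the connected closed sets. This form passes to induced subhypergraphs and along
  isomorphisms more directly than the quotient in \<open>components_of\<close>.\<close>

definition closed_in :: "'a hypergraph \<Rightarrow> 'a set \<Rightarrow> bool" where
  "closed_in H W \<longleftrightarrow> W \<subseteq> verts H \<and> (\<forall>e\<in>edges H. e \<inter> W \<noteq> {} \<longrightarrow> e \<subseteq> W)"

definition adj :: "'a set set \<Rightarrow> ('a \<times> 'a) set" where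
  "adj E = {(x, y). \<exists>e\<in>E. x \<in> e \<and> y \<in> e}"

lemma linked_adj: "linked H = {(u, v). u \<in> verts H \<and> v \<in> verts H \<and> (u, v) \<in> (adj (edges H))\<^sup>*}"
  unfolding linked_def adj_def by simp

lemma verts_induced [simp]: "verts (induced H W) = W"
  and edges_induced [simp]: "edges (induced H W) = {e \<in> edges H. e \<subseteq> W}"
  by (simp_all add: induced_def)

lemma induced_induced: "U \<subseteq> W \<Longrightarrow> induced (induced H W) U = induced H U"
  by (auto simp: induced_def)

lemma sym_adj: "sym (adj E)"
  by (auto simp: adj_def sym_def)

lemma adj_rtrancl_sym: "(x, y) \<in> (adj E)\<^sup>* \<Longrightarrow> (y, x) \<in> (adj E)\<^sup>*"
  by (meson sym_adj sym_rtrancl symD)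

lemma adj_rtrancl_mono: "E \<subseteq> E' \<Longrightarrow> (x, y) \<in> (adj E)\<^sup>* \<Longrightarrow> (x, y) \<in> (adj E')\<^sup>*"
  by (rule rtrancl_mono[THEN subsetD, of "adj E"]) (auto simp: adj_def)

lemma closed_in_adj_rtrancl:
  assumes "closed_in H W" "(x, y) \<in> (adj (edges H))\<^sup>*" "x \<in> W"
  shows "y \<in> W \<and> (x, y) \<in> (adj (edges (induced H W)))\<^sup>*"
  using assms(2)
proof (induction rule: rtrancl_induct)
  case (step y z)
  then obtain e where "e \<in> edges H" "y \<in> e" "z \<in> e" by (auto simp: adj_def)
  then have "e \<subseteq> W" using step.IH assms(1) by (auto simp: closed_in_def)
  then have "(y, z) \<in> adj (edges (induced H W))" "z \<in> W"
    using \<open>e \<in> edges H\<close> \<open>y \<in> e\<close> \<open>z \<in> e\<close> by (auto simp: adj_def)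
  then show ?case using step.IH by (meson rtrancl.rtrancl_into_rtrancl)
qed (simp add: assms(3))

lemma equiv_linked: "equiv (verts H) (linked H)"
  by (auto simp: equiv_def refl_on_def sym_def trans_def linked_adj intro: adj_rtrancl_sym)

lemma closed_in_link_class:
  assumes "\<forall>e\<in>edges H. e \<subseteq> verts H"
  shows "closed_in H (linked H `` {x})"
  unfolding closed_in_def
proof (intro conjI ballI impI)
  show "linked H `` {x} \<subseteq> verts H" by (auto simp: linked_adj)
  fix e assume e: "e \<in> edges H" "e \<inter> linked H `` {x} \<noteq> {}"
  then obtain y where y: "y \<in> e" "x \<in> verts H" "(x, y) \<in> (adj (edges H))\<^sup>*"
    by (auto simp: linked_adj)
  show "e \<subseteq> linked H `` {x}"
  proof
    fix z assume "z \<in> e"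
    then have "(y, z) \<in> adj (edges H)" using e y by (auto simp: adj_def)
    with y have "(x, z) \<in> (adj (edges H))\<^sup>*" by (meson rtrancl.rtrancl_into_rtrancl)
    then show "z \<in> linked H `` {x}" using assms e \<open>z \<in> e\<close> y by (auto simp: linked_adj)
  qed
qed

text \<open>Two connected closed sets with a common vertex are both its linkage class and hence
  equal; distinct components are kept apart by this.\<close>

lemma connected_closed_eq_link_class:
  assumes "closed_in H W" "connected_hypergraph (induced H W)" "x \<in> W"
  shows "W = linked H `` {x}"
proof
  have sub: "W \<subseteq> verts H" using assms(1) by (simp add: closed_in_def)
  show "W \<subseteq> linked H `` {x}"
  proof
    fix y assume y: "y \<in> W"
    then have "(x, y) \<in> (adj (edges (induced H W)))\<^sup>*"
      using assms(2,3) by (auto simp: connected_hypergraph_def linked_adj)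
    then have "(x, y) \<in> (adj (edges H))\<^sup>*" by (rule adj_rtrancl_mono[rotated]) auto
    then show "y \<in> linked H `` {x}" using sub y assms(3) by (auto simp: linked_adj)
  qed
  show "linked H `` {x} \<subseteq> W"
    using closed_in_adj_rtrancl[OF assms(1) _ assms(3)] by (auto simp: linked_adj)
qed

lemma connected_link_class:
  assumes "\<forall>e\<in>edges H. e \<subseteq> verts H" "x \<in> verts H"
  shows "connected_hypergraph (induced H (linked H `` {x}))"
proof -
  let ?W = "linked H `` {x}"
  have x: "x \<in> ?W" using assms(2) by (auto simp: linked_adj)
  have *: "(x, y) \<in> (adj (edges (induced H ?W)))\<^sup>*" if "y \<in> ?W" for y
  proof -
    have "(x, y) \<in> (adj (edges H))\<^sup>*" using that by (simp add: linked_adj)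
    from closed_in_adj_rtrancl[OF closed_in_link_class[OF assms(1), of x] this x]
    show ?thesis by blast
  qed
  have "(y, z) \<in> (adj (edges (induced H ?W)))\<^sup>*" if "y \<in> ?W" "z \<in> ?W" for y z
    using adj_rtrancl_sym[OF *[OF that(1)]] *[OF that(2)] by (rule rtrancl_trans)
  then show ?thesis using x unfolding connected_hypergraph_def linked_adj by auto
qed

lemma components_of_iff:
  assumes "\<forall>e\<in>edges H. e \<subseteq> verts H"
  shows "K \<in> components_of H \<longleftrightarrow>
    (\<exists>W. K = induced H W \<and> closed_in H W \<and> connected_hypergraph (induced H W))"
proof
  assume "K \<in> components_of H"
  then obtain x where "x \<in> verts H" "K = induced H (linked H `` {x})"
    unfolding components_of_def quotient_def induced_def by auto
  then show "\<exists>W. K = induced H W \<and> closed_in H W \<and> connected_hypergraph (induced H W)"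
    using closed_in_link_class[OF assms] connected_link_class[OF assms] by blast
next
  assume "\<exists>W. K = induced H W \<and> closed_in H W \<and> connected_hypergraph (induced H W)"
  then obtain W where W: "K = induced H W" "closed_in H W" "connected_hypergraph (induced H W)"
    by blast
  then obtain x where x: "x \<in> W" by (auto simp: connected_hypergraph_def)
  have "W = linked H `` {x}" by (rule connected_closed_eq_link_class[OF W(2,3) x])
  moreover have "x \<in> verts H" using W(2) x by (auto simp: closed_in_def)
  ultimately have "W \<in> verts H // linked H" by (metis quotientI)
  then show "K \<in> components_of H" unfolding components_of_def W induced_def by auto
qed

lemma closed_in_induced:
  assumes "closed_in H W" "U \<subseteq> W" "\<forall>e\<in>edges H. e \<noteq> {}"
  shows "closed_in (induced H W) U \<longleftrightarrow> closed_in H U"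
proof
  assume U: "closed_in (induced H W) U"
  have "e \<subseteq> U" if "e \<in> edges H" "e \<inter> U \<noteq> {}" for e
  proof -
    have "e \<subseteq> W" using that assms(1,2) unfolding closed_in_def by blast
    then show ?thesis using U that unfolding closed_in_def by simp
  qed
  then show "closed_in H U" using assms(1,2) by (auto simp: closed_in_def)
next
  assume "closed_in H U"
  then show "closed_in (induced H W) U" using assms(2) by (simp add: closed_in_def)
qed

lemma closed_in_Diff: "closed_in H W \<Longrightarrow> \<forall>e\<in>edges H. e \<subseteq> verts H \<Longrightarrow> closed_in H (verts H - W)"
  unfolding closed_in_def by blast

lemma closed_in_Union: "(\<And>W. W \<in> \<W> \<Longrightarrow> closed_in H W) \<Longrightarrow> closed_in H (\<Union>\<W>)"
  unfolding closed_in_def by blast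

lemma connected_closed_cases:
  assumes "closed_in H W" "closed_in H U" "connected_hypergraph (induced H U)"
  shows "U \<subseteq> W \<or> U \<inter> W = {}"
proof (rule ccontr)
  assume "\<not> ?thesis"
  then obtain x y where xy: "x \<in> U" "x \<in> W" "y \<in> U" "y \<notin> W" by blast
  have "y \<in> linked H `` {x}"
    using connected_closed_eq_link_class[OF assms(2,3) xy(1)] xy by simp
  then have "(x, y) \<in> (adj (edges H))\<^sup>*" by (auto simp: linked_adj)
  from closed_in_adj_rtrancl[OF assms(1) this xy(2)] xy(4) show False by simp
qed

section \<open>Cyclic edges\<close>

text \<open>The edge lies on a Berge cycle. Two edges sharing two vertices already form such a
  cycle, of length two.\<close>

definition cyclic_edge :: "'a set set \<Rightarrow> 'a set \<Rightarrow> bool" where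
  "cyclic_edge E e \<longleftrightarrow> e \<in> E \<and> (\<exists>u\<in>e. \<exists>w\<in>e. u \<noteq> w \<and> (u, w) \<in> (adj (E - {e}))\<^sup>*)"

lemma cyclic_edge_mono: "cyclic_edge E e \<Longrightarrow> E \<subseteq> E' \<Longrightarrow> cyclic_edge E' e"
  unfolding cyclic_edge_def by (meson Diff_mono adj_rtrancl_mono order_refl subsetD)

text \<open>Induction on the number of edges. Remove an edge \<open>e\<close>: as it is not cyclic,
  its \<open>d\<close> vertices fall into disjoint parts closed under the other edges, and each part
  satisfies the bound. Of the \<open>d\<close> summands 1, all but one pay for \<open>e\<close>.
  There is only an inequality because \<open>V\<close> may be disconnected.\<close>

lemma acyclic_card_verts:
  fixes V :: "'a set"
  assumes "finite V" "V \<noteq> {}" "d \<ge> 1" "\<forall>e\<in>E. e \<subseteq> V \<and> card e = d" "\<forall>e. \<not> cyclic_edge E e"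
  shows "(d - 1) * card E + 1 \<le> card V"
  using assms(1,2,4,5)
proof (induction "card E" arbitrary: V E rule: less_induct)
  case less
  note fV = less.prems(1)
  have fE: "finite E" using less.prems by (meson Pow_iff finite_Pow_iff finite_subset subsetI)
  show ?case
  proof (cases "E = {}")
    case True
    then show ?thesis using less.prems by (simp add: Suc_le_eq card_gt_0_iff)
  next
    case False
    then obtain e where e: "e \<in> E" by blast
    with less.prems have ce: "card e = d" "e \<subseteq> V" by auto
    with assms(3) have fe: "finite e" "e \<noteq> {}" using fV finite_subset by auto
    then obtain x0 where x0: "x0 \<in> e" by blast
    define E' where "E' = E - {e}"
    \<comment> \<open>One vertex \<open>x0\<close> of \<open>e\<close> receives everything not
      reached from the others, so that the parts cover \<open>V\<close>.\<close>
    define C where "C x = (if x = x0 then V - (\<Union>y\<in>e - {x0}. (adj E')\<^sup>* `` {y} \<inter> V) else (adj E')\<^sup>* `` {x} \<inter> V)" for x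
    have dj: "(adj E')\<^sup>* `` {x} \<inter> (adj E')\<^sup>* `` {y} = {}" if "x \<in> e" "y \<in> e" "x \<noteq> y" for x y
    proof (rule ccontr)
      assume "\<not> ?thesis"
      then obtain z where "(x, z) \<in> (adj E')\<^sup>*" "(y, z) \<in> (adj E')\<^sup>*" by blast
      then have "(x, y) \<in> (adj E')\<^sup>*" by (meson adj_rtrancl_sym rtrancl_trans)
      then have "cyclic_edge E e" using e that by (auto simp: cyclic_edge_def E'_def)
      then show False using less.prems by blast
    qed
    have xC: "x \<in> C x" if "x \<in> e" for x
      using that ce dj[of x0] unfolding C_def by auto
    have disj: "C x \<inter> C y = {}" if "x \<in> e" "y \<in> e" "x \<noteq> y" for x y
      using dj[OF that] that unfolding C_def by auto
    have cl: "f \<subseteq> C x" if f: "f \<in> E'" "z \<in> f" "z \<in> C x" for f z x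
    proof -
      have fV: "f \<subseteq> V" using f less.prems by (auto simp: E'_def)
      have *: "w \<in> (adj E')\<^sup>* `` {y} \<longleftrightarrow> z \<in> (adj E')\<^sup>* `` {y}" if "w \<in> f" for w y
      proof -
        have "(w, z) \<in> adj E'" "(z, w) \<in> adj E'" using f that by (auto simp: adj_def)
        then show ?thesis by (auto intro: rtrancl_into_rtrancl)
      qed
      have "w \<in> C x" if "w \<in> f" for w
      proof -
        have "w \<in> V" "z \<in> V" using that fV f(2) by auto
        have "w \<in> C x \<longleftrightarrow> z \<in> C x"
          unfolding C_def using \<open>w \<in> V\<close> \<open>z \<in> V\<close> by (simp add: *[OF that] del: Image_singleton_iff)
        then show ?thesis using f(3) by simp
      qed
      then show ?thesis by blast
    qed
    have CV: "C x \<subseteq> V" for x unfolding C_def by auto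
    have cov: "V \<subseteq> (\<Union>x\<in>e. C x)" using x0 unfolding C_def by auto
    have step: "(d - 1) * card {f \<in> E'. f \<subseteq> C x} + 1 \<le> card (C x)" if "x \<in> e" for x
    proof (rule less.hyps)
      show "card {f \<in> E'. f \<subseteq> C x} < card E"
        using fE e by (intro psubset_card_mono) (auto simp: E'_def)
      show "finite (C x)" using CV fV finite_subset by blast
      show "C x \<noteq> {}" using xC[OF that] by blast
      show "\<forall>ea\<in>{f \<in> E'. f \<subseteq> C x}. ea \<subseteq> C x \<and> card ea = d"
        using less.prems by (auto simp: E'_def)
      show "\<forall>ea. \<not> cyclic_edge {f \<in> E'. f \<subseteq> C x} ea"
        using less.prems(4) cyclic_edge_mono[of "{f \<in> E'. f \<subseteq> C x}" _ E] by (auto simp: E'_def)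
    qed
    have E'eq: "E' = (\<Union>x\<in>e. {f \<in> E'. f \<subseteq> C x})"
    proof -
      have "\<exists>x\<in>e. f \<subseteq> C x" if "f \<in> E'" for f
      proof -
        have "f \<noteq> {}" "f \<subseteq> V" using that less.prems assms(3) by (auto simp: E'_def)
        then show ?thesis using cov cl[OF that] by blast
      qed
      then show ?thesis by blast
    qed
    have "card E' = (\<Sum>x\<in>e. card {f \<in> E'. f \<subseteq> C x})"
    proof (subst E'eq, rule card_UN_disjoint)
      show "\<forall>i\<in>e. finite {f \<in> E'. f \<subseteq> C i}" using fE by (simp add: E'_def)
      have ne: "f \<noteq> {}" if "f \<in> E'" for f using that less.prems assms(3) by (auto simp: E'_def)
      show "\<forall>i\<in>e. \<forall>j\<in>e. i \<noteq> j \<longrightarrow> {f \<in> E'. f \<subseteq> C i} \<inter> {f \<in> E'. f \<subseteq> C j} = {}"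
        using disj ne by blast
    qed (rule fe)
    moreover have "(\<Sum>x\<in>e. (d - 1) * card {f \<in> E'. f \<subseteq> C x} + 1) \<le> (\<Sum>x\<in>e. card (C x))"
      by (rule sum_mono) (rule step)
    moreover have "(\<Sum>x\<in>e. card (C x)) = card (\<Union>x\<in>e. C x)"
    proof (rule card_UN_disjoint[symmetric])
      show "\<forall>i\<in>e. finite (C i)" using finite_subset[OF CV fV] by simp
      show "\<forall>i\<in>e. \<forall>j\<in>e. i \<noteq> j \<longrightarrow> C i \<inter> C j = {}" using disj by simp
    qed (rule fe)
    moreover have "card (\<Union>x\<in>e. C x) \<le> card V" using CV by (intro card_mono fV) auto
    moreover have "card E = card E' + 1" using card.remove[OF fE e] by (simp add: E'_def)
    moreover have "(\<Sum>x\<in>e. (d - 1) * card {f \<in> E'. f \<subseteq> C x} + 1) =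
        (d - 1) * (\<Sum>x\<in>e. card {f \<in> E'. f \<subseteq> C x}) + d"
      unfolding sum.distrib sum_distrib_left[symmetric] using ce by simp
    ultimately have "(d - 1) * card E' + d \<le> card V" by simp
    moreover have "(d - 1) * card E' + d = (d - 1) * card E + 1"
      using assms(3) \<open>card E = card E' + 1\<close> by (cases d) simp_all
    ultimately show ?thesis by simp
  qed
qed

section \<open>Walks\<close>

text \<open>A step records the edge used and the vertex reached. Consecutive vertices differ, so
  that \<open>card_dsets_through_pair\<close> applies to the edge of each step.\<close>

fun walk :: "'a \<Rightarrow> ('a set \<times> 'a) list \<Rightarrow> 'a \<Rightarrow> bool" where
  "walk x [] y \<longleftrightarrow> x = y"
| "walk x ((e, v) # ps) y \<longleftrightarrow> x \<in> e \<and> v \<in> e \<and> x \<noteq> v \<and> walk v ps y"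

lemma walk_append: "walk x (ps @ qs) y \<longleftrightarrow> (\<exists>z. walk x ps z \<and> walk z qs y)"
  by (induction ps arbitrary: x) auto

lemma walk_unique: "walk x ps y \<Longrightarrow> walk x ps z \<Longrightarrow> y = z"
  by (induction ps arbitrary: x) auto

lemma distinct_walk_exists:
  assumes "(x, y) \<in> (adj E)\<^sup>*"
  shows "\<exists>ps. walk x ps y \<and> distinct (map fst ps) \<and> fst ` set ps \<subseteq> E"
  using assms
proof (induction rule: rtrancl_induct)
  case base
  then show ?case by (intro exI[of _ "[]"]) simp
next
  case (step y z)
  then obtain ps where ps: "walk x ps y" "distinct (map fst ps)" "fst ` set ps \<subseteq> E" by blast
  from step obtain e where e: "e \<in> E" "y \<in> e" "z \<in> e" by (auto simp: adj_def)
  consider "y = z" | "y \<noteq> z" "e \<notin> fst ` set ps" | "e \<in> fst ` set ps" by blast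
  then show ?case
  proof cases
    case 1 with ps show ?thesis by blast
  next
    case 2
    with ps e show ?thesis
      by (intro exI[of _ "ps @ [(e, z)]"]) (auto simp: walk_append)
  next
    \<comment> \<open>The edge \<open>e\<close> has been used already. Cut the walk where it is
      about to use \<open>e\<close>, at a vertex \<open>u\<close> of \<open>e\<close>, and go to
      \<open>z\<close> by one step through \<open>e\<close>, or by none if
      \<open>u = z\<close>.\<close>
    case 3
    then obtain v where "(e, v) \<in> set ps" by auto
    then obtain ps1 ps2 where eq: "ps = ps1 @ (e, v) # ps2" by (meson split_list)
    with ps obtain u where u: "walk x ps1 u" "u \<in> e" by (auto simp: walk_append)
    show ?thesis
    proof (cases "u = z")
      case True
      then show ?thesis using u ps eq by (intro exI[of _ ps1]) auto
    next
      case False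
      then show ?thesis using u ps eq e
        by (intro exI[of _ "ps1 @ [(e, z)]"]) (auto simp: walk_append)
    qed
  qed
qed

text \<open>The vertices of the components that contain a cycle. By
  \<open>excess_nonneg_cyclic_verts\<close> all unicyclic and all complex components lie here, so
  one expectation controls both.\<close>

definition cyclic_verts :: "'a set set \<Rightarrow> 'a set" where
  "cyclic_verts E = {y. \<exists>e u. cyclic_edge E e \<and> u \<in> e \<and> (u, y) \<in> (adj E)\<^sup>*}"

text \<open>The closed walk joins two vertices of \<open>e\<close> avoiding \<open>e\<close> and
  returns through \<open>e\<close>. A walk from \<open>e\<close> to \<open>y\<close> is cut after
  the last edge it shares with \<open>cs\<close>; the vertex where it leaves that edge need not be
  visited by \<open>cs\<close>, so \<open>x\<close> ranges over all vertices of edges of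
  \<open>cs\<close>. Distinct edges make the probability of the configuration an exact power of
  \<open>p\<close>.\<close>

lemma cyclic_verts_lollipop:
  assumes "y \<in> cyclic_verts E"
  shows "\<exists>u cs x ps. cs \<noteq> [] \<and> walk u cs u \<and> x \<in> \<Union>(fst ` set cs) \<and> walk x ps y \<and>
    distinct (map fst (cs @ ps)) \<and> fst ` set (cs @ ps) \<subseteq> E"
proof -
  obtain e u0 where e: "cyclic_edge E e" "u0 \<in> e" "(u0, y) \<in> (adj E)\<^sup>*"
    using assms unfolding cyclic_verts_def by blast
  then obtain u w where uw: "u \<in> e" "w \<in> e" "u \<noteq> w" "(u, w) \<in> (adj (E - {e}))\<^sup>*" "e \<in> E"
    by (auto simp: cyclic_edge_def)
  from distinct_walk_exists[OF uw(4)] obtain qs where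
    qs: "walk u qs w" "distinct (map fst qs)" "fst ` set qs \<subseteq> E - {e}" by blast
  define cs where "cs = qs @ [(e, u)]"
  have cs: "cs \<noteq> []" "walk u cs u" "distinct (map fst cs)" "fst ` set cs \<subseteq> E" "e \<in> fst ` set cs"
    using qs uw by (auto simp: cs_def walk_append)
  from distinct_walk_exists[OF e(3)] obtain ps where
    ps: "walk u0 ps y" "distinct (map fst ps)" "fst ` set ps \<subseteq> E" by blast
  have "\<exists>x ps. x \<in> \<Union>(fst ` set cs) \<and> walk x ps y \<and> distinct (map fst ps) \<and> fst ` set ps \<subseteq> E \<and>
      fst ` set ps \<inter> fst ` set cs = {}"
  proof (cases "\<exists>p\<in>set ps. fst p \<in> fst ` set cs")
    case False
    then show ?thesis using ps e(2) cs(5) by (intro exI[of _ u0] exI[of _ ps]) auto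
  next
    case True
    then obtain p ps1 ps2 where eq: "ps = ps1 @ p # ps2" "fst p \<in> fst ` set cs"
      "\<forall>q\<in>set ps2. \<not> fst q \<in> fst ` set cs"
      using split_list_last_prop[of ps "\<lambda>p. fst p \<in> fst ` set cs"] by blast
    obtain f v where p: "p = (f, v)" by fastforce
    have "walk v ps2 y" "v \<in> f" using ps(1) eq(1) p by (auto simp: walk_append)
    then show ?thesis using ps eq p by (intro exI[of _ v] exI[of _ ps2]) auto
  qed
  then show ?thesis using cs by (metis (no_types, lifting) distinct_append image_Un le_sup_iff
        map_append set_append set_map inf_commute)
qed

section \<open>Isomorphisms\<close>

abbreviation wf_hypergraph :: "'a hypergraph \<Rightarrow> bool" where
  "wf_hypergraph H \<equiv> \<forall>e\<in>edges H. e \<subseteq> verts H"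

definition iso_via :: "('a \<Rightarrow> 'b) \<Rightarrow> 'a hypergraph \<Rightarrow> 'b hypergraph \<Rightarrow> bool" where
  "iso_via f H K \<longleftrightarrow> bij_betw f (verts H) (verts K) \<and> edges K = (`) f ` edges H"

lemma iso_hypergraph_iff: "H \<simeq>\<^sub>H K \<longleftrightarrow> (\<exists>f. iso_via f H K)"
  by (simp add: iso_hypergraph_def iso_via_def)

text \<open>The map is injective on vertices only, so edges have to consist of vertices. On
  arbitrary pairs isomorphism is not symmetric: an edge outside the vertex set may be
  collapsed.\<close>

lemma iso_via_inv:
  assumes "wf_hypergraph H" "iso_via f H K"
  shows "iso_via (inv_into (verts H) f) K H"
proof -
  have f: "bij_betw f (verts H) (verts K)" "edges K = (`) f ` edges H"
    using assms(2) by (auto simp: iso_via_def)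
  have "inv_into (verts H) f ` f ` e = e" if "e \<in> edges H" for e
    using assms(1) that f(1) by (meson bij_betw_def inv_into_image_cancel)
  then have "edges H = (`) (inv_into (verts H) f) ` edges K"
    unfolding f(2) by (auto simp: image_image)
  then show ?thesis using bij_betw_inv_into[OF f(1)] by (simp add: iso_via_def)
qed

lemma iso_via_comp: "iso_via f H K \<Longrightarrow> iso_via g K M \<Longrightarrow> iso_via (g \<circ> f) H M"
  unfolding iso_via_def by (auto intro: bij_betw_trans simp: image_image image_comp)

lemma iso_hypergraph_refl: "H \<simeq>\<^sub>H H"
  unfolding iso_hypergraph_iff iso_via_def by (intro exI[of _ id]) auto

lemma iso_hypergraph_sym: "wf_hypergraph H \<Longrightarrow> H \<simeq>\<^sub>H K \<Longrightarrow> K \<simeq>\<^sub>H H"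
  unfolding iso_hypergraph_iff using iso_via_inv by blast

lemma iso_hypergraph_trans: "H \<simeq>\<^sub>H K \<Longrightarrow> K \<simeq>\<^sub>H M \<Longrightarrow> H \<simeq>\<^sub>H M"
  unfolding iso_hypergraph_iff using iso_via_comp by blast

lemma iso_via_induced:
  assumes "wf_hypergraph H" "iso_via f H K" "W \<subseteq> verts H"
  shows "iso_via f (induced H W) (induced K (f ` W))"
proof -
  have f: "bij_betw f (verts H) (verts K)" "edges K = (`) f ` edges H" "inj_on f (verts H)"
    using assms(2) by (auto simp: iso_via_def bij_betw_def)
  have "f ` e \<subseteq> f ` W \<longleftrightarrow> e \<subseteq> W" if "e \<in> edges H" for e
    using that assms(1,3) f(3) by (meson inj_on_image_subset_iff)
  then have "{e \<in> edges K. e \<subseteq> f ` W} = (`) f ` {e \<in> edges H. e \<subseteq> W}"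
    unfolding f(2) by auto
  moreover have "bij_betw f W (f ` W)" using f(3) assms(3) by (meson bij_betw_subset f(1) order_refl)
  ultimately show ?thesis by (simp add: iso_via_def)
qed

lemma iso_via_closed_in:
  assumes "wf_hypergraph H" "iso_via f H K" "closed_in H W"
  shows "closed_in K (f ` W)"
proof -
  have f: "f ` verts H = verts K" "edges K = (`) f ` edges H" "inj_on f (verts H)"
    using assms(2) by (auto simp: iso_via_def bij_betw_def)
  have W: "W \<subseteq> verts H" using assms(3) by (simp add: closed_in_def)
  have "f ` e \<subseteq> f ` W" if "e \<in> edges H" "f ` e \<inter> f ` W \<noteq> {}" for e
  proof -
    have "f ` e \<inter> f ` W = f ` (e \<inter> W)"
      using that assms(1) W f(3) by (metis inj_on_image_Int)
    then have "e \<inter> W \<noteq> {}" using that by auto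
    then show ?thesis using that assms(3) by (auto simp: closed_in_def)
  qed
  then show ?thesis using W unfolding closed_in_def f(2) f(1)[symmetric] by auto
qed

lemma iso_via_adj_rtrancl:
  assumes "edges K = (`) f ` edges H" "(x, y) \<in> (adj (edges H))\<^sup>*"
  shows "(f x, f y) \<in> (adj (edges K))\<^sup>*"
  using assms(2)
proof (induction rule: rtrancl_induct)
  case (step y z)
  then have "(f y, f z) \<in> adj (edges K)" unfolding assms(1) adj_def by auto
  with step.IH show ?case by (meson rtrancl.rtrancl_into_rtrancl)
qed simp

lemma iso_via_connected:
  assumes "iso_via f H K" "connected_hypergraph H"
  shows "connected_hypergraph K"
proof -
  have f: "f ` verts H = verts K" "edges K = (`) f ` edges H"
    using assms(1) by (auto simp: iso_via_def bij_betw_def)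
  show ?thesis using assms(2) iso_via_adj_rtrancl[OF f(2)]
    unfolding connected_hypergraph_def linked_adj f(1)[symmetric] by auto
qed

lemma iso_via_card_verts: "iso_via f H K \<Longrightarrow> card (verts K) = card (verts H)"
  unfolding iso_via_def using bij_betw_same_card by fastforce

lemma iso_via_card_edges:
  assumes "wf_hypergraph H" "iso_via f H K"
  shows "card (edges K) = card (edges H)"
proof -
  have "inj_on ((`) f) (edges H)"
    using assms unfolding iso_via_def bij_betw_def by (metis PowI inj_on_image_Pow inj_on_subset subsetI)
  then show ?thesis using assms(2) by (simp add: iso_via_def card_image)
qed

lemma uniform_wf: "uniform_hypergraph d H \<Longrightarrow> wf_hypergraph H"
  by (simp add: uniform_hypergraph_def)

lemma uniform_edges_ne: "uniform_hypergraph d H \<Longrightarrow> d \<ge> 1 \<Longrightarrow> \<forall>e\<in>edges H. e \<noteq> {}"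
  by (auto simp: uniform_hypergraph_def)

lemma uniform_induced: "uniform_hypergraph d H \<Longrightarrow> W \<subseteq> verts H \<Longrightarrow> uniform_hypergraph d (induced H W)"
  by (auto simp: uniform_hypergraph_def intro: finite_subset)

lemma iso_via_uniform:
  assumes "uniform_hypergraph d H" "iso_via f H K"
  shows "uniform_hypergraph d K"
proof -
  have f: "f ` verts H = verts K" "edges K = (`) f ` edges H" "inj_on f (verts H)"
    using assms(2) by (auto simp: iso_via_def bij_betw_def)
  have "card (f ` e) = card e" if "e \<in> edges H" for e
    using that assms(1) f(3) by (meson card_image inj_on_subset uniform_hypergraph_def)
  then show ?thesis using assms(1) unfolding uniform_hypergraph_def f(2) f(1)[symmetric] by auto
qed

lemma iso_via_unicycle:
  assumes "iso_via f H K" "unicycle d H"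
  shows "unicycle d K"
  using assms iso_via_uniform[of d H f K] iso_via_connected[of f H K] iso_via_card_verts[of f H K]
    iso_via_card_edges[of H f K] uniform_wf[of d H]
  by (simp add: unicycle_def excess_def)

definition uni_free :: "nat \<Rightarrow> 'a hypergraph \<Rightarrow> bool" where
  "uni_free d H \<longleftrightarrow> \<not> (\<exists>U. closed_in H U \<and> unicycle d (induced H U))"

definition all_uni :: "nat \<Rightarrow> 'a hypergraph \<Rightarrow> bool" where
  "all_uni d H \<longleftrightarrow> uniform_hypergraph d H \<and> (\<forall>K\<in>components_of H. unicycle d K)"

lemma iso_via_uni_free:
  assumes "uniform_hypergraph d H" "iso_via f H K"
  shows "uni_free d K \<longleftrightarrow> uni_free d H"
proof -
  have *: "\<exists>U. closed_in K U \<and> unicycle d (induced K U)"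
    if "uniform_hypergraph d H" "iso_via f H K" "closed_in H U" "unicycle d (induced H U)"
    for f U and H :: "'x hypergraph" and K :: "'y hypergraph"
    using iso_via_closed_in[OF uniform_wf[OF that(1)] that(2,3)]
      iso_via_unicycle[OF iso_via_induced[OF uniform_wf[OF that(1)] that(2)] that(4)] that(3)
    by (auto simp: closed_in_def)
  show ?thesis unfolding uni_free_def
    using *[OF assms] *[OF iso_via_uniform[OF assms] iso_via_inv[OF uniform_wf[OF assms(1)] assms(2)]]
    by metis
qed

lemma iso_via_all_uni:
  assumes "all_uni d H" "iso_via f H K"
  shows "all_uni d K"
proof -
  have H: "uniform_hypergraph d H" using assms(1) by (simp add: all_uni_def)
  have K: "uniform_hypergraph d K" using iso_via_uniform[OF H assms(2)] .
  let ?g = "inv_into (verts H) f"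
  have g: "iso_via ?g K H" by (rule iso_via_inv[OF uniform_wf[OF H] assms(2)])
  have "unicycle d C" if "C \<in> components_of K" for C
  proof -
    from that obtain U where U: "C = induced K U" "closed_in K U" "connected_hypergraph (induced K U)"
      unfolding components_of_iff[OF uniform_wf[OF K]] by blast
    have UK: "U \<subseteq> verts K" using U by (simp add: closed_in_def)
    have i: "iso_via ?g (induced K U) (induced H (?g ` U))"
      by (rule iso_via_induced[OF uniform_wf[OF K] g UK])
    have "induced H (?g ` U) \<in> components_of H"
      unfolding components_of_iff[OF uniform_wf[OF H]]
      using iso_via_closed_in[OF uniform_wf[OF K] g U(2)] iso_via_connected[OF i U(3)] by blast
    then have "unicycle d (induced H (?g ` U))" using assms(1) by (simp add: all_uni_def)
    then show ?thesis
      using iso_via_unicycle[OF iso_via_inv[OF uniform_wf[OF uniform_induced[OF K UK]] i]] U(1) by simp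
  qed
  then show ?thesis using K by (simp add: all_uni_def)
qed

section \<open>The fragment\<close>

definition frag_verts :: "nat \<Rightarrow> 'a hypergraph \<Rightarrow> 'a set" where
  "frag_verts d H = \<Union>{U. closed_in H U \<and> unicycle d (induced H U)}"

lemma closed_in_frag_verts: "closed_in H (frag_verts d H)"
  unfolding frag_verts_def by (rule closed_in_Union) auto

text \<open>A nonempty edge inside the union of the unicyclic closed sets meets one of them and
  therefore lies in it; so the union of their edge sets is the induced edge set.\<close>

lemma Frag_eq:
  assumes "uniform_hypergraph d H" "d \<ge> 1"
  shows "Frag d H = induced H (frag_verts d H)"
proof -
  let ?\<U> = "{U. closed_in H U \<and> unicycle d (induced H U)}"
  have c: "{K \<in> components_of H. unicycle d K} = induced H ` ?\<U>"
    unfolding components_of_iff[OF uniform_wf[OF assms(1)]]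
    by (auto simp only: unicycle_def mem_Collect_eq image_iff)
  have "\<exists>U\<in>?\<U>. e \<subseteq> U" if e: "e \<in> edges H" "e \<subseteq> \<Union>?\<U>" for e
  proof -
    have "e \<noteq> {}" using uniform_edges_ne[OF assms] e by blast
    then obtain U where U: "U \<in> ?\<U>" "e \<inter> U \<noteq> {}" using e(2) by blast
    then have "e \<subseteq> U" using e(1) by (simp add: closed_in_def)
    with U show ?thesis by blast
  qed
  then have "(\<Union>U\<in>?\<U>. {e \<in> edges H. e \<subseteq> U}) = {e \<in> edges H. e \<subseteq> \<Union>?\<U>}" by blast
  then show ?thesis
    unfolding Frag_def c image_image verts_induced edges_induced by (simp add: induced_def frag_verts_def)
qed

text \<open>A component of a closed induced part is a component of the whole.\<close>

lemma closed_all_uni_subset_frag: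
  assumes H: "uniform_hypergraph d H" and d: "d \<ge> 1" and W: "closed_in H W" "all_uni d (induced H W)"
  shows "W \<subseteq> frag_verts d H"
proof
  fix x assume x: "x \<in> W"
  have wfW: "wf_hypergraph (induced H W)" by simp
  define U where "U = linked (induced H W) `` {x}"
  have xU: "x \<in> U" using x by (simp add: U_def linked_adj)
  have U: "closed_in (induced H W) U" unfolding U_def by (rule closed_in_link_class[OF wfW])
  have cU: "connected_hypergraph (induced (induced H W) U)"
    unfolding U_def by (rule connected_link_class[OF wfW]) (simp add: x)
  have sub: "U \<subseteq> W" using U by (simp add: closed_in_def)
  have "induced (induced H W) U \<in> components_of (induced H W)"
    unfolding components_of_iff[OF wfW] using U cU by blast
  then have "unicycle d (induced H U)"
    using W(2) unfolding all_uni_def induced_induced[OF sub] by blast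
  moreover have "closed_in H U"
    using U closed_in_induced[OF W(1) sub uniform_edges_ne[OF H d]] by simp
  ultimately show "x \<in> frag_verts d H" using xU unfolding frag_verts_def by blast
qed

text \<open>Splits the event that the fragment is prescribed into a condition on the edges meeting
  \<open>W\<close> and one on the edges avoiding \<open>W\<close>. These are independent, which is
  what \<open>prob_Frag_in_class\<close> exploits.\<close>

lemma frag_verts_iff:
  assumes H: "uniform_hypergraph d H" and d: "d \<ge> 1"
  shows "closed_in H W \<and> all_uni d (induced H W) \<and> uni_free d (induced H (verts H - W)) \<longleftrightarrow>
    W = frag_verts d H"
proof
  note wf = uniform_wf[OF H] and ne = uniform_edges_ne[OF H d]
  let ?F = "frag_verts d H"
  have clF: "closed_in H ?F" by (rule closed_in_frag_verts)
  then have FV: "?F \<subseteq> verts H" by (simp add: closed_in_def)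
  assume W: "W = ?F"
  have "unicycle d K" if K: "K \<in> components_of (induced H ?F)" for K
  proof -
    have wfF: "wf_hypergraph (induced H ?F)" by simp
    from K obtain U where U: "K = induced (induced H ?F) U" "closed_in (induced H ?F) U"
      "connected_hypergraph (induced (induced H ?F) U)"
      unfolding components_of_iff[OF wfF] by blast
    have UF: "U \<subseteq> ?F" using U(2) by (simp add: closed_in_def)
    have U': "closed_in H U" "connected_hypergraph (induced H U)" "K = induced H U"
      using U closed_in_induced[OF clF UF ne] by (simp_all add: induced_induced[OF UF])
    obtain x where x: "x \<in> U" using U'(2) by (auto simp: connected_hypergraph_def)
    then obtain U0 where U0: "x \<in> U0" "closed_in H U0" "unicycle d (induced H U0)"
      using UF unfolding frag_verts_def by blast
    then have "U = U0" using connected_closed_eq_link_class[OF U'(1,2) x]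
        connected_closed_eq_link_class[OF U0(2) _ U0(1)] by (simp add: unicycle_def)
    then show ?thesis using U' U0 by simp
  qed
  moreover have "uni_free d (induced H (verts H - ?F))"
    unfolding uni_free_def
  proof safe
    fix U assume U: "closed_in (induced H (verts H - ?F)) U"
      "unicycle d (induced (induced H (verts H - ?F)) U)"
    then have sub: "U \<subseteq> verts H - ?F" by (simp add: closed_in_def)
    have "closed_in H U" "unicycle d (induced H U)"
      using closed_in_induced[OF closed_in_Diff[OF clF wf] sub ne] U
      by (simp_all add: induced_induced[OF sub])
    then have "U \<subseteq> ?F" "U \<noteq> {}" by (auto simp: frag_verts_def unicycle_def connected_hypergraph_def)
    then show False using sub by blast
  qed
  ultimately show "closed_in H W \<and> all_uni d (induced H W) \<and> uni_free d (induced H (verts H - W))"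
    using W clF uniform_induced[OF H FV] by (simp add: all_uni_def)
next
  note wf = uniform_wf[OF H] and ne = uniform_edges_ne[OF H d]
  assume W: "closed_in H W \<and> all_uni d (induced H W) \<and> uni_free d (induced H (verts H - W))"
  then have clW: "closed_in H W" and WV: "W \<subseteq> verts H" by (auto simp: closed_in_def)
  show "W = frag_verts d H"
  proof
    show "W \<subseteq> frag_verts d H" using closed_all_uni_subset_frag[OF H d] W by blast
    show "frag_verts d H \<subseteq> W"
      unfolding frag_verts_def
    proof safe
      fix x U assume U: "x \<in> U" "closed_in H U" "unicycle d (induced H U)"
      then have "U \<subseteq> W \<or> U \<inter> W = {}"
        using connected_closed_cases[OF clW U(2)] by (simp add: unicycle_def)
      moreover have False if "U \<inter> W = {}"
      proof -
        have sub: "U \<subseteq> verts H - W" using that U(2) by (auto simp: closed_in_def)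
        have "closed_in (induced H (verts H - W)) U"
          using closed_in_induced[OF closed_in_Diff[OF clW wf] sub ne] U(2) by simp
        then show False using W U(3) unfolding uni_free_def
          by (metis induced_induced[OF sub])
      qed
      ultimately show "x \<in> W" using U(1) by blast
    qed
  qed
qed

lemma Frag_all_uni: "uniform_hypergraph d H \<Longrightarrow> d \<ge> 1 \<Longrightarrow> all_uni d (Frag d H)"
  using frag_verts_iff[of d H "frag_verts d H"] Frag_eq[of d H] by simp

text \<open>A connected acyclic hypergraph has excess at most -1 by
  \<open>acyclic_card_verts\<close>, so there is a cycle, and connectedness links every vertex of
  \<open>U\<close> to it.\<close>

lemma excess_nonneg_cyclic_verts:
  assumes H: "uniform_hypergraph d H" and d: "d \<ge> 1" and "closed_in H U"
    "connected_hypergraph (induced H U)" "excess d (induced H U) \<ge> 0"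
  shows "U \<subseteq> cyclic_verts (edges H)"
proof -
  let ?E = "edges (induced H U)"
  have UV: "U \<subseteq> verts H" using assms(3) by (simp add: closed_in_def)
  have fin: "finite U" using H UV finite_subset by (auto simp: uniform_hypergraph_def)
  have "\<exists>e. cyclic_edge ?E e"
  proof (rule ccontr)
    assume "\<not> ?thesis"
    then have "(d - 1) * card ?E + 1 \<le> card U"
      using H d assms(4) fin
      by (intro acyclic_card_verts) (auto simp: connected_hypergraph_def uniform_hypergraph_def)
    then have "int ((d - 1) * card ?E + 1) \<le> int (card U)" by linarith
    then have "(int d - 1) * int (card ?E) + 1 \<le> int (card U)" using d by (simp add: of_nat_diff)
    then show False using assms(5) unfolding excess_def verts_induced by linarith
  qed
  then obtain e where e: "cyclic_edge ?E e" by blast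
  then have e': "cyclic_edge (edges H) e" by (rule cyclic_edge_mono) auto
  obtain u where u: "u \<in> e" "u \<in> U" using e by (auto simp: cyclic_edge_def)
  show ?thesis
  proof
    fix y assume "y \<in> U"
    then have "(u, y) \<in> (adj (edges H))\<^sup>*"
      using connected_closed_eq_link_class[OF assms(3,4) u(2)] by (auto simp: linked_adj)
    then show "y \<in> cyclic_verts (edges H)" using e' u by (auto simp: cyclic_verts_def)
  qed
qed

lemma frag_verts_cyclic:
  "uniform_hypergraph d H \<Longrightarrow> d \<ge> 1 \<Longrightarrow> frag_verts d H \<subseteq> cyclic_verts (edges H)"
  unfolding frag_verts_def
  by (rule Union_least) (use excess_nonneg_cyclic_verts[of d H] in \<open>simp add: unicycle_def\<close>)

text \<open>The vertex lies in an acyclic component; deleting it cuts that component into acyclic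
  pieces and leaves the others alone. For the converse direction, a unicycle found after the
  deletion contains a cycle present in \<open>H\<close>, so none of its vertices shares an edge with
  \<open>x\<close>.\<close>

lemma uni_free_delete_vertex:
  assumes H: "uniform_hypergraph d H" and d: "d \<ge> 1" and x: "x \<notin> cyclic_verts (edges H)"
  shows "uni_free d (induced H (verts H - {x})) \<longleftrightarrow> uni_free d H"
proof -
  let ?H = "induced H (verts H - {x})"
  have H': "uniform_hypergraph d ?H" by (rule uniform_induced[OF H]) auto
  have 1: "closed_in ?H U \<and> unicycle d (induced ?H U)" if U: "closed_in H U" "unicycle d (induced H U)" for U
  proof -
    have "U \<subseteq> cyclic_verts (edges H)"
      using excess_nonneg_cyclic_verts[OF H d U(1)] U(2) by (simp add: unicycle_def)
    then have "x \<notin> U" using x by blast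
    then have sub: "U \<subseteq> verts H - {x}" using U(1) by (auto simp: closed_in_def)
    have "closed_in ?H U" using U(1) sub by (auto simp: closed_in_def)
    then show ?thesis using U by (simp add: induced_induced[OF sub])
  qed
  have 2: "closed_in H U \<and> unicycle d (induced H U)" if U: "closed_in ?H U" "unicycle d (induced ?H U)" for U
  proof -
    have sub: "U \<subseteq> verts H - {x}" using U(1) by (simp add: closed_in_def)
    have "U \<subseteq> cyclic_verts (edges ?H)"
      using excess_nonneg_cyclic_verts[OF H' d U(1)] U(2) by (simp add: unicycle_def)
    moreover have "cyclic_verts (edges ?H) \<subseteq> cyclic_verts (edges H)"
      unfolding cyclic_verts_def
    proof clarify
      fix y e u assume "cyclic_edge (edges ?H) e" "u \<in> e" "(u, y) \<in> (adj (edges ?H))\<^sup>*"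
      moreover have "edges ?H \<subseteq> edges H" by auto
      ultimately show "\<exists>e u. cyclic_edge (edges H) e \<and> u \<in> e \<and> (u, y) \<in> (adj (edges H))\<^sup>*"
        using cyclic_edge_mono adj_rtrancl_mono by metis
    qed
    ultimately have Uc: "U \<subseteq> cyclic_verts (edges H)" by blast
    have "e \<subseteq> U" if e: "e \<in> edges H" "e \<inter> U \<noteq> {}" for e
    proof -
      obtain y where y: "y \<in> e" "y \<in> U" using e by blast
      then obtain g u where g: "cyclic_edge (edges H) g" "u \<in> g" "(u, y) \<in> (adj (edges H))\<^sup>*"
        using Uc by (auto simp: cyclic_verts_def)
      have "x \<notin> e"
      proof
        assume "x \<in> e"
        then have "(y, x) \<in> adj (edges H)" using e y by (auto simp: adj_def)
        with g have "x \<in> cyclic_verts (edges H)"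
          unfolding cyclic_verts_def by (blast intro: rtrancl.rtrancl_into_rtrancl)
        then show False using x by simp
      qed
      then have "e \<in> edges ?H" using e uniform_wf[OF H] by auto
      then show ?thesis using U(1) e by (auto simp: closed_in_def)
    qed
    then have "closed_in H U" using sub by (auto simp: closed_in_def)
    then show ?thesis using U(2) by (simp add: induced_induced[OF sub])
  qed
  show ?thesis unfolding uni_free_def using 1 2 by blast
qed

definition complex_component :: "nat \<Rightarrow> 'a hypergraph \<Rightarrow> bool" where
  "complex_component d H \<longleftrightarrow>
     (\<exists>U. closed_in H U \<and> connected_hypergraph (induced H U) \<and> excess d (induced H U) > 0)"

text \<open>For \<open>d \<ge> 1\<close> a connected hypergraph has excess at least -1, so these are
  the hypertrees, of excess exactly -1.\<close>

definition is_tree :: "nat \<Rightarrow> 'a hypergraph \<Rightarrow> bool" where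
  "is_tree d T \<longleftrightarrow> uniform_hypergraph d T \<and> connected_hypergraph T \<and> excess d T < 0"

section \<open>The classes of the unicyclic family\<close>

lemma unicyclic_family_alt: "unicyclic_family d = {H. all_uni d H} // {(H, K). H \<simeq>\<^sub>H K}"
  by (simp add: unicyclic_family_def all_uni_def)

lemma all_uni_wf: "all_uni d H \<Longrightarrow> wf_hypergraph H"
  unfolding all_uni_def using uniform_wf by blast

lemma unicyclic_familyE:
  assumes "C \<in> unicyclic_family d"
  obtains H :: "nat hypergraph" where "all_uni d H" "C = {K. H \<simeq>\<^sub>H K}"
  using assms unfolding unicyclic_family_alt quotient_def by auto

lemma iso_class_in_family:
  fixes H :: "nat hypergraph"
  shows "all_uni d H \<Longrightarrow> {K. H \<simeq>\<^sub>H K} \<in> unicyclic_family d"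
  unfolding unicyclic_family_alt quotient_def
  by (rule UN_I[of H]) auto

lemma family_all_uni: "C \<in> unicyclic_family d \<Longrightarrow> H \<in> C \<Longrightarrow> all_uni d H"
  by (elim unicyclic_familyE) (auto simp: iso_hypergraph_iff intro: iso_via_all_uni)

lemma family_class_eq:
  assumes "C \<in> unicyclic_family d" "H \<in> C"
  shows "C = {K. H \<simeq>\<^sub>H K}"
proof -
  obtain H0 :: "nat hypergraph" where H0: "all_uni d H0" "C = {K. H0 \<simeq>\<^sub>H K}" using assms(1) by (rule unicyclic_familyE)
  have "H0 \<simeq>\<^sub>H H" using assms(2) H0 by blast
  moreover have "H \<simeq>\<^sub>H H0" by (rule iso_hypergraph_sym[OF all_uni_wf[OF H0(1)] calculation])
  ultimately have "H0 \<simeq>\<^sub>H K \<longleftrightarrow> H \<simeq>\<^sub>H K" for K :: "nat hypergraph"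
    by (metis iso_hypergraph_trans)
  then show ?thesis unfolding H0(2) by (rule Collect_cong)
qed

lemma family_disjoint:
  "C \<in> unicyclic_family d \<Longrightarrow> C' \<in> unicyclic_family d \<Longrightarrow> H \<in> C \<Longrightarrow> H \<in> C' \<Longrightarrow> C = C'"
  by (rule trans[OF family_class_eq family_class_eq[symmetric]])

section \<open>Random subsets of a finite set\<close>

text \<open>Expectation over a random subset of \<open>D\<close> containing each element
  independently with probability \<open>p\<close>. Finite weighted sums replace the measure until
  \<open>prob_random_hypergraph\<close> connects the two.\<close>

definition Expect :: "'e set \<Rightarrow> real \<Rightarrow> ('e set \<Rightarrow> real) \<Rightarrow> real" where
  "Expect D p f = (\<Sum>E\<in>Pow D. f E * (p ^ card E * (1 - p) ^ card (D - E)))"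

definition Pr :: "'e set \<Rightarrow> real \<Rightarrow> ('e set \<Rightarrow> bool) \<Rightarrow> real" where
  "Pr D p Q = Expect D p (\<lambda>E. of_bool (Q E))"

lemma Expect_mono:
  assumes "0 \<le> p" "p \<le> 1" "\<And>E. E \<subseteq> D \<Longrightarrow> f E \<le> g E"
  shows "Expect D p f \<le> Expect D p g"
  unfolding Expect_def using assms by (intro sum_mono mult_right_mono) auto

lemma Expect_cong: "(\<And>E. E \<subseteq> D \<Longrightarrow> f E = g E) \<Longrightarrow> Expect D p f = Expect D p g"
  unfolding Expect_def by (intro sum.cong) auto

lemma Expect_add: "Expect D p (\<lambda>E. f E + g E) = Expect D p f + Expect D p g"
  unfolding Expect_def by (simp add: sum.distrib distrib_right)

lemma Expect_sum: "Expect D p (\<lambda>E. \<Sum>i\<in>I. f i E) = (\<Sum>i\<in>I. Expect D p (f i))"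
  unfolding Expect_def by (simp add: sum_distrib_right sum.swap[of _ I])

lemma Expect_cmult: "Expect D p (\<lambda>E. a * f E) = a * Expect D p f"
  unfolding Expect_def by (simp add: sum_distrib_left mult.assoc)

lemma Expect_const: "finite D \<Longrightarrow> Expect D p (\<lambda>_. a) = a"
  using prod_add[of D "\<lambda>_. p" "\<lambda>_. 1 - p"]
  by (simp add: Expect_def flip: sum_distrib_left)

lemma Expect_card: "finite I \<Longrightarrow> Expect D p (\<lambda>E. real (card {i \<in> I. Q i E})) = (\<Sum>i\<in>I. Pr D p (Q i))"
  unfolding Pr_def Expect_sum[symmetric] by (rule Expect_cong) (simp add: sum.If_cases Int_def of_bool_def)

lemma Pr_cong: "(\<And>E. E \<subseteq> D \<Longrightarrow> Q E \<longleftrightarrow> R E) \<Longrightarrow> Pr D p Q = Pr D p R"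
  unfolding Pr_def by (rule Expect_cong) simp

lemma Pr_mono:
  "0 \<le> p \<Longrightarrow> p \<le> 1 \<Longrightarrow> (\<And>E. E \<subseteq> D \<Longrightarrow> Q E \<Longrightarrow> R E) \<Longrightarrow> Pr D p Q \<le> Pr D p R"
  unfolding Pr_def by (rule Expect_mono) auto

lemma Pr_nonneg: "0 \<le> p \<Longrightarrow> p \<le> 1 \<Longrightarrow> 0 \<le> Pr D p Q"
  unfolding Pr_def Expect_def by (intro sum_nonneg) auto

lemma Pr_True: "finite D \<Longrightarrow> Pr D p (\<lambda>_. True) = 1"
  unfolding Pr_def by (simp add: Expect_const)

lemma Pr_le_1: "finite D \<Longrightarrow> 0 \<le> p \<Longrightarrow> p \<le> 1 \<Longrightarrow> Pr D p Q \<le> 1"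
  using Pr_mono[of p D Q "\<lambda>_. True"] Pr_True[of D p] by simp

lemma Pr_union:
  assumes "0 \<le> p" "p \<le> 1"
  shows "Pr D p (\<lambda>E. Q E \<or> R E) \<le> Pr D p Q + Pr D p R"
  unfolding Pr_def Expect_add[symmetric] by (rule Expect_mono[OF assms]) auto

lemma Pr_not: "finite D \<Longrightarrow> Pr D p (\<lambda>E. \<not> Q E) = 1 - Pr D p Q"
proof -
  assume "finite D"
  then have "Pr D p (\<lambda>E. \<not> Q E) + Pr D p Q = Expect D p (\<lambda>_. 1)"
    unfolding Pr_def Expect_add[symmetric] by (intro Expect_cong) auto
  then show ?thesis using Expect_const[OF \<open>finite D\<close>, of p 1] by simp
qed

lemma Pr_Bex:
  assumes "0 \<le> p" "p \<le> 1" "finite I"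
  shows "Pr D p (\<lambda>E. \<exists>i\<in>I. Q i E) \<le> (\<Sum>i\<in>I. Pr D p (Q i))"
  unfolding Expect_card[OF assms(3), symmetric] unfolding Pr_def
proof (rule Expect_mono[OF assms(1,2)])
  fix E
  show "of_bool (\<exists>i\<in>I. Q i E) \<le> real (card {i \<in> I. Q i E})"
  proof (cases "\<exists>i\<in>I. Q i E")
    case True
    then have "{i \<in> I. Q i E} \<noteq> {}" by blast
    then have "card {i \<in> I. Q i E} > 0" using assms(3) by (simp add: card_gt_0_iff)
    then show ?thesis using True by simp
  qed simp
qed

lemma Pr_Bex_unique:
  assumes "finite I" "\<And>E i j. E \<subseteq> D \<Longrightarrow> i \<in> I \<Longrightarrow> j \<in> I \<Longrightarrow> Q i E \<Longrightarrow> Q j E \<Longrightarrow> i = j"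
  shows "Pr D p (\<lambda>E. \<exists>i\<in>I. Q i E) = (\<Sum>i\<in>I. Pr D p (Q i))"
  unfolding Expect_card[OF assms(1), symmetric] unfolding Pr_def
proof (rule Expect_cong)
  fix E assume E: "E \<subseteq> D"
  show "of_bool (\<exists>i\<in>I. Q i E) = real (card {i \<in> I. Q i E})"
  proof (cases "\<exists>i\<in>I. Q i E")
    case True
    then obtain i where "i \<in> I" "Q i E" by blast
    then have "{i \<in> I. Q i E} = {i}" using assms(2)[OF E] by blast
    then show ?thesis using True by simp
  next
    case False
    then have "{i \<in> I. Q i E} = {}" by blast
    then show ?thesis using False by (simp only: card.empty) simp
  qed
qed

text \<open>Independence on disjoint sets: a subset of the union is a pair of subsets, and the
  weights multiply.\<close>

lemma Pr_split:
  assumes "finite D1" "finite D2" "D1 \<inter> D2 = {}"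
  shows "Pr (D1 \<union> D2) p (\<lambda>E. Q (E \<inter> D1) \<and> R (E \<inter> D2)) = Pr D1 p Q * Pr D2 p R"
proof -
  let ?w = "\<lambda>D E. p ^ card E * (1 - p) ^ card (D - E)"
  have "Pr D1 p Q * Pr D2 p R = (\<Sum>(A, B)\<in>Pow D1 \<times> Pow D2.
      of_bool (Q A) * ?w D1 A * (of_bool (R B) * ?w D2 B))"
    unfolding Pr_def Expect_def by (simp add: sum_product sum.cartesian_product)
  also have "\<dots> = (\<Sum>E\<in>Pow (D1 \<union> D2). of_bool (Q (E \<inter> D1) \<and> R (E \<inter> D2)) * ?w (D1 \<union> D2) E)"
  proof (rule sum.reindex_bij_witness[where i = "\<lambda>E. (E \<inter> D1, E \<inter> D2)" and j = "\<lambda>(A, B). A \<union> B"])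
    fix x assume x: "x \<in> Pow D1 \<times> Pow D2"
    obtain A B where AB: "x = (A, B)" "A \<subseteq> D1" "B \<subseteq> D2" using x by auto
    have fin: "finite A" "finite B"
      using finite_subset[OF AB(2) assms(1)] finite_subset[OF AB(3) assms(2)] by auto
    have eq: "(A \<union> B) \<inter> D1 = A" "(A \<union> B) \<inter> D2 = B" using AB assms(3) by auto
    have "card (A \<union> B) = card A + card B" using fin AB assms(3) by (intro card_Un_disjoint) auto
    moreover have "D1 \<union> D2 - (A \<union> B) = (D1 - A) \<union> (D2 - B)" using AB assms(3) by auto
    then have "card (D1 \<union> D2 - (A \<union> B)) = card (D1 - A) + card (D2 - B)"
      using assms by (simp, intro card_Un_disjoint) auto
    ultimately show "of_bool (Q ((case x of (A, B) \<Rightarrow> A \<union> B) \<inter> D1) \<and> R ((case x of (A, B) \<Rightarrow> A \<union> B) \<inter> D2)) *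
        ?w (D1 \<union> D2) (case x of (A, B) \<Rightarrow> A \<union> B) =
      (case x of (A, B) \<Rightarrow> of_bool (Q A) * ?w D1 A * (of_bool (R B) * ?w D2 B))"
      using eq by (simp add: AB power_add)
  qed (use assms in auto)
  finally show ?thesis unfolding Pr_def Expect_def by simp
qed

lemma Pr_restrict:
  assumes "finite D" "D1 \<subseteq> D"
  shows "Pr D p (\<lambda>E. Q (E \<inter> D1)) = Pr D1 p Q"
proof -
  have "D1 \<union> (D - D1) = D" "finite D1" "finite (D - D1)" using assms finite_subset by auto
  then show ?thesis
    using Pr_split[of D1 "D - D1" p Q "\<lambda>_. True"] Pr_True[of "D - D1" p] by simp
qed

lemma Pr_eq:
  assumes "finite D" "F \<subseteq> D"
  shows "Pr D p (\<lambda>E. E = F) = p ^ card F * (1 - p) ^ card (D - F)"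
proof -
  have "Pr D p (\<lambda>E. E = F) = (\<Sum>E\<in>Pow D. if E = F then p ^ card E * (1 - p) ^ card (D - E) else 0)"
    unfolding Pr_def Expect_def by (intro sum.cong) auto
  then show ?thesis using assms by (simp add: sum.delta)
qed

lemma Pr_superset:
  assumes "finite D" "F \<subseteq> D"
  shows "Pr D p (\<lambda>E. F \<subseteq> E) = p ^ card F"
proof -
  have "finite F" using assms finite_subset by blast
  have "Pr D p (\<lambda>E. F \<subseteq> E) = Pr D p (\<lambda>E. E \<inter> F = F)" by (rule Pr_cong) blast
  also have "\<dots> = Pr F p (\<lambda>E. E = F)" by (rule Pr_restrict[OF assms])
  also have "\<dots> = p ^ card F" using Pr_eq[OF \<open>finite F\<close>, of F p] by simp
  finally show ?thesis .
qed

lemma Pr_image: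
  assumes "inj_on f D"
  shows "Pr (f ` D) p Q = Pr D p (\<lambda>E. Q (f ` E))"
  unfolding Pr_def Expect_def
proof (rule sum.reindex_bij_witness[symmetric, where i = "\<lambda>E. {x \<in> D. f x \<in> E}" and j = "\<lambda>E. f ` E"])
  fix E assume E: "E \<in> Pow D"
  then have inj: "inj_on f E" using assms by (meson PowD inj_on_subset)
  show "{x \<in> D. f x \<in> f ` E} = E" using E assms by (auto simp: inj_on_def)
  have "f ` D - f ` E = f ` (D - E)" using E assms by (simp add: inj_on_image_set_diff)
  moreover have "inj_on f (D - E)" using assms by (meson Diff_subset inj_on_subset)
  ultimately show "of_bool (Q (f ` E)) * (p ^ card (f ` E) * (1 - p) ^ card (f ` D - f ` E)) =
     of_bool (Q (f ` E)) * (p ^ card E * (1 - p) ^ card (D - E))"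
    using inj by (simp add: card_image)
qed auto

lemma Pr_markov:
  assumes "0 \<le> p" "p \<le> 1" "M > 0" "\<And>E. E \<subseteq> D \<Longrightarrow> f E \<ge> 0"
  shows "Pr D p (\<lambda>E. f E \<ge> M) \<le> Expect D p f / M"
proof -
  have "M * Pr D p (\<lambda>E. f E \<ge> M) \<le> Expect D p f"
    unfolding Pr_def Expect_cmult[symmetric] using assms by (intro Expect_mono) auto
  then show ?thesis using assms(3) by (simp add: field_simps)
qed

section \<open>The random edge set as a random set of \<open>d\<close>-element sets\<close>

definition dsets :: "nat \<Rightarrow> 'a set \<Rightarrow> 'a set set" where
  "dsets d V = {e. e \<subseteq> V \<and> card e = d}"

lemma finite_dsets [simp]: "finite V \<Longrightarrow> finite (dsets d V)"
  unfolding dsets_def by (rule finite_subset[of _ "Pow V"]) auto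

lemma card_dsets: "finite V \<Longrightarrow> card (dsets d V) = card V choose d"
  unfolding dsets_def by (rule n_subsets)

lemma dsets_mono: "W \<subseteq> V \<Longrightarrow> dsets d W \<subseteq> dsets d V"
  by (auto simp: dsets_def)

lemma uniform_dsets: "finite V \<Longrightarrow> E \<subseteq> dsets d V \<Longrightarrow> uniform_hypergraph d (V, E)"
  by (auto simp: uniform_hypergraph_def dsets_def)

lemma prob_random_hypergraph:
  assumes "0 \<le> p" "p \<le> 1"
  shows "measure_pmf.prob (random_hypergraph d n p) {H. Q H} =
    Pr (dsets d {1..n}) p (\<lambda>E. Q ({1..n}, E))"
proof -
  let ?D = "dsets d {1..n}" and ?V = "{1..n}"
  let ?P = "Pi_pmf ?D False (\<lambda>_. bernoulli_pmf p)"
  have "random_hypergraph d n p = map_pmf (\<lambda>f. (?V, {e \<in> ?D. f e})) ?P"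
    by (simp add: random_hypergraph_def dsets_def)
  then have "measure_pmf.prob (random_hypergraph d n p) {H. Q H} =
      measure_pmf.prob ?P {f. Q (?V, {e \<in> ?D. f e})}"
    by (simp add: vimage_def)
  also have "\<dots> = measure_pmf.prob ?P ((\<lambda>E e. e \<in> E) ` {E. E \<subseteq> ?D \<and> Q (?V, E)})"
  \<comment> \<open>The events differ only by functions that are not membership in a subset of
    \<open>?D\<close>. As the default value outside \<open>?D\<close> is \<open>False\<close>, such
    functions have mass 0.\<close>
  proof (rule measure_prob_cong_0)
    fix f assume f: "f \<in> {f. Q (?V, {e \<in> ?D. f e})} - (\<lambda>E e. e \<in> E) ` {E. E \<subseteq> ?D \<and> Q (?V, E)}"
    have "\<exists>x. x \<notin> ?D \<and> f x \<noteq> False"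
    proof (rule ccontr)
      assume "\<not> ?thesis"
      then have "f e \<longleftrightarrow> e \<in> {e \<in> ?D. f e}" for e by blast
      then have "f = (\<lambda>e. e \<in> {e \<in> ?D. f e})" by (rule ext)
      moreover have "{e \<in> ?D. f e} \<in> {E. E \<subseteq> ?D \<and> Q (?V, E)}" using f by blast
      ultimately have "f \<in> (\<lambda>E e. e \<in> E) ` {E. E \<subseteq> ?D \<and> Q (?V, E)}" by (rule image_eqI)
      then show False using f by simp
    qed
    then show "pmf ?P f = 0" by (intro pmf_Pi_outside) simp_all
  next
    fix f assume f: "f \<in> (\<lambda>E e. e \<in> E) ` {E. E \<subseteq> ?D \<and> Q (?V, E)} - {f. Q (?V, {e \<in> ?D. f e})}"
    then obtain E where E: "E \<subseteq> ?D" "Q (?V, E)" "f = (\<lambda>e. e \<in> E)" by auto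
    then have "{e \<in> ?D. f e} = E" by auto
    then show "pmf ?P f = 0" using f E by simp
  qed
  also have "\<dots> = (\<Sum>E | E \<subseteq> ?D \<and> Q (?V, E). pmf ?P (\<lambda>e. e \<in> E))"
    by (subst measure_measure_pmf_finite, simp, subst sum.reindex) (auto simp: inj_on_def fun_eq_iff)
  also have "\<dots> = (\<Sum>E | E \<subseteq> ?D \<and> Q (?V, E). p ^ card E * (1 - p) ^ card (?D - E))"
  proof (rule sum.cong[OF refl])
    fix E assume "E \<in> {E. E \<subseteq> ?D \<and> Q (?V, E)}"
    then have E: "E \<subseteq> ?D" by simp
    have "pmf ?P (\<lambda>e. e \<in> E) = (\<Prod>e\<in>?D. pmf (bernoulli_pmf p) (e \<in> E))"
      by (rule pmf_Pi') (use E in auto)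
    also have "\<dots> = (\<Prod>e\<in>?D. if e \<in> E then p else 1 - p)"
      by (rule prod.cong) (use assms in auto)
    also have "\<dots> = p ^ card (?D \<inter> E) * (1 - p) ^ card (?D - E)"
      by (simp add: prod.If_cases Collect_mem_eq Diff_eq)
    also have "?D \<inter> E = E" using E by blast
    finally show "pmf ?P (\<lambda>e. e \<in> E) = p ^ card E * (1 - p) ^ card (?D - E)" .
  qed
  also have "\<dots> = (\<Sum>E\<in>Pow ?D. if Q (?V, E) then p ^ card E * (1 - p) ^ card (?D - E) else 0)"
    by (subst sum.inter_filter[symmetric]) (auto intro: sum.cong)
  also have "\<dots> = Pr ?D p (\<lambda>E. Q (?V, E))"
    unfolding Pr_def Expect_def by (intro sum.cong) auto
  finally show ?thesis .
qed

section \<open>The expected number of vertices in cyclic components\<close>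

definition walks :: "nat \<Rightarrow> 'a set \<Rightarrow> 'a \<Rightarrow> nat \<Rightarrow> ('a set \<times> 'a) list set" where
  "walks d V x m = {ps. length ps = m \<and> (\<exists>y. walk x ps y) \<and> fst ` set ps \<subseteq> dsets d V}"

definition walks_to :: "nat \<Rightarrow> 'a set \<Rightarrow> 'a \<Rightarrow> 'a \<Rightarrow> nat \<Rightarrow> ('a set \<times> 'a) list set" where
  "walks_to d V x y m = {ps. length ps = m \<and> walk x ps y \<and> fst ` set ps \<subseteq> dsets d V}"

lemma walk_snd_mem: "walk x ps y \<Longrightarrow> p \<in> set ps \<Longrightarrow> snd p \<in> fst p"
  by (induction ps arbitrary: x) auto

lemma finite_walks:
  assumes "finite V"
  shows "finite (walks d V x m)"
proof (rule finite_subset)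
  show "walks d V x m \<subseteq> {ps. set ps \<subseteq> dsets d V \<times> V \<and> length ps = m}"
    unfolding walks_def using walk_snd_mem by (fastforce simp: dsets_def)
  show "finite {ps. set ps \<subseteq> dsets d V \<times> V \<and> length ps = m}"
    using assms by (intro finite_lists_length_eq) simp
qed

lemma finite_walks_to: "finite V \<Longrightarrow> finite (walks_to d V x y m)"
  by (rule finite_subset[OF _ finite_walks[of V d x m]]) (auto simp: walks_to_def walks_def)

text \<open>Deleting \<open>x\<close> and \<open>v\<close> maps these edges injectively to sets of
  size \<open>d - 2\<close>. The factorial here is the one in the bound on \<open>c\<close>.\<close>

lemma card_dsets_through_pair:
  assumes "finite V" "x \<noteq> v"
  shows "real (card {e \<in> dsets d V. x \<in> e \<and> v \<in> e}) \<le> real (card V) ^ (d - 2) / fact (d - 2)"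
proof -
  let ?A = "{e \<in> dsets d V. x \<in> e \<and> v \<in> e}"
  have "card ?A \<le> card (dsets (d - 2) V)"
  proof (rule card_inj_on_le)
    show "inj_on (\<lambda>e. e - {x, v}) ?A" by (auto simp: inj_on_def)
    show "(\<lambda>e. e - {x, v}) ` ?A \<subseteq> dsets (d - 2) V"
    proof clarify
      fix e assume e: "e \<in> dsets d V" "x \<in> e" "v \<in> e"
      then have "finite e" using assms(1) finite_subset by (auto simp: dsets_def)
      then have "card (e - {x, v}) = d - 2"
        using e assms(2) by (subst card_Diff_subset) (auto simp: dsets_def)
      then show "e - {x, v} \<in> dsets (d - 2) V" using e by (auto simp: dsets_def)
    qed
    show "finite (dsets (d - 2) V)" using assms(1) by simp
  qed
  also have "\<dots> = card V choose (d - 2)" using assms(1) by (rule card_dsets)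
  finally have "card ?A * fact (d - 2) \<le> (card V choose (d - 2)) * fact (d - 2)" by simp
  also have "\<dots> \<le> card V ^ (d - 2)" by (rule binomial_fact_pow)
  finally have "real (card ?A * fact (d - 2)) \<le> real (card V ^ (d - 2))" by (rule of_nat_mono)
  then show ?thesis by (simp add: field_simps)
qed

lemma walks_Suc_subset:
  "walks d V x (Suc m) \<subseteq> (\<Union>(v, e)\<in>(SIGMA v:V - {x}. {e \<in> dsets d V. x \<in> e \<and> v \<in> e}).
     Cons (e, v) ` walks d V v m)"
proof
  fix ps assume ps: "ps \<in> walks d V x (Suc m)"
  then obtain e v qs where eq: "ps = (e, v) # qs" by (auto simp: walks_def length_Suc_conv)
  then have "e \<in> dsets d V" "x \<in> e" "v \<in> e" "x \<noteq> v" "qs \<in> walks d V v m" "v \<in> V"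
    using ps by (auto simp: walks_def dsets_def)
  then show "ps \<in> (\<Union>(v, e)\<in>(SIGMA v:V - {x}. {e \<in> dsets d V. x \<in> e \<and> v \<in> e}).
     Cons (e, v) ` walks d V v m)" unfolding eq by blast
qed

lemma walks_to_Suc_subset:
  "walks_to d V x y (Suc m) \<subseteq> (\<Union>(v, e)\<in>(SIGMA v:V - {x}. {e \<in> dsets d V. x \<in> e \<and> v \<in> e}).
     Cons (e, v) ` walks_to d V v y m)"
proof
  fix ps assume ps: "ps \<in> walks_to d V x y (Suc m)"
  then obtain e v qs where eq: "ps = (e, v) # qs" by (auto simp: walks_to_def length_Suc_conv)
  then have "e \<in> dsets d V" "x \<in> e" "v \<in> e" "x \<noteq> v" "qs \<in> walks_to d V v y m" "v \<in> V"
    using ps by (auto simp: walks_to_def dsets_def)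
  then show "ps \<in> (\<Union>(v, e)\<in>(SIGMA v:V - {x}. {e \<in> dsets d V. x \<in> e \<and> v \<in> e}).
     Cons (e, v) ` walks_to d V v y m)" unfolding eq by blast
qed

text \<open>One step costs the choice of the next vertex and of an edge through both ends. The
  continuations \<open>A v\<close> are arbitrary, so that walks with free and with fixed end are
  both covered.\<close>

lemma card_steps:
  assumes "finite V" "\<And>v. finite (A v)" "\<And>v. real (card (A v)) \<le> B" "B \<ge> 0"
    "X \<subseteq> (\<Union>(v, e)\<in>(SIGMA v:V - {x}. {e \<in> dsets d V. x \<in> e \<and> v \<in> e}). Cons (e, v) ` A v)"
  shows "real (card X) \<le> real (card V) * (real (card V) ^ (d - 2) / fact (d - 2)) * B"
proof -
  let ?I = "SIGMA v:V - {x}. {e \<in> dsets d V. x \<in> e \<and> v \<in> e}"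
  let ?b = "real (card V) ^ (d - 2) / fact (d - 2)"
  have fin: "finite ?I" using assms(1) by (intro finite_SigmaI) auto
  have "real (card X) \<le> real (card (\<Union>(v, e)\<in>?I. Cons (e, v) ` A v))"
    using assms(5) fin assms(2) by (intro of_nat_mono card_mono finite_UN_I) auto
  also have "\<dots> \<le> real (\<Sum>(v, e)\<in>?I. card (Cons (e, v) ` A v))"
    unfolding case_prod_unfold using fin by (intro of_nat_mono card_UN_le)
  also have "\<dots> \<le> (\<Sum>(v, e)\<in>?I. B)"
    unfolding of_nat_sum case_prod_unfold
  proof (rule sum_mono)
    fix i assume "i \<in> ?I"
    have "card (Cons (snd i, fst i) ` A (fst i)) \<le> card (A (fst i))" by (rule card_image_le[OF assms(2)])
    then show "real (card (Cons (snd i, fst i) ` A (fst i))) \<le> B"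
      using assms(3)[of "fst i"] by linarith
  qed
  also have "\<dots> = real (card ?I) * B" by (simp add: case_prod_unfold)
  also have "real (card ?I) = (\<Sum>v\<in>V - {x}. real (card {e \<in> dsets d V. x \<in> e \<and> v \<in> e}))"
    using assms(1) by (subst card_SigmaI) auto
  also have "\<dots> \<le> (\<Sum>v\<in>V - {x}. ?b)"
    using card_dsets_through_pair[OF assms(1)] by (intro sum_mono) auto
  also have "\<dots> \<le> real (card V) * ?b"
    using assms(1) by (auto intro!: divide_right_mono mult_right_mono card_mono)
  finally show ?thesis using assms(4) by (simp add: mult_right_mono)
qed

lemma card_walks:
  assumes "finite V"
  shows "real (card (walks d V x m)) \<le> (real (card V) * (real (card V) ^ (d - 2) / fact (d - 2))) ^ m"
proof (induction m arbitrary: x)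
  case 0
  have "walks d V x 0 \<subseteq> {[]}" by (auto simp: walks_def)
  then have "card (walks d V x 0) \<le> card {[] :: ('a set \<times> 'a) list}" by (intro card_mono) auto
  then show ?case by simp
next
  case (Suc m)
  show ?case unfolding power_Suc
    by (rule card_steps[OF assms finite_walks[OF assms] Suc.IH _ walks_Suc_subset]) simp
qed

text \<open>A fixed end leaves no choice of vertex in the last step and saves one factor
  \<open>card V\<close>. In \<open>card_lollipops\<close> this factor pays for the start of the
  closed walk.\<close>

lemma card_walks_to:
  assumes "finite V"
  shows "real (card (walks_to d V x y (Suc m))) \<le>
    (real (card V) * (real (card V) ^ (d - 2) / fact (d - 2))) ^ m * (real (card V) ^ (d - 2) / fact (d - 2))"
proof (induction m arbitrary: x)
  case 0
  show ?case
  proof (cases "x = y")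
    case True
    then have "walks_to d V x y (Suc 0) = {}" by (auto simp: walks_to_def length_Suc_conv)
    then show ?thesis by simp
  next
    case False
    have "walks_to d V x y (Suc 0) \<subseteq> (\<lambda>e. [(e, y)]) ` {e \<in> dsets d V. x \<in> e \<and> y \<in> e}"
      by (auto simp: walks_to_def length_Suc_conv)
    moreover have fin: "finite {e \<in> dsets d V. x \<in> e \<and> y \<in> e}" using assms by simp
    ultimately have "card (walks_to d V x y (Suc 0)) \<le> card {e \<in> dsets d V. x \<in> e \<and> y \<in> e}"
      using surj_card_le by blast
    then show ?thesis using card_dsets_through_pair[OF assms False, of d] by simp
  qed
next
  case (Suc m)
  show ?case unfolding power_Suc mult.assoc[of _ "_ ^ m"]
    by (rule card_steps[OF assms finite_walks_to[OF assms] Suc.IH _ walks_to_Suc_subset]) simp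
qed

definition lollipops :: "nat \<Rightarrow> 'a set \<Rightarrow> nat \<Rightarrow> nat \<Rightarrow> ('a \<times> ('a set \<times> 'a) list \<times> 'a \<times> ('a set \<times> 'a) list) set" where
  "lollipops d V l m = (SIGMA u:V. SIGMA cs:walks_to d V u u l. SIGMA x:\<Union>(fst ` set cs). walks d V x m)"

lemma finite_Union_walk:
  assumes "finite V" "cs \<in> walks_to d V u u l"
  shows "finite (\<Union>(fst ` set cs))" "card (\<Union>(fst ` set cs)) \<le> d * l"
proof -
  have cs: "length cs = l" "\<And>p. p \<in> set cs \<Longrightarrow> fst p \<subseteq> V \<and> card (fst p) = d"
    using assms(2) by (auto simp: walks_to_def dsets_def)
  show "finite (\<Union>(fst ` set cs))" using cs assms(1) finite_subset by blast
  have "card (\<Union>(fst ` set cs)) \<le> (\<Sum>p\<in>set cs. card (fst p))"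
    by (rule card_UN_le) simp
  also have "\<dots> = d * card (set cs)" using cs by simp
  also have "\<dots> \<le> d * l" using cs(1) card_length[of cs] by simp
  finally show "card (\<Union>(fst ` set cs)) \<le> d * l" .
qed

lemma finite_lollipops: "finite V \<Longrightarrow> finite (lollipops d V l m)"
  unfolding lollipops_def
  by (intro finite_SigmaI finite_walks finite_walks_to finite_Union_walk(1)) assumption+

text \<open>The start \<open>u\<close> restores the factor saved in \<open>card_walks_to\<close>,
  and the tail may begin at any of at most \<open>d * Suc l\<close> vertices. There remains one
  factor \<open>N\<close> per edge and no extra power of \<open>card V\<close>; this makes the final
  bound uniform in the number of vertices.\<close>

lemma card_lollipops:
  fixes V :: "'a set" and d :: nat
  defines "N \<equiv> real (card V) * (real (card V) ^ (d - 2) / fact (d - 2))"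
  assumes "finite V"
  shows "real (card (lollipops d V (Suc l) m)) \<le> real d * real (Suc l) * N ^ Suc l * N ^ m"
proof -
  let ?b = "real (card V) ^ (d - 2) / fact (d - 2)"
  have N0: "N \<ge> 0" unfolding N_def by simp
  have fin: "finite (SIGMA x:\<Union>(fst ` set cs). walks d V x m)" if "cs \<in> walks_to d V u u (Suc l)" for cs u
    using finite_Union_walk[OF assms(2) that] finite_walks[OF assms(2)] by (intro finite_SigmaI) auto
  have 1: "real (card (SIGMA x:\<Union>(fst ` set cs). walks d V x m)) \<le> real d * real (Suc l) * N ^ m"
    if cs: "cs \<in> walks_to d V u u (Suc l)" for cs u
  proof -
    have "real (card (SIGMA x:\<Union>(fst ` set cs). walks d V x m)) =
        (\<Sum>x\<in>\<Union>(fst ` set cs). real (card (walks d V x m)))"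
      using finite_Union_walk[OF assms(2) cs] finite_walks[OF assms(2)] by (subst card_SigmaI) auto
    also have "\<dots> \<le> (\<Sum>x\<in>\<Union>(fst ` set cs). N ^ m)"
      unfolding N_def by (intro sum_mono card_walks assms(2))
    also have "\<dots> = real (card (\<Union>(fst ` set cs))) * N ^ m" by simp
    also have "\<dots> \<le> real (d * Suc l) * N ^ m"
      using finite_Union_walk(2)[OF assms(2) cs] N0 by (intro mult_right_mono of_nat_mono) auto
    finally show ?thesis unfolding of_nat_mult .
  qed
  have 2: "real (card (SIGMA cs:walks_to d V u u (Suc l). SIGMA x:\<Union>(fst ` set cs). walks d V x m)) \<le>
      N ^ l * ?b * (real d * real (Suc l) * N ^ m)" for u
  proof -
    have "real (card (SIGMA cs:walks_to d V u u (Suc l). SIGMA x:\<Union>(fst ` set cs). walks d V x m)) =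
        (\<Sum>cs\<in>walks_to d V u u (Suc l). real (card (SIGMA x:\<Union>(fst ` set cs). walks d V x m)))"
      using fin finite_walks_to[OF assms(2)] by (subst card_SigmaI) (auto simp del: card_SigmaI)
    also have "\<dots> \<le> (\<Sum>cs\<in>walks_to d V u u (Suc l). real d * real (Suc l) * N ^ m)"
      by (rule sum_mono) (rule 1)
    also have "\<dots> = real (card (walks_to d V u u (Suc l))) * (real d * real (Suc l) * N ^ m)" by simp
    also have "\<dots> \<le> N ^ l * ?b * (real d * real (Suc l) * N ^ m)"
      unfolding N_def by (intro mult_right_mono card_walks_to assms(2)) auto
    finally show ?thesis .
  qed
  have "real (card (lollipops d V (Suc l) m)) =
      (\<Sum>u\<in>V. real (card (SIGMA cs:walks_to d V u u (Suc l). SIGMA x:\<Union>(fst ` set cs). walks d V x m)))"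
    unfolding lollipops_def using assms(2) fin finite_walks_to[OF assms(2)]
    by (subst card_SigmaI) (auto simp del: card_SigmaI)
  also have "\<dots> \<le> (\<Sum>u\<in>V. N ^ l * ?b * (real d * real (Suc l) * N ^ m))"
    by (rule sum_mono) (rule 2)
  also have "\<dots> = real d * real (Suc l) * N ^ Suc l * N ^ m" by (simp add: N_def)
  finally show ?thesis .
qed

text \<open>For \<open>0 \<le> r < 1\<close> this is d r / (1 - r)^3. The first sum belongs to
  closed walks of length l + 1 with d (l + 1) places for the tail, the second to the tail.\<close>

definition cyclic_bound :: "nat \<Rightarrow> real \<Rightarrow> real" where
  "cyclic_bound d r = real d * (\<Sum>l. real (Suc l) * r ^ Suc l) * (\<Sum>m. r ^ m)"

text \<open>Each cyclic vertex is the end of a lollipop with distinct edges. Distinctness bounds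
  both lengths by the number of possible edges, which makes the sums finite.\<close>

lemma card_cyclic_verts_le:
  assumes "finite V" "E \<subseteq> dsets d V"
  shows "card (cyclic_verts E) \<le> (\<Sum>l\<le>card (dsets d V). \<Sum>m\<le>card (dsets d V).
    card {t \<in> {(u, cs, x, ps) \<in> lollipops d V (Suc l) m. distinct (map fst (cs @ ps))}.
      case t of (u, cs, x, ps) \<Rightarrow> fst ` set (cs @ ps) \<subseteq> E})"
proof -
  let ?D = "dsets d V"
  define T where "T l m = {t \<in> {(u, cs, x, ps) \<in> lollipops d V (Suc l) m. distinct (map fst (cs @ ps))}.
      case t of (u, cs, x, ps) \<Rightarrow> fst ` set (cs @ ps) \<subseteq> E}" for l m
  have finT: "finite (T l m)" for l m
    unfolding T_def by (rule finite_subset[OF _ finite_lollipops[OF assms(1), of d "Suc l" m]]) auto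
  have "cyclic_verts E \<subseteq> (\<lambda>(u, cs, x, ps). THE y. walk x ps y) ` (\<Union>l\<le>card ?D. \<Union>m\<le>card ?D. T l m)"
  proof
    fix y assume "y \<in> cyclic_verts E"
    then obtain u cs x ps where h: "cs \<noteq> []" "walk u cs u" "x \<in> \<Union>(fst ` set cs)" "walk x ps y"
      "distinct (map fst (cs @ ps))" "fst ` set (cs @ ps) \<subseteq> E"
      using cyclic_verts_lollipop by metis
    have len: "length qs \<le> card ?D" if "distinct (map fst qs)" "fst ` set qs \<subseteq> E" for qs :: "('a set \<times> 'a) list"
    proof -
      have "length qs = card (fst ` set qs)" using distinct_card[OF that(1)] by simp
      then show ?thesis using that(2) assms by (simp add: card_mono)
    qed
    obtain l where l: "length cs = Suc l" using h(1) by (cases cs) auto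
    have "length cs \<le> card ?D" "length ps \<le> card ?D" using len h(5,6) by auto
    then have lm: "l \<le> card ?D" "length ps \<le> card ?D" using l by auto
    have sub: "fst ` set (cs @ ps) \<subseteq> ?D" using h(6) assms(2) by blast
    have "u \<in> V"
    proof (cases cs)
      case (Cons p cs')
      then have "u \<in> fst p" "fst p \<in> ?D" using h(2) sub by (cases p; auto)+
      then show ?thesis by (auto simp: dsets_def)
    qed (use h(1) in simp)
    then have "(u, cs, x, ps) \<in> lollipops d V (Suc l) (length ps)"
      unfolding lollipops_def using h l sub by (auto simp: walks_to_def walks_def)
    then have "(u, cs, x, ps) \<in> T l (length ps)" using h(5,6) unfolding T_def by simp
    moreover have "(THE y. walk x ps y) = y" using h(4) walk_unique by (intro the_equality) auto
    ultimately show "y \<in> (\<lambda>(u, cs, x, ps). THE y. walk x ps y) ` (\<Union>l\<le>card ?D. \<Union>m\<le>card ?D. T l m)"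
      using lm by (intro image_eqI[of _ _ "(u, cs, x, ps)"]) auto
  qed
  then have "card (cyclic_verts E) \<le> card ((\<lambda>(u, cs, x, ps). THE y. walk x ps y) ` (\<Union>l\<le>card ?D. \<Union>m\<le>card ?D. T l m))"
    using finT by (intro card_mono finite_imageI finite_UN_I) auto
  also have "\<dots> \<le> card (\<Union>l\<le>card ?D. \<Union>m\<le>card ?D. T l m)"
    using finT by (intro card_image_le finite_UN_I) auto
  also have "\<dots> \<le> (\<Sum>l\<le>card ?D. card (\<Union>m\<le>card ?D. T l m))" by (rule card_UN_le) simp
  also have "\<dots> \<le> (\<Sum>l\<le>card ?D. \<Sum>m\<le>card ?D. card (T l m))"
    by (intro sum_mono card_UN_le) simp
  finally show ?thesis unfolding T_def .
qed

text \<open>Linearity of expectation over lollipops. Having distinct edges, one of them is present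
  with probability \<open>p ^ (Suc l + m)\<close>; against at most d (l + 1) N^(l + 1 + m) of them,
  only powers of \<open>p * N \<le> r < 1\<close> are left.\<close>

lemma expected_cyclic_verts:
  fixes V :: "'a set"
  assumes V: "finite V" and p: "0 \<le> p" "p \<le> 1"
    and r: "p * (real (card V) * (real (card V) ^ (d - 2) / fact (d - 2))) \<le> r" "r < 1"
  shows "Expect (dsets d V) p (\<lambda>E. real (card (cyclic_verts E))) \<le> cyclic_bound d r"
proof -
  let ?D = "dsets d V"
  define N where "N = real (card V) * (real (card V) ^ (d - 2) / fact (d - 2))"
  have N0: "N \<ge> 0" unfolding N_def by simp
  then have r0: "0 \<le> r" using p r(1) unfolding N_def[symmetric] by (meson mult_nonneg_nonneg order_trans)
  have pN: "(p * N) ^ k \<le> r ^ k" for k using r(1) p N0 unfolding N_def[symmetric] by (intro power_mono) auto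
  define A where "A l m = {(u, cs, x, ps) \<in> lollipops d V (Suc l) m. distinct (map fst (cs @ ps))}" for l m
  define S :: "'a \<times> ('a set \<times> 'a) list \<times> 'a \<times> ('a set \<times> 'a) list \<Rightarrow> 'a set set"
    where "S t = (case t of (u, cs, x, ps) \<Rightarrow> fst ` set (cs @ ps))" for t
  have finA: "finite (A l m)" for l m
    unfolding A_def by (rule finite_subset[OF _ finite_lollipops[OF V, of d "Suc l" m]]) auto
  have "Expect ?D p (\<lambda>E. real (card (cyclic_verts E))) \<le>
     Expect ?D p (\<lambda>E. \<Sum>l\<le>card ?D. \<Sum>m\<le>card ?D. real (card {t \<in> A l m. S t \<subseteq> E}))"
  proof (rule Expect_mono[OF p])
    fix E assume "E \<subseteq> ?D"
    from of_nat_mono[OF card_cyclic_verts_le[OF V this], where 'a = real]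
    show "real (card (cyclic_verts E)) \<le> (\<Sum>l\<le>card ?D. \<Sum>m\<le>card ?D. real (card {t \<in> A l m. S t \<subseteq> E}))"
      unfolding A_def S_def by (simp add: case_prod_unfold)
  qed
  also have "\<dots> = (\<Sum>l\<le>card ?D. \<Sum>m\<le>card ?D. \<Sum>t\<in>A l m. Pr ?D p (\<lambda>E. S t \<subseteq> E))"
    by (simp add: Expect_sum Expect_card[OF finA])
  also have "\<dots> = (\<Sum>l\<le>card ?D. \<Sum>m\<le>card ?D. \<Sum>t\<in>A l m. p ^ (Suc l + m))"
  proof (intro sum.cong refl)
    fix l m t assume t: "t \<in> A l m"
    then obtain u cs x ps where eq: "t = (u, cs, x, ps)" "(u, cs, x, ps) \<in> lollipops d V (Suc l) m"
      "distinct (map fst (cs @ ps))" by (auto simp: A_def)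
    then have sub: "S t \<subseteq> ?D" and len: "length (cs @ ps) = Suc l + m"
      by (auto simp: S_def lollipops_def walks_to_def walks_def)
    have "S t = set (map fst (cs @ ps))" unfolding eq(1) S_def by (simp add: image_Un)
    then have "card (S t) = Suc l + m" using distinct_card[OF eq(3)] len by simp
    then show "Pr ?D p (\<lambda>E. S t \<subseteq> E) = p ^ (Suc l + m)" using Pr_superset[OF _ sub] V by simp
  qed
  also have "\<dots> \<le> (\<Sum>l\<le>card ?D. \<Sum>m\<le>card ?D. real d * (real (Suc l) * r ^ Suc l) * r ^ m)"
  proof (intro sum_mono)
    fix l m
    have "real (card (A l m)) \<le> real (card (lollipops d V (Suc l) m))"
      unfolding A_def by (intro of_nat_mono card_mono finite_lollipops[OF V]) auto
    also have "\<dots> \<le> real d * real (Suc l) * N ^ Suc l * N ^ m"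
      unfolding N_def by (rule card_lollipops[OF V])
    finally have "(\<Sum>t\<in>A l m. p ^ (Suc l + m)) \<le> real d * real (Suc l) * N ^ Suc l * N ^ m * p ^ (Suc l + m)"
      using p by (simp add: mult_right_mono)
    also have "\<dots> = real d * real (Suc l) * ((p * N) ^ Suc l * (p * N) ^ m)"
      by (simp add: power_mult_distrib power_add)
    also have "\<dots> \<le> real d * real (Suc l) * (r ^ Suc l * r ^ m)"
      using p N0 r0 by (intro mult_left_mono mult_mono pN) auto
    finally show "(\<Sum>t\<in>A l m. p ^ (Suc l + m)) \<le> real d * (real (Suc l) * r ^ Suc l) * r ^ m"
      by (simp add: mult_ac)
  qed
  also have "\<dots> = real d * (\<Sum>l\<le>card ?D. real (Suc l) * r ^ Suc l) * (\<Sum>m\<le>card ?D. r ^ m)"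
    by (simp add: sum_product sum_distrib_left sum_distrib_right mult_ac)
  also have "\<dots> \<le> cyclic_bound d r"
  proof -
    have s1: "summable (\<lambda>m. r ^ m)" using r0 r(2) by (intro summable_geometric) simp
    have "summable (\<lambda>l. real (Suc l) * r ^ l)"
      using geometric_deriv_sums[of r] r0 r(2) by (auto simp: sums_iff)
    from summable_mult[OF this, of r] have s2: "summable (\<lambda>l. real (Suc l) * r ^ Suc l)"
      by (simp add: mult_ac)
    have "(\<Sum>l\<le>card ?D. real (Suc l) * r ^ Suc l) \<le> (\<Sum>l. real (Suc l) * r ^ Suc l)"
      "(\<Sum>m\<le>card ?D. r ^ m) \<le> (\<Sum>m. r ^ m)"
      using s1 s2 r0 by (auto intro!: sum_le_suminf)
    moreover have "0 \<le> (\<Sum>l. real (Suc l) * r ^ Suc l)" using s2 r0 by (intro suminf_nonneg) auto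
    ultimately show ?thesis unfolding cyclic_bound_def using r0
      by (intro mult_mono mult_left_mono) (simp_all add: sum_nonneg)
  qed
  finally show ?thesis .
qed

section \<open>Deleting vertices\<close>

lemma cyclic_verts_subset:
  assumes "E \<subseteq> dsets d V"
  shows "cyclic_verts E \<subseteq> V"
proof
  fix y assume "y \<in> cyclic_verts E"
  then obtain e u where e: "cyclic_edge E e" "u \<in> e" "(u, y) \<in> (adj E)\<^sup>*"
    by (auto simp: cyclic_verts_def)
  have "closed_in (V, E) V" using assms by (auto simp: closed_in_def dsets_def)
  moreover have "u \<in> V" using e(1,2) assms by (auto simp: cyclic_edge_def dsets_def)
  ultimately show "y \<in> V" using closed_in_adj_rtrancl[of "(V, E)" V u y] e(3) by simp
qed

lemma dsets_image:
  assumes "bij_betw f V V'"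
  shows "dsets d V' = (`) f ` dsets d V" "inj_on ((`) f) (dsets d V)"
proof -
  have f: "inj_on f V" "f ` V = V'" using assms by (auto simp: bij_betw_def)
  have inj: "inj_on ((`) f) (Pow V)" using f(1) by (rule inj_on_image_Pow)
  show "inj_on ((`) f) (dsets d V)" by (rule inj_on_subset[OF inj]) (auto simp: dsets_def)
  have c: "card (f ` e) = card e" if "e \<subseteq> V" for e
    using f(1) that by (meson card_image inj_on_subset)
  show "dsets d V' = (`) f ` dsets d V"
  proof
    show "dsets d V' \<subseteq> (`) f ` dsets d V"
    proof
      fix e' assume e': "e' \<in> dsets d V'"
      then obtain e where "e \<subseteq> V" "e' = f ` e" using f(2) by (auto simp: dsets_def subset_image_iff)
      then show "e' \<in> (`) f ` dsets d V" using c e' by (auto simp: dsets_def)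
    qed
    show "(`) f ` dsets d V \<subseteq> dsets d V'" using c f(2) by (auto simp: dsets_def)
  qed
qed

lemma Pr_iso:
  assumes "bij_betw f V V'" "\<And>E. E \<subseteq> dsets d V \<Longrightarrow> Q' ((`) f ` E) \<longleftrightarrow> Q E"
  shows "Pr (dsets d V') p Q' = Pr (dsets d V) p Q"
  unfolding dsets_image(1)[OF assms(1)] Pr_image[OF dsets_image(2)[OF assms(1)]]
  by (rule Pr_cong) (rule assms(2))

lemma iso_via_image: "bij_betw f V V' \<Longrightarrow> iso_via f (V, E) (V', (`) f ` E)"
  by (simp add: iso_via_def)

text \<open>The number of vertices and \<open>p\<close> are separate arguments because removing a
  union of components lowers the first and keeps the second.\<close>

definition prob_uni_free :: "nat \<Rightarrow> nat \<Rightarrow> real \<Rightarrow> real" where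
  "prob_uni_free d n p = Pr (dsets d {1..n}) p (\<lambda>E. uni_free d ({1..n}, E))"

lemma Pr_uni_free:
  fixes V :: "'a set"
  assumes "finite V"
  shows "Pr (dsets d V) p (\<lambda>E. uni_free d (V, E)) = prob_uni_free d (card V) p"
proof -
  obtain f where f: "bij_betw f V {1..card V}"
    using finite_same_card_bij[of V "{1..card V}"] assms by auto
  show ?thesis unfolding prob_uni_free_def
    by (rule Pr_iso[OF f, symmetric])
      (rule iso_via_uni_free[OF uniform_dsets[OF assms] iso_via_image[OF f]])
qed

lemma Pr_induced:
  assumes "finite V" "W \<subseteq> V"
  shows "Pr (dsets d V) p (\<lambda>E. Q {e \<in> E. e \<subseteq> W}) = Pr (dsets d W) p Q"
proof -
  have "Pr (dsets d V) p (\<lambda>E. Q {e \<in> E. e \<subseteq> W}) = Pr (dsets d V) p (\<lambda>E. Q (E \<inter> dsets d W))"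
  proof (rule Pr_cong)
    fix E assume "E \<subseteq> dsets d V"
    then have "{e \<in> E. e \<subseteq> W} = E \<inter> dsets d W" by (auto simp: dsets_def)
    then show "Q {e \<in> E. e \<subseteq> W} \<longleftrightarrow> Q (E \<inter> dsets d W)" by simp
  qed
  also have "\<dots> = Pr (dsets d W) p Q" by (rule Pr_restrict[OF finite_dsets[OF assms(1)] dsets_mono[OF assms(2)]])
  finally show ?thesis .
qed

lemma Pr_abs_diff:
  assumes "0 \<le> p" "p \<le> 1" "\<And>E. E \<subseteq> D \<Longrightarrow> \<not> B E \<Longrightarrow> Q E \<longleftrightarrow> R E"
  shows "\<bar>Pr D p Q - Pr D p R\<bar> \<le> Pr D p B"
proof -
  have "Pr D p Q \<le> Pr D p (\<lambda>E. R E \<or> B E)" "Pr D p R \<le> Pr D p (\<lambda>E. Q E \<or> B E)"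
    using assms(3) by (auto intro!: Pr_mono[OF assms(1,2)])
  moreover have "Pr D p (\<lambda>E. R E \<or> B E) \<le> Pr D p R + Pr D p B"
    "Pr D p (\<lambda>E. Q E \<or> B E) \<le> Pr D p Q + Pr D p B" by (intro Pr_union[OF assms(1,2)])+
  ultimately show ?thesis by linarith
qed

text \<open>Deleting \<open>x\<close> changes the event only if \<open>x\<close> lies in a cyclic
  component. The difference does not depend on \<open>x\<close>, so summing over all vertices bounds
  \<open>Suc n\<close> times it by the expected number of cyclic vertices.\<close>

lemma prob_uni_free_Suc_diff:
  assumes d: "d \<ge> 1" and p: "0 \<le> p" "p \<le> 1"
    and r: "p * (real (Suc n) * (real (Suc n) ^ (d - 2) / fact (d - 2))) \<le> r" "r < 1"
  shows "\<bar>prob_uni_free d (Suc n) p - prob_uni_free d n p\<bar> \<le> cyclic_bound d r / real (Suc n)"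
proof -
  let ?V = "{1..Suc n}"
  let ?D = "dsets d ?V"
  have fin: "finite ?V" and cV: "card ?V = Suc n" by auto
  have 1: "\<bar>prob_uni_free d (Suc n) p - prob_uni_free d n p\<bar> \<le> Pr ?D p (\<lambda>E. x \<in> cyclic_verts E)"
    if x: "x \<in> ?V" for x
  proof -
    have "prob_uni_free d n p = Pr (dsets d (?V - {x})) p (\<lambda>E. uni_free d (?V - {x}, E))"
      using Pr_uni_free[of "?V - {x}" d p] x by (simp only: finite_Diff[OF fin] card_Diff_singleton cV) simp
    also have "\<dots> = Pr ?D p (\<lambda>E. uni_free d (?V - {x}, {e \<in> E. e \<subseteq> ?V - {x}}))"
      by (rule Pr_induced[OF fin, symmetric]) blast
    finally have eq: "prob_uni_free d n p = Pr ?D p (\<lambda>E. uni_free d (?V - {x}, {e \<in> E. e \<subseteq> ?V - {x}}))" .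
    show ?thesis unfolding eq unfolding prob_uni_free_def
    proof (rule Pr_abs_diff[OF p])
      fix E assume E: "E \<subseteq> ?D" "x \<notin> cyclic_verts E"
      show "uni_free d (?V, E) \<longleftrightarrow> uni_free d (?V - {x}, {e \<in> E. e \<subseteq> ?V - {x}})"
        using uni_free_delete_vertex[OF uniform_dsets[OF fin E(1)] d, of x] E(2)
        by (simp add: induced_def)
    qed
  qed
  have "real (Suc n) * \<bar>prob_uni_free d (Suc n) p - prob_uni_free d n p\<bar> =
      (\<Sum>x\<in>?V. \<bar>prob_uni_free d (Suc n) p - prob_uni_free d n p\<bar>)" by simp
  also have "\<dots> \<le> (\<Sum>x\<in>?V. Pr ?D p (\<lambda>E. x \<in> cyclic_verts E))" by (rule sum_mono) (rule 1)
  also have "\<dots> = Expect ?D p (\<lambda>E. real (card {x \<in> ?V. x \<in> cyclic_verts E}))"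
    by (rule Expect_card[OF fin, symmetric])
  also have "\<dots> = Expect ?D p (\<lambda>E. real (card (cyclic_verts E)))"
  proof (rule Expect_cong)
    fix E assume "E \<subseteq> ?D"
    from cyclic_verts_subset[OF this] have "{x \<in> ?V. x \<in> cyclic_verts E} = cyclic_verts E" by blast
    then show "real (card {x \<in> ?V. x \<in> cyclic_verts E}) = real (card (cyclic_verts E))" by simp
  qed
  also have "\<dots> \<le> cyclic_bound d r"
    by (rule expected_cyclic_verts[OF fin p]) (use r in \<open>simp_all only: cV\<close>)
  finally show ?thesis by (simp add: field_simps)
qed

lemma prob_uni_free_diff:
  assumes "m \<le> n" and d: "d \<ge> 1" and p: "0 \<le> p" "p \<le> 1"
    and r: "p * (real n * (real n ^ (d - 2) / fact (d - 2))) \<le> r" "0 \<le> r" "r < 1"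
  shows "\<bar>prob_uni_free d n p - prob_uni_free d m p\<bar> \<le> real (n - m) * (cyclic_bound d r / real (Suc m))"
  using assms(1) r(1)
proof (induction n rule: dec_induct)
  case base
  then show ?case by simp
next
  case (step n)
  have "real n * (real n ^ (d - 2) / fact (d - 2)) \<le> real (Suc n) * (real (Suc n) ^ (d - 2) / fact (d - 2))"
    by (intro mult_mono divide_right_mono power_mono) auto
  then have "p * (real n * (real n ^ (d - 2) / fact (d - 2))) \<le> r"
    using step.prems p(1) by (meson mult_left_mono order_trans)
  then have IH: "\<bar>prob_uni_free d n p - prob_uni_free d m p\<bar> \<le> real (n - m) * (cyclic_bound d r / real (Suc m))"
    by (rule step.IH)
  \<comment> \<open>Nonnegative as an upper bound of a nonnegative expectation, here over the empty
    vertex set.\<close>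
  have K: "cyclic_bound d r \<ge> 0"
  proof -
    have "0 \<le> Expect (dsets d ({} :: nat set)) p (\<lambda>E. real (card (cyclic_verts E)))"
      unfolding Expect_def using p by (intro sum_nonneg) auto
    also have "\<dots> \<le> cyclic_bound d r" by (rule expected_cyclic_verts) (use p r in auto)
    finally show ?thesis .
  qed
  have "\<bar>prob_uni_free d (Suc n) p - prob_uni_free d n p\<bar> \<le> cyclic_bound d r / real (Suc n)"
    by (rule prob_uni_free_Suc_diff[OF d p step.prems r(3)])
  also have "\<dots> \<le> cyclic_bound d r / real (Suc m)"
    using step.hyps K by (intro divide_left_mono) auto
  finally have "\<bar>prob_uni_free d (Suc n) p - prob_uni_free d m p\<bar> \<le>
      cyclic_bound d r / real (Suc m) + real (n - m) * (cyclic_bound d r / real (Suc m))"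
    using IH by linarith
  also have "\<dots> = real (Suc n - m) * (cyclic_bound d r / real (Suc m))"
    using step.hyps by (simp add: Suc_diff_le distrib_right del: times_divide_eq_right times_divide_eq_left)
  finally show ?case .
qed

section \<open>Removing a union of components\<close>

text \<open>The first two conditions fix the status of every possible edge meeting \<open>W\<close>:
  those in \<open>F\<close> are present, all others absent. The exponent of \<open>1 - p\<close>
  counts the latter, and the edges inside \<open>V - W\<close> stay independent.\<close>

lemma Pr_copy:
  assumes V: "finite V" and W: "W \<subseteq> V" and F: "F \<subseteq> dsets d W" and d: "d \<ge> 1"
  shows "Pr (dsets d V) p (\<lambda>E. closed_in (V, E) W \<and> {e \<in> E. e \<subseteq> W} = F \<and> Q {e \<in> E. e \<subseteq> V - W}) =
    p ^ card F * (1 - p) ^ ((card V choose d) - ((card V - card W) choose d) - card F) *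
    Pr (dsets d (V - W)) p Q"
proof -
  let ?D2 = "dsets d (V - W)"
  let ?D1 = "dsets d V - ?D2"
  have fin: "finite (dsets d V)" "finite ?D1" "finite ?D2" "finite W" using V W finite_subset by auto
  have D2: "?D2 \<subseteq> dsets d V" by (rule dsets_mono) blast
  then have un: "?D1 \<union> ?D2 = dsets d V" by blast
  have FD1: "F \<subseteq> ?D1"
  proof
    fix e assume "e \<in> F"
    then have e: "e \<subseteq> W" "card e = d" using F by (auto simp: dsets_def)
    then have "e \<noteq> {}" using d by auto
    then show "e \<in> ?D1" using e W by (auto simp: dsets_def)
  qed
  have "Pr (dsets d V) p (\<lambda>E. closed_in (V, E) W \<and> {e \<in> E. e \<subseteq> W} = F \<and> Q {e \<in> E. e \<subseteq> V - W}) =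
      Pr (?D1 \<union> ?D2) p (\<lambda>E. E \<inter> ?D1 = F \<and> Q (E \<inter> ?D2))"
    unfolding un
  proof (rule Pr_cong)
    fix E assume E: "E \<subseteq> dsets d V"
    have 1: "{e \<in> E. e \<subseteq> V - W} = E \<inter> ?D2" using E by (auto simp: dsets_def)
    have D1: "E \<inter> ?D1 = {e \<in> E. e \<inter> W \<noteq> {}}" using E by (auto simp: dsets_def)
    have ne: "e \<inter> W \<noteq> {}" if "e \<in> E" "e \<subseteq> W" for e
    proof -
      have "card e = d" using that E by (auto simp: dsets_def)
      then have "e \<noteq> {}" using d by auto
      then show ?thesis using that by blast
    qed
    have "closed_in (V, E) W \<and> {e \<in> E. e \<subseteq> W} = F \<longleftrightarrow> E \<inter> ?D1 = F"
    proof
      assume "closed_in (V, E) W \<and> {e \<in> E. e \<subseteq> W} = F"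
      then have cl: "\<And>e. e \<in> E \<Longrightarrow> e \<inter> W \<noteq> {} \<Longrightarrow> e \<subseteq> W" and F': "{e \<in> E. e \<subseteq> W} = F"
        by (auto simp only: closed_in_def snd_conv)
      show "E \<inter> ?D1 = F" unfolding D1 F'[symmetric] using cl ne by blast
    next
      assume "E \<inter> ?D1 = F"
      then have F': "F = {e \<in> E. e \<inter> W \<noteq> {}}" using D1 by simp
      have "\<And>e. e \<in> F \<Longrightarrow> e \<subseteq> W" using F by (auto simp: dsets_def)
      then have cl: "\<And>e. e \<in> E \<Longrightarrow> e \<inter> W \<noteq> {} \<Longrightarrow> e \<subseteq> W" unfolding F' by simp
      then have "closed_in (V, E) W" using W by (simp add: closed_in_def)
      moreover have "{e \<in> E. e \<subseteq> W} = F" unfolding F' using cl ne by blast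
      ultimately show "closed_in (V, E) W \<and> {e \<in> E. e \<subseteq> W} = F" by simp
    qed
    then show "(closed_in (V, E) W \<and> {e \<in> E. e \<subseteq> W} = F \<and> Q {e \<in> E. e \<subseteq> V - W}) \<longleftrightarrow>
      (E \<inter> ?D1 = F \<and> Q (E \<inter> ?D2))" unfolding 1 by blast
  qed
  also have "\<dots> = Pr ?D1 p (\<lambda>E. E = F) * Pr ?D2 p Q"
    by (rule Pr_split[OF fin(2,3), where Q = "\<lambda>E. E = F"]) blast
  also have "Pr ?D1 p (\<lambda>E. E = F) = p ^ card F * (1 - p) ^ card (?D1 - F)"
    by (rule Pr_eq[OF fin(2) FD1])
  also have "card (?D1 - F) = card ?D1 - card F"
    by (rule card_Diff_subset[OF finite_subset[OF FD1 fin(2)] FD1])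
  also have "card ?D1 = (card V choose d) - ((card V - card W) choose d)"
    using card_Diff_subset[OF fin(3) D2] card_dsets[OF V, of d] card_dsets[of "V - W" d] V
      card_Diff_subset[OF fin(4) W] by simp
  finally show ?thesis .
qed

definition iso_closed :: "'a hypergraph set \<Rightarrow> bool" where
  "iso_closed C \<longleftrightarrow> (\<forall>H K f. H \<in> C \<longrightarrow> wf_hypergraph H \<longrightarrow> iso_via f H K \<longrightarrow> K \<in> C)"

definition copies :: "nat \<Rightarrow> 'a hypergraph set \<Rightarrow> 'a set \<Rightarrow> 'a hypergraph set" where
  "copies d C V = {(W, F). W \<subseteq> V \<and> F \<subseteq> dsets d W \<and> (W, F) \<in> C}"

text \<open>For the isomorphism class of a \<open>d\<close>-uniform hypergraph on v vertices this is
  v! divided by the number of its automorphisms.\<close>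

definition labelings :: "nat \<Rightarrow> nat hypergraph set \<Rightarrow> nat \<Rightarrow> nat" where
  "labelings d C v = card {F. F \<subseteq> dsets d {1..v} \<and> ({1..v}, F) \<in> C}"

lemma finite_copies: "finite V \<Longrightarrow> finite (copies d C V)"
  unfolding copies_def
  by (rule finite_subset[of _ "Pow V \<times> Pow (dsets d V)"]) (auto simp: dsets_def)

lemma card_copies:
  fixes V :: "nat set"
  assumes V: "finite V" and C: "iso_closed C" "\<And>H. H \<in> C \<Longrightarrow> card (verts H) = v"
  shows "card (copies d C V) = (card V choose v) * labelings d C v"
proof -
  have "copies d C V = (SIGMA W:dsets v V. {F. F \<subseteq> dsets d W \<and> (W, F) \<in> C})"
    using C(2) unfolding copies_def by (fastforce simp: dsets_def)
  moreover have "card {F. F \<subseteq> dsets d W \<and> (W, F) \<in> C} = labelings d C v" if W: "W \<in> dsets v V" for W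
  proof -
    have "finite W" "card W = v" using W V finite_subset by (auto simp: dsets_def)
    then obtain f where f: "bij_betw f {1..v} W"
      using finite_same_card_bij[of "{1..v}" W] by auto
    let ?g = "inv_into {1..v} f"
    have g: "bij_betw ?g W {1..v}" by (rule bij_betw_inv_into[OF f])
    have fg: "(`) f ` (`) ?g ` F = F" if "F \<subseteq> dsets d W" for F
    proof -
      have "f ` ?g ` e = e" if "e \<in> F" for e
        using f that \<open>F \<subseteq> dsets d W\<close> by (intro image_inv_into_cancel) (auto simp: bij_betw_def dsets_def)
      then show ?thesis unfolding image_image[of "(`) f" "(`) ?g" F] by simp
    qed
    have gf: "(`) ?g ` (`) f ` F = F" if "F \<subseteq> dsets d {1..v}" for F
    proof -
      have "?g ` f ` e = e" if "e \<in> F" for e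
        using f that \<open>F \<subseteq> dsets d {1..v}\<close> by (intro inv_into_image_cancel) (auto simp: bij_betw_def dsets_def)
      then show ?thesis unfolding image_image[of "(`) ?g" "(`) f" F] by simp
    qed
    have tr: "(`) h ` F \<in> {F. F \<subseteq> dsets d Y \<and> (Y, F) \<in> C}"
      if "bij_betw h X Y" "F \<in> {F. F \<subseteq> dsets d X \<and> (X, F) \<in> C}" for h X Y F
    proof -
      have F: "F \<subseteq> dsets d X" "(X, F) \<in> C" using that(2) by auto
      have "wf_hypergraph (X, F)" using F(1) by (auto simp: dsets_def)
      then have "(Y, (`) h ` F) \<in> C" using C(1) F(2) iso_via_image[OF that(1), of F]
        unfolding iso_closed_def by blast
      moreover have "(`) h ` F \<subseteq> dsets d Y" unfolding dsets_image(1)[OF that(1)] by (rule image_mono[OF F(1)])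
      ultimately show ?thesis by simp
    qed
    have "bij_betw (\<lambda>F. (`) f ` F) {F. F \<subseteq> dsets d {1..v} \<and> ({1..v}, F) \<in> C} {F. F \<subseteq> dsets d W \<and> (W, F) \<in> C}"
    proof (rule bij_betw_byWitness[where f' = "\<lambda>F. (`) ?g ` F"])
      show "\<forall>F\<in>{F. F \<subseteq> dsets d {1..v} \<and> ({1..v}, F) \<in> C}. (`) ?g ` (`) f ` F = F" using gf by simp
      show "\<forall>F\<in>{F. F \<subseteq> dsets d W \<and> (W, F) \<in> C}. (`) f ` (`) ?g ` F = F" using fg by simp
      show "(\<lambda>F. (`) f ` F) ` {F. F \<subseteq> dsets d {1..v} \<and> ({1..v}, F) \<in> C} \<subseteq> {F. F \<subseteq> dsets d W \<and> (W, F) \<in> C}"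
        by (rule image_subsetI) (rule tr[OF f])
      show "(\<lambda>F. (`) ?g ` F) ` {F. F \<subseteq> dsets d W \<and> (W, F) \<in> C} \<subseteq> {F. F \<subseteq> dsets d {1..v} \<and> ({1..v}, F) \<in> C}"
        by (rule image_subsetI) (rule tr[OF g])
    qed
    then show ?thesis unfolding labelings_def by (rule bij_betw_same_card[symmetric])
  qed
  moreover have "finite {F. F \<subseteq> dsets d W \<and> (W, F) \<in> C}" if "W \<in> dsets v V" for W
  proof -
    have "finite W" using that V finite_subset by (auto simp: dsets_def)
    then have "finite (Pow (dsets d W))" by simp
    then show ?thesis by (rule rev_finite_subset) blast
  qed
  ultimately show ?thesis using V by (simp add: card_dsets)
qed

text \<open>Times \<open>labelings\<close>, this is the expected number of closed sets inducing a
  member of a class with \<open>v\<close> vertices and \<open>k\<close> edges.\<close>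

definition copy_weight :: "nat \<Rightarrow> nat \<Rightarrow> nat \<Rightarrow> nat \<Rightarrow> real \<Rightarrow> real" where
  "copy_weight d n v k p =
     real (n choose v) * (p ^ k * (1 - p) ^ ((n choose d) - ((n - v) choose d) - k))"

lemma induced_pair: "induced (V, E) W = (W, {e \<in> E. e \<subseteq> W})"
  by (simp add: induced_def)

lemma copies_in_class:
  "(W, F) \<in> copies d C V \<Longrightarrow> W \<subseteq> V \<and> F \<subseteq> dsets d W \<and> (W, F) \<in> C"
  by (simp add: copies_def)

text \<open>By \<open>frag_verts_iff\<close> the fragment is a given copy iff that copy is closed
  and leaves no unicycle outside. These events exclude each other, and by \<open>Pr_copy\<close> all
  have the same probability.\<close>

lemma prob_Frag_in_class:
  fixes C :: "nat hypergraph set"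
  assumes C: "iso_closed C" "\<And>H. H \<in> C \<Longrightarrow> all_uni d H \<and> card (verts H) = v \<and> card (edges H) = k"
    and d: "d \<ge> 1"
  shows "Pr (dsets d {1..n}) p (\<lambda>E. Frag d ({1..n}, E) \<in> C) =
    real (labelings d C v) * copy_weight d n v k p * prob_uni_free d (n - v) p"
proof -
  let ?V = "{1..n}"
  define Q where "Q = (\<lambda>(W, F) E. closed_in (?V, E) W \<and> {e \<in> E. e \<subseteq> W} = F \<and>
      uni_free d (?V - W, {e \<in> E. e \<subseteq> ?V - W}))"
  have iff: "Q (W, F) E \<longleftrightarrow> Frag d (?V, E) = (W, F) \<and> F = {e \<in> E. e \<subseteq> W}"
    if E: "E \<subseteq> dsets d ?V" and WF: "(W, F) \<in> C" for W F E
  proof -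
    have u: "uniform_hypergraph d (?V, E)" by (rule uniform_dsets[OF _ E]) simp
    note ind = induced_pair
    have Fr: "Frag d (?V, E) = (frag_verts d (?V, E), {e \<in> E. e \<subseteq> frag_verts d (?V, E)})"
      using Frag_eq[OF u d] ind by simp
    have au: "all_uni d (W, F)" using C(2)[OF WF] by simp
    show ?thesis
    proof
      assume "Q (W, F) E"
      then have q: "closed_in (?V, E) W" "{e \<in> E. e \<subseteq> W} = F"
        "uni_free d (?V - W, {e \<in> E. e \<subseteq> ?V - W})" unfolding Q_def by auto
      then have "W = frag_verts d (?V, E)"
        using frag_verts_iff[OF u d, of W] au by (simp add: ind)
      then show "Frag d (?V, E) = (W, F) \<and> F = {e \<in> E. e \<subseteq> W}" using Fr q(2) by simp
    next
      assume a: "Frag d (?V, E) = (W, F) \<and> F = {e \<in> E. e \<subseteq> W}"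
      then have "W = frag_verts d (?V, E)" using Fr by simp
      then have "closed_in (?V, E) W" "uni_free d (induced (?V, E) (verts (?V, E) - W))"
        using frag_verts_iff[OF u d, of W] by auto
      then show "Q (W, F) E" using a unfolding Q_def by (simp add: ind)
    qed
  qed
  have "Pr (dsets d ?V) p (\<lambda>E. Frag d (?V, E) \<in> C) = Pr (dsets d ?V) p (\<lambda>E. \<exists>H\<in>copies d C ?V. Q H E)"
  proof (rule Pr_cong)
    fix E assume E: "E \<subseteq> dsets d ?V"
    have u: "uniform_hypergraph d (?V, E)" by (rule uniform_dsets[OF _ E]) simp
    show "Frag d (?V, E) \<in> C \<longleftrightarrow> (\<exists>H\<in>copies d C ?V. Q H E)"
    proof
      assume FC: "Frag d (?V, E) \<in> C"
      let ?W = "frag_verts d (?V, E)"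
      have Fr: "Frag d (?V, E) = (?W, {e \<in> E. e \<subseteq> ?W})" using Frag_eq[OF u d] by (simp add: induced_def)
      have WV: "?W \<subseteq> ?V" using closed_in_frag_verts[of "(?V, E)" d] by (simp add: closed_in_def)
      have "(?W, {e \<in> E. e \<subseteq> ?W}) \<in> copies d C ?V"
        using FC Fr WV E by (auto simp: copies_def dsets_def)
      moreover have "Q (?W, {e \<in> E. e \<subseteq> ?W}) E" using iff[OF E, of ?W "{e \<in> E. e \<subseteq> ?W}"] FC Fr by simp
      ultimately show "\<exists>H\<in>copies d C ?V. Q H E" by blast
    next
      assume "\<exists>H\<in>copies d C ?V. Q H E"
      then obtain H where H: "H \<in> copies d C ?V" "Q H E" by blast
      obtain W F where HWF: "H = (W, F)" by (cases H)
      have "(W, F) \<in> C" using copies_in_class[of W F d C ?V] H HWF by simp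
      then show "Frag d (?V, E) \<in> C" using iff[OF E, of W F] H(2) HWF by simp
    qed
  qed
  also have "\<dots> = (\<Sum>H\<in>copies d C ?V. Pr (dsets d ?V) p (Q H))"
  proof (rule Pr_Bex_unique)
    fix E H K assume h: "E \<subseteq> dsets d ?V" "H \<in> copies d C ?V" "K \<in> copies d C ?V" "Q H E" "Q K E"
    have "Frag d (?V, E) = H" if "H \<in> copies d C ?V" "Q H E" for H
      using iff[OF h(1), of "fst H" "snd H"] copies_in_class[of "fst H" "snd H"] that by simp
    then show "H = K" using h by metis
  qed (simp add: finite_copies)
  also have "\<dots> = (\<Sum>H\<in>copies d C ?V.
      p ^ k * (1 - p) ^ ((n choose d) - ((n - v) choose d) - k) * prob_uni_free d (n - v) p)"
  proof (rule sum.cong[OF refl])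
    fix H assume "H \<in> copies d C ?V"
    moreover obtain W F where HWF: "H = (W, F)" by (cases H)
    ultimately have H: "H = (W, F)" "W \<subseteq> ?V" "F \<subseteq> dsets d W" "(W, F) \<in> C"
      using copies_in_class[of W F d C ?V] by simp_all
    have c: "card W = v" "card F = k" using C(2)[OF H(4)] by auto
    have "finite W" using H(2) finite_subset by blast
    then have c': "card (?V - W) = n - v" using H(2) c by (simp add: card_Diff_subset)
    have "Pr (dsets d ?V) p (Q H) = p ^ card F * (1 - p) ^ ((card ?V choose d) - ((card ?V - card W) choose d) - card F) *
        Pr (dsets d (?V - W)) p (\<lambda>E. uni_free d (?V - W, E))"
      unfolding H(1) Q_def case_prod_conv by (rule Pr_copy) (use H d in auto)
    also have "Pr (dsets d (?V - W)) p (\<lambda>E. uni_free d (?V - W, E)) = prob_uni_free d (n - v) p"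
      using Pr_uni_free[of "?V - W" d p] c' by simp
    finally show "Pr (dsets d ?V) p (Q H) =
      p ^ k * (1 - p) ^ ((n choose d) - ((n - v) choose d) - k) * prob_uni_free d (n - v) p"
      using c by simp
  qed
  also have "\<dots> = real (card (copies d C ?V)) *
      (p ^ k * (1 - p) ^ ((n choose d) - ((n - v) choose d) - k) * prob_uni_free d (n - v) p)" by simp
  also have "card (copies d C ?V) = (n choose v) * labelings d C v"
    using card_copies[OF _ C(1), of ?V v d] C(2) by simp
  finally show ?thesis by (simp add: copy_weight_def)
qed

section \<open>Components of a given isomorphism type\<close>

definition comp_copies :: "'a hypergraph set \<Rightarrow> 'a hypergraph \<Rightarrow> 'a set set" where
  "comp_copies C H = {W. closed_in H W \<and> induced H W \<in> C}"

text \<open>Any other component of a type in \<open>C\<close> is disjoint from \<open>W\<close> and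
  survives its removal, so the count drops by exactly one.\<close>

lemma comp_copies_remove:
  assumes H: "uniform_hypergraph d H" and d: "d \<ge> 1" and C: "\<And>K. K \<in> C \<Longrightarrow> connected_hypergraph K"
    and W: "W \<in> comp_copies C H"
  shows "comp_copies C H = insert W (comp_copies C (induced H (verts H - W)))"
    and "W \<notin> comp_copies C (induced H (verts H - W))"
proof -
  note ne = uniform_edges_ne[OF H d] and wf = uniform_wf[OF H]
  have W': "closed_in H W" "induced H W \<in> C" using W by (auto simp: comp_copies_def)
  have cW: "connected_hypergraph (induced H W)" using C W' by blast
  have W0: "W \<noteq> {}" using cW by (auto simp: connected_hypergraph_def)
  have cl: "closed_in H (verts H - W)" by (rule closed_in_Diff[OF W'(1) wf])
  show "W \<notin> comp_copies C (induced H (verts H - W))"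
    using W0 by (auto simp: comp_copies_def closed_in_def)
  have "U \<in> comp_copies C H \<longleftrightarrow> U = W \<or> U \<in> comp_copies C (induced H (verts H - W))" for U
  proof
    assume U: "U \<in> comp_copies C H"
    then have U': "closed_in H U" "induced H U \<in> C" by (auto simp: comp_copies_def)
    have cU: "connected_hypergraph (induced H U)" using C U' by blast
    show "U = W \<or> U \<in> comp_copies C (induced H (verts H - W))"
    proof (cases "U \<inter> W = {}")
      case True
      then have sub: "U \<subseteq> verts H - W" using U'(1) by (auto simp: closed_in_def)
      then have "closed_in (induced H (verts H - W)) U" using closed_in_induced[OF cl sub ne] U'(1) by simp
      then show ?thesis using U'(2) by (simp add: comp_copies_def induced_induced[OF sub])
    next
      case False
      then obtain x where "x \<in> U" "x \<in> W" by blast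
      then have "U = W"
        using connected_closed_eq_link_class[OF U'(1) cU] connected_closed_eq_link_class[OF W'(1) cW] by metis
      then show ?thesis by simp
    qed
  next
    assume a: "U = W \<or> U \<in> comp_copies C (induced H (verts H - W))"
    show "U \<in> comp_copies C H"
    proof (cases "U = W")
      case False
      then have U: "closed_in (induced H (verts H - W)) U" "induced (induced H (verts H - W)) U \<in> C"
        using a by (auto simp: comp_copies_def)
      then have sub: "U \<subseteq> verts H - W" by (simp add: closed_in_def)
      have "closed_in H U" using closed_in_induced[OF cl sub ne] U(1) by simp
      then show ?thesis using U(2) by (simp add: comp_copies_def induced_induced[OF sub])
    qed (use W in simp)
  qed
  then show "comp_copies C H = insert W (comp_copies C (induced H (verts H - W)))" by blast
qed

lemma finite_comp_copies: "finite (verts H) \<Longrightarrow> finite (comp_copies C H)"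
  by (rule finite_subset[of _ "Pow (verts H)"]) (auto simp: comp_copies_def closed_in_def)

lemma card_comp_copies_iso:
  fixes H K :: "'a hypergraph"
  assumes H: "uniform_hypergraph d H" and f: "iso_via f H K" and C: "iso_closed C"
  shows "card (comp_copies C K) = card (comp_copies C H)"
proof -
  have le: "card (comp_copies C H) \<le> card (comp_copies C K)"
    if H: "uniform_hypergraph d H" and f: "iso_via f H K" for f and H K :: "'a hypergraph"
  proof (rule card_inj_on_le)
    have inj: "inj_on f (verts H)" using f by (simp add: iso_via_def bij_betw_def)
    show "inj_on ((`) f) (comp_copies C H)"
      by (rule inj_on_subset[OF inj_on_image_Pow[OF inj]]) (auto simp: comp_copies_def closed_in_def)
    show "(`) f ` comp_copies C H \<subseteq> comp_copies C K"
    proof (rule image_subsetI)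
      fix W assume "W \<in> comp_copies C H"
      then have W: "closed_in H W" "induced H W \<in> C" by (auto simp: comp_copies_def)
      have WV: "W \<subseteq> verts H" using W(1) by (simp add: closed_in_def)
      have "closed_in K (f ` W)" by (rule iso_via_closed_in[OF uniform_wf[OF H] f W(1)])
      moreover have "induced K (f ` W) \<in> C"
        using C W(2) uniform_wf[OF uniform_induced[OF H WV]] iso_via_induced[OF uniform_wf[OF H] f WV]
        unfolding iso_closed_def by metis
      ultimately show "f ` W \<in> comp_copies C K" by (simp add: comp_copies_def)
    qed
    show "finite (comp_copies C K)"
      using iso_via_uniform[OF H f] by (intro finite_comp_copies) (simp add: uniform_hypergraph_def)
  qed
  show ?thesis
    using le[OF H f] le[OF iso_via_uniform[OF H f] iso_via_inv[OF uniform_wf[OF H] f]] by linarith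
qed

definition prob_copies :: "nat \<Rightarrow> nat hypergraph set \<Rightarrow> nat \<Rightarrow> real \<Rightarrow> nat \<Rightarrow> real" where
  "prob_copies d C n p j = Pr (dsets d {1..n}) p (\<lambda>E. card (comp_copies C ({1..n}, E)) = j)"

lemma Pr_copies:
  fixes V :: "nat set"
  assumes "finite V" "iso_closed C"
  shows "Pr (dsets d V) p (\<lambda>E. card (comp_copies C (V, E)) = j) = prob_copies d C (card V) p j"
proof -
  obtain f where f: "bij_betw f V {1..card V}"
    using finite_same_card_bij[of V "{1..card V}"] assms by auto
  show ?thesis unfolding prob_copies_def
  proof (rule Pr_iso[OF f, symmetric])
    fix E assume "E \<subseteq> dsets d V"
    from card_comp_copies_iso[OF uniform_dsets[OF assms(1) this] iso_via_image[OF f] assms(2)]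
    show "card (comp_copies C ({1..card V}, (`) f ` E)) = j \<longleftrightarrow> card (comp_copies C (V, E)) = j" by simp
  qed
qed

text \<open>Double counting of the pairs consisting of a component of type \<open>C\<close> and a hypergraph with
  exactly \<open>j + 1\<close> such components.\<close>

lemma prob_copies_Suc:
  fixes C :: "nat hypergraph set"
  assumes C: "iso_closed C"
      "\<And>H. H \<in> C \<Longrightarrow> connected_hypergraph H \<and> card (verts H) = v \<and> card (edges H) = k"
    and d: "d \<ge> 1"
  shows "real (Suc j) * prob_copies d C n p (Suc j) =
    real (labelings d C v) * copy_weight d n v k p * prob_copies d C (n - v) p j"
proof -
  let ?V = "{1..n}"
  define Q where "Q = (\<lambda>(W, F) E. closed_in (?V, E) W \<and> {e \<in> E. e \<subseteq> W} = F \<and>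
      card (comp_copies C (?V - W, {e \<in> E. e \<subseteq> ?V - W})) = j)"
  have fin: "finite (copies d C ?V)" by (simp add: finite_copies)
  have "real (Suc j) * prob_copies d C n p (Suc j) =
     Expect (dsets d ?V) p (\<lambda>E. real (card {H \<in> copies d C ?V. Q H E}))"
    unfolding prob_copies_def Pr_def Expect_cmult[symmetric]
  proof (rule Expect_cong)
    fix E assume E: "E \<subseteq> dsets d ?V"
    let ?H = "(?V, E)"
    have u: "uniform_hypergraph d ?H" by (rule uniform_dsets[OF _ E]) simp
    have finX: "finite (comp_copies C ?H)" by (rule finite_comp_copies) simp
    let ?g = "\<lambda>W. (W, {e \<in> E. e \<subseteq> W})"
    let ?X = "{W \<in> comp_copies C ?H. card (comp_copies C (?V - W, {e \<in> E. e \<subseteq> ?V - W})) = j}"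
    have eq: "{H \<in> copies d C ?V. Q H E} = ?g ` ?X"
    proof (intro equalityI subsetI)
      fix H assume h: "H \<in> {H \<in> copies d C ?V. Q H E}"
      obtain W F where H: "H = (W, F)" by (cases H)
      have "(W, F) \<in> C" using h H copies_in_class[of W F d C ?V] by simp
      then have "W \<in> ?X" "H = ?g W" using h H by (auto simp: Q_def comp_copies_def induced_pair)
      then show "H \<in> ?g ` ?X" by blast
    next
      fix H assume "H \<in> ?g ` ?X"
      then obtain W where W: "W \<in> ?X" "H = ?g W" by blast
      then have W': "closed_in ?H W" "?g W \<in> C" by (auto simp: comp_copies_def induced_pair)
      then have "W \<subseteq> ?V" by (simp add: closed_in_def)
      moreover have "{e \<in> E. e \<subseteq> W} \<subseteq> dsets d W" using E by (auto simp: dsets_def)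
      ultimately show "H \<in> {H \<in> copies d C ?V. Q H E}" using W W' by (auto simp: copies_def Q_def)
    qed
    have "card (comp_copies C ?H) = Suc (card (comp_copies C (?V - W, {e \<in> E. e \<subseteq> ?V - W})))"
      if W: "W \<in> comp_copies C ?H" for W
    proof -
      have ind: "induced ?H (verts ?H - W) = (?V - W, {e \<in> E. e \<subseteq> ?V - W})" by (simp add: induced_def)
      have "comp_copies C ?H = insert W (comp_copies C (?V - W, {e \<in> E. e \<subseteq> ?V - W}))"
        "W \<notin> comp_copies C (?V - W, {e \<in> E. e \<subseteq> ?V - W})"
        using comp_copies_remove[OF u d _ W] C(2) unfolding ind by blast+
      moreover have "finite (comp_copies C (?V - W, {e \<in> E. e \<subseteq> ?V - W}))"
        by (rule finite_comp_copies) simp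
      ultimately show ?thesis by simp
    qed
    \<comment> \<open>Removing any of the components lowers the count by one, so either all of them
      meet the condition or none does.\<close>
    then have "?X = (if card (comp_copies C ?H) = Suc j then comp_copies C ?H else {})" by auto
    moreover have "card (?g ` ?X) = card ?X" by (rule card_image) (auto simp: inj_on_def)
    ultimately show "real (Suc j) * of_bool (card (comp_copies C ?H) = Suc j) =
        real (card {H \<in> copies d C ?V. Q H E})" unfolding eq by simp
  qed
  also have "\<dots> = (\<Sum>H\<in>copies d C ?V. Pr (dsets d ?V) p (Q H))" by (rule Expect_card[OF fin])
  also have "\<dots> = (\<Sum>H\<in>copies d C ?V.
      p ^ k * (1 - p) ^ ((n choose d) - ((n - v) choose d) - k) * prob_copies d C (n - v) p j)"
  proof (rule sum.cong[OF refl])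
    fix H assume "H \<in> copies d C ?V"
    moreover obtain W F where HWF: "H = (W, F)" by (cases H)
    ultimately have H: "H = (W, F)" "W \<subseteq> ?V" "F \<subseteq> dsets d W" "(W, F) \<in> C"
      using copies_in_class[of W F d C ?V] by simp_all
    have c: "card W = v" "card F = k" using C(2)[OF H(4)] by auto
    have "finite W" using H(2) finite_subset by blast
    then have c': "card (?V - W) = n - v" using H(2) c by (simp add: card_Diff_subset)
    have "Pr (dsets d ?V) p (Q H) = p ^ card F * (1 - p) ^ ((card ?V choose d) - ((card ?V - card W) choose d) - card F) *
        Pr (dsets d (?V - W)) p (\<lambda>E. card (comp_copies C (?V - W, E)) = j)"
      unfolding H(1) Q_def case_prod_conv by (rule Pr_copy) (use H d in auto)
    also have "Pr (dsets d (?V - W)) p (\<lambda>E. card (comp_copies C (?V - W, E)) = j) = prob_copies d C (n - v) p j"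
      using Pr_copies[OF _ C(1), of "?V - W" d p j] c' by simp
    finally show "Pr (dsets d ?V) p (Q H) =
      p ^ k * (1 - p) ^ ((n choose d) - ((n - v) choose d) - k) * prob_copies d C (n - v) p j"
      using c by simp
  qed
  also have "\<dots> = real (card (copies d C ?V)) *
      (p ^ k * (1 - p) ^ ((n choose d) - ((n - v) choose d) - k) * prob_copies d C (n - v) p j)" by simp
  also have "card (copies d C ?V) = (n choose v) * labelings d C v"
    using card_copies[OF _ C(1), of ?V v d] C(2) by simp
  finally show ?thesis by (simp add: copy_weight_def)
qed

section \<open>Small dense vertex sets\<close>

text \<open>Union bound over vertex sets of size \<open>v \<le> M\<close> and edge sets
  \<open>F\<close> on them. There are at most n^v vertex sets, while (d - 1) |F| > v makes p^|F| of
  order at most n^-(v + 1); so each \<open>v\<close> contributes a constant over \<open>n\<close>.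
  At most 2^M edges fit, hence at most 2^(2^M) edge sets.\<close>

lemma prob_small_dense:
  assumes d: "d \<ge> 1" and c: "0 < c" and n: "n \<ge> 1" and p: "p = c / real n ^ (d - 1)" "p \<le> 1"
  shows "Pr (dsets d {1..n}) p (\<lambda>E. \<exists>W. W \<subseteq> {1..n} \<and> card W \<le> M \<and> card W < (d - 1) * card {e \<in> E. e \<subseteq> W}) \<le>
    real (Suc M) * (2 ^ (2 ^ M) * max 1 c ^ (2 ^ M)) / real n"
proof -
  let ?V = "{1..n}"
  let ?D = "dsets d ?V"
  let ?B = "2 ^ (2 ^ M) * max 1 c ^ (2 ^ M)"
  have p0: "0 \<le> p" using c p by simp
  define I where "I v = (SIGMA W:dsets v ?V. {F. F \<subseteq> dsets d W \<and> v < (d - 1) * card F})" for v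
  have finW: "finite W" if "W \<in> dsets v ?V" for v W using that finite_subset by (auto simp: dsets_def)
  have cardD: "card (dsets d W) \<le> 2 ^ v" if "W \<in> dsets v ?V" for v W
  proof -
    have "card (dsets d W) \<le> card (Pow W)" using finW[OF that] by (intro card_mono) (auto simp: dsets_def)
    then show ?thesis using finW[OF that] that by (simp add: card_Pow dsets_def)
  qed
  have finF: "finite {F. F \<subseteq> dsets d W \<and> v < (d - 1) * card F}" if "W \<in> dsets v ?V" for v W
  proof -
    have "finite (Pow (dsets d W))" using finW[OF that] by simp
    then show ?thesis by (rule rev_finite_subset) blast
  qed
  have finI: "finite (I v)" for v unfolding I_def using finF by (intro finite_SigmaI) auto
  have I1: "p ^ card F \<le> max 1 c ^ (2 ^ M) / real n ^ Suc v" if "(W, F) \<in> I v" "v \<le> M" for v W F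
  proof -
    have WF: "W \<in> dsets v ?V" "F \<subseteq> dsets d W" "v < (d - 1) * card F" using that(1) by (auto simp: I_def)
    have "card F \<le> 2 ^ v"
      using cardD[OF WF(1)] card_mono[OF finite_dsets[OF finW[OF WF(1)]] WF(2)] by linarith
    also have "\<dots> \<le> 2 ^ M" using that(2) by simp
    finally have cF: "card F \<le> 2 ^ M" .
    \<comment> \<open>With base \<open>max 1 c\<close> the exponent may be raised to its upper bound
      also when \<open>c < 1\<close>.\<close>
    have "c ^ card F \<le> max 1 c ^ card F" using c by (intro power_mono) auto
    also have "\<dots> \<le> max 1 c ^ (2 ^ M)" using cF by (intro power_increasing) auto
    finally have 1: "c ^ card F \<le> max 1 c ^ (2 ^ M)" .
    have 2: "real n ^ Suc v \<le> real n ^ ((d - 1) * card F)" using n WF(3) by (intro power_increasing) auto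
    have "p ^ card F = c ^ card F / real n ^ ((d - 1) * card F)"
      unfolding p(1) by (simp add: power_divide power_mult)
    also have "\<dots> \<le> max 1 c ^ (2 ^ M) / real n ^ Suc v"
      using 1 2 n by (intro frac_le) auto
    finally show ?thesis .
  qed
  have I2: "real (card (I v)) \<le> real n ^ v * 2 ^ (2 ^ M)" if "v \<le> M" for v
  proof -
    have "card (I v) = (\<Sum>W\<in>dsets v ?V. card {F. F \<subseteq> dsets d W \<and> v < (d - 1) * card F})"
      unfolding I_def using finF by (intro card_SigmaI) auto
    also have "\<dots> \<le> (\<Sum>W\<in>dsets v ?V. 2 ^ (2 ^ M))"
    proof (rule sum_mono)
      fix W assume W: "W \<in> dsets v ?V"
      have "card {F. F \<subseteq> dsets d W \<and> v < (d - 1) * card F} \<le> card (Pow (dsets d W))"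
        using finW[OF W] by (intro card_mono) auto
      also have "\<dots> = 2 ^ card (dsets d W)" using finW[OF W] by (simp add: card_Pow)
      also have "\<dots> \<le> 2 ^ (2 ^ M)"
      proof (rule power_increasing)
        have "(2::nat) ^ v \<le> 2 ^ M" using that by simp
        then show "card (dsets d W) \<le> 2 ^ M" using cardD[OF W] by linarith
      qed simp
      finally show "card {F. F \<subseteq> dsets d W \<and> v < (d - 1) * card F} \<le> 2 ^ (2 ^ M)" .
    qed
    also have "\<dots> = (n choose v) * 2 ^ (2 ^ M)" by (simp add: card_dsets)
    also have "\<dots> \<le> n ^ v * 2 ^ (2 ^ M)"
    proof (rule mult_right_mono)
      have "(n choose v) * 1 \<le> (n choose v) * fact v" by (intro mult_left_mono) (auto simp: Suc_le_eq)
      also have "\<dots> \<le> n ^ v" by (rule binomial_fact_pow)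
      finally show "(n choose v) \<le> n ^ v" by simp
    qed simp
    finally have "real (card (I v)) \<le> real (n ^ v * 2 ^ (2 ^ M))" by (rule of_nat_mono)
    then show ?thesis by simp
  qed
  have "Pr ?D p (\<lambda>E. \<exists>W. W \<subseteq> ?V \<and> card W \<le> M \<and> card W < (d - 1) * card {e \<in> E. e \<subseteq> W}) \<le>
      Pr ?D p (\<lambda>E. \<exists>v\<in>{..M}. \<exists>WF\<in>I v. snd WF \<subseteq> E)"
  proof (rule Pr_mono[OF p0 p(2)])
    fix E assume E: "E \<subseteq> ?D"
      and "\<exists>W. W \<subseteq> ?V \<and> card W \<le> M \<and> card W < (d - 1) * card {e \<in> E. e \<subseteq> W}"
    then obtain W where W: "W \<subseteq> ?V" "card W \<le> M" "card W < (d - 1) * card {e \<in> E. e \<subseteq> W}" by blast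
    then have "(W, {e \<in> E. e \<subseteq> W}) \<in> I (card W)" using E by (auto simp: I_def dsets_def)
    then show "\<exists>v\<in>{..M}. \<exists>WF\<in>I v. snd WF \<subseteq> E" using W(2) by force
  qed
  also have "\<dots> \<le> (\<Sum>v\<le>M. Pr ?D p (\<lambda>E. \<exists>WF\<in>I v. snd WF \<subseteq> E))" by (rule Pr_Bex[OF p0 p(2)]) simp
  also have "\<dots> \<le> (\<Sum>v\<le>M. ?B / real n)"
  proof (rule sum_mono)
    fix v assume "v \<in> {..M}"
    then have v: "v \<le> M" by simp
    have "Pr ?D p (\<lambda>E. \<exists>WF\<in>I v. snd WF \<subseteq> E) \<le> (\<Sum>WF\<in>I v. Pr ?D p (\<lambda>E. snd WF \<subseteq> E))"
      by (rule Pr_Bex[OF p0 p(2) finI])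
    also have "\<dots> \<le> (\<Sum>WF\<in>I v. max 1 c ^ (2 ^ M) / real n ^ Suc v)"
    proof (rule sum_mono)
      fix WF assume a: "WF \<in> I v"
      obtain W F where WF: "WF = (W, F)" by (cases WF)
      have "F \<subseteq> dsets d W" "W \<subseteq> ?V" using a WF by (auto simp: I_def dsets_def)
      then have "F \<subseteq> ?D" using dsets_mono[of W ?V d] by blast
      then have "Pr ?D p (\<lambda>E. snd WF \<subseteq> E) = p ^ card F" unfolding WF by (simp add: Pr_superset)
      then show "Pr ?D p (\<lambda>E. snd WF \<subseteq> E) \<le> max 1 c ^ (2 ^ M) / real n ^ Suc v"
        using I1[of W F v] a WF v by simp
    qed
    also have "\<dots> = real (card (I v)) * (max 1 c ^ (2 ^ M) / real n ^ Suc v)" by simp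
    also have "\<dots> \<le> real n ^ v * 2 ^ (2 ^ M) * (max 1 c ^ (2 ^ M) / real n ^ Suc v)"
      by (intro mult_right_mono I2 v) auto
    also have "\<dots> = ?B / real n" using n by (simp add: field_simps)
    finally show "Pr ?D p (\<lambda>E. \<exists>WF\<in>I v. snd WF \<subseteq> E) \<le> ?B / real n" .
  qed
  also have "\<dots> = real (Suc M) * ?B / real n" by simp
  finally show ?thesis .
qed

section \<open>Asymptotics of the weights\<close>

lemma choose_ratio_limit:
  assumes "(\<lambda>n. real (s n) / real n) \<longlonglongrightarrow> 1"
  shows "(\<lambda>n. real (s n choose b) / real n ^ b) \<longlonglongrightarrow> 1 / fact b"
proof -
  have "(\<lambda>n. (real (s n) - real i) / real n) \<longlonglongrightarrow> 1 - 0" for i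
    unfolding diff_divide_distrib by (intro tendsto_diff assms lim_const_over_n)
  then have "(\<lambda>n. (\<Prod>i=0..<b. (real (s n) - real i) / real n) / fact b) \<longlonglongrightarrow> (\<Prod>i=0..<b. 1 - 0) / fact b"
    by (intro tendsto_divide tendsto_prod tendsto_const) auto
  moreover have "real (s n choose b) / real n ^ b = (\<Prod>i=0..<b. (real (s n) - real i) / real n) / fact b" for n
    unfolding binomial_gbinomial gbinomial_prod_rev by (simp add: prod_dividef)
  ultimately show ?thesis by simp
qed

lemma shift_ratio_limit: "(\<lambda>n. real (n + a) / real n) \<longlonglongrightarrow> 1" "(\<lambda>n. real (n - a) / real n) \<longlonglongrightarrow> 1"
proof -
  have "(\<lambda>n. 1 + real a / real n) \<longlonglongrightarrow> 1 + 0" by (intro tendsto_add tendsto_const lim_const_over_n)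
  moreover have "\<forall>\<^sub>F n in sequentially. real (n + a) / real n = 1 + real a / real n"
    using eventually_gt_at_top[of 0] by eventually_elim (simp add: field_simps)
  ultimately show "(\<lambda>n. real (n + a) / real n) \<longlonglongrightarrow> 1" by (simp add: tendsto_cong)
  have "(\<lambda>n. 1 - real a / real n) \<longlonglongrightarrow> 1 - 0" by (intro tendsto_diff tendsto_const lim_const_over_n)
  moreover have "\<forall>\<^sub>F n in sequentially. real (n - a) / real n = 1 - real a / real n"
    using eventually_gt_at_top[of a] by eventually_elim (simp add: field_simps of_nat_diff)
  ultimately show "(\<lambda>n. real (n - a) / real n) \<longlonglongrightarrow> 1" by (simp add: tendsto_cong)
qed

text \<open>Squeeze ln (1 - p) between -p - 2 p^2 and -p. The quadratic term contributes a multiple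
  of (m p) p, which vanishes.\<close>

lemma one_minus_power_limit:
  fixes p :: "nat \<Rightarrow> real" and m :: "nat \<Rightarrow> nat"
  assumes p: "p \<longlonglongrightarrow> 0" "\<forall>\<^sub>F n in sequentially. 0 \<le> p n" and mp: "(\<lambda>n. real (m n) * p n) \<longlonglongrightarrow> t"
  shows "(\<lambda>n. (1 - p n) ^ m n) \<longlonglongrightarrow> exp (- t)"
proof -
  have half: "\<forall>\<^sub>F n in sequentially. p n < 1 / 2" using order_tendstoD(2)[OF p(1), of "1/2"] by simp
  have "(\<lambda>n. real (m n) * ln (1 - p n)) \<longlonglongrightarrow> - t"
  proof (rule tendsto_sandwich)
    have "(\<lambda>n. - (real (m n) * p n) - 2 * (real (m n) * p n) * p n) \<longlonglongrightarrow> - t - 2 * t * 0"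
      by (intro tendsto_intros p mp)
    then show "(\<lambda>n. - (real (m n) * p n) - 2 * (real (m n) * p n) * p n) \<longlonglongrightarrow> - t" by simp
    show "(\<lambda>n. - (real (m n) * p n)) \<longlonglongrightarrow> - t" by (intro tendsto_minus mp)
    show "\<forall>\<^sub>F n in sequentially. - (real (m n) * p n) - 2 * (real (m n) * p n) * p n \<le> real (m n) * ln (1 - p n)"
      using p(2) half
    proof eventually_elim
      case (elim n)
      have "- p n - 2 * (p n)\<^sup>2 \<le> ln (1 - p n)" using elim by (intro ln_one_minus_pos_lower_bound) auto
      then have "real (m n) * (- p n - 2 * (p n)\<^sup>2) \<le> real (m n) * ln (1 - p n)" by (rule mult_left_mono) simp
      then show ?case by (simp add: algebra_simps power2_eq_square)
    qed
    show "\<forall>\<^sub>F n in sequentially. real (m n) * ln (1 - p n) \<le> - (real (m n) * p n)"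
      using p(2) half
    proof eventually_elim
      case (elim n)
      have "ln (1 - p n) \<le> - p n" using elim ln_le_minus_one[of "1 - p n"] by simp
      then have "real (m n) * ln (1 - p n) \<le> real (m n) * (- p n)" by (rule mult_left_mono) simp
      then show ?case by simp
    qed
  qed
  then have "(\<lambda>n. exp (real (m n) * ln (1 - p n))) \<longlonglongrightarrow> exp (- t)" by (rule tendsto_exp)
  moreover have "\<forall>\<^sub>F n in sequentially. (1 - p n) ^ m n = exp (real (m n) * ln (1 - p n))"
    using half by eventually_elim (simp add: exp_of_nat_mult)
  ultimately show ?thesis by (simp add: tendsto_cong)
qed

text \<open>Pascal's rule, iterated. It writes the number of \<open>d\<close>-sets meeting
  \<open>v\<close> added vertices as a sum of binomials of order \<open>d - 1\<close>, the power of
  \<open>n\<close> that balances \<open>p\<close>.\<close>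

lemma choose_add_eq_sum:
  assumes "d \<ge> 1"
  shows "(m + v) choose d = (m choose d) + (\<Sum>i<v. (m + i) choose (d - 1))"
proof (induction v)
  case (Suc v)
  obtain d' where "d = Suc d'" using assms by (cases d) auto
  then show ?case using Suc by simp
qed simp

lemma edge_prob_limit: "d \<ge> 2 \<Longrightarrow> (\<lambda>n. c / real n ^ (d - 1)) \<longlonglongrightarrow> 0"
proof -
  assume "d \<ge> 2"
  then have "(\<lambda>n. inverse (real n) ^ (d - 1)) \<longlonglongrightarrow> 0 ^ (d - 1)"
    by (intro tendsto_power lim_inverse_n)
  then have "(\<lambda>n. c * inverse (real n) ^ (d - 1)) \<longlonglongrightarrow> c * 0"
    using \<open>d \<ge> 2\<close> by (intro tendsto_mult tendsto_const) (simp add: power_0_left)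
  then show ?thesis by (simp add: divide_inverse power_inverse)
qed

text \<open>The remaining number of vertices \<open>s n\<close> is kept general for two uses:
  \<open>n - v\<close> when a fragment is removed from \<open>n\<close> vertices, and
  \<open>n\<close> when a tree is removed from \<open>n + v\<close>. Subtracting \<open>k\<close> is
  harmless because \<open>p\<close> tends to 0.\<close>

lemma missing_edges_limit:
  assumes d: "d \<ge> 2" and c: "0 \<le> c" and s: "\<And>i. (\<lambda>n. real (s n + i) / real n) \<longlonglongrightarrow> 1"
  shows "(\<lambda>n. real ((s n + v choose d) - (s n choose d) - k) * (c / real n ^ (d - 1))) \<longlonglongrightarrow>
    real v * (c / fact (d - 1))"
proof -
  let ?p = "\<lambda>n. c / real n ^ (d - 1)"
  let ?S = "\<lambda>n. \<Sum>i<v. (s n + i) choose (d - 1)"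
  have eq: "(s n + v choose d) - (s n choose d) = ?S n" for n
    using choose_add_eq_sum[of d "s n" v] d by simp
  have "(\<lambda>n. \<Sum>i<v. c * (real ((s n + i) choose (d - 1)) / real n ^ (d - 1))) \<longlonglongrightarrow> (\<Sum>i<v. c * (1 / fact (d - 1)))"
    by (intro tendsto_sum tendsto_mult tendsto_const choose_ratio_limit s)
  moreover have "real (?S n) * ?p n = (\<Sum>i<v. c * (real ((s n + i) choose (d - 1)) / real n ^ (d - 1)))" for n
    unfolding of_nat_sum sum_distrib_right by (rule sum.cong) simp_all
  ultimately have S: "(\<lambda>n. real (?S n) * ?p n) \<longlonglongrightarrow> real v * (c / fact (d - 1))" by simp
  show ?thesis unfolding eq
  proof (rule tendsto_sandwich)
    have "(\<lambda>n. real (?S n) * ?p n - real k * ?p n) \<longlonglongrightarrow> real v * (c / fact (d - 1)) - real k * 0"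
      by (intro tendsto_diff tendsto_mult tendsto_const S edge_prob_limit d)
    then show "(\<lambda>n. real (?S n) * ?p n - real k * ?p n) \<longlonglongrightarrow> real v * (c / fact (d - 1))" by simp
    show "(\<lambda>n. real (?S n) * ?p n) \<longlonglongrightarrow> real v * (c / fact (d - 1))" by (rule S)
    have "real (?S n) * ?p n - real k * ?p n \<le> real (?S n - k) * ?p n" for n
    proof -
      have "(real (?S n) - real k) * ?p n \<le> real (?S n - k) * ?p n"
        using c by (intro mult_right_mono) (linarith, simp)
      then show ?thesis by (simp only: left_diff_distrib)
    qed
    then show "\<forall>\<^sub>F n in sequentially. real (?S n) * ?p n - real k * ?p n \<le> real (?S n - k) * ?p n" by simp
    have "real (?S n - k) * ?p n \<le> real (?S n) * ?p n" for n
      using c by (intro mult_right_mono of_nat_mono diff_le_self) simp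
    then show "\<forall>\<^sub>F n in sequentially. real (?S n - k) * ?p n \<le> real (?S n) * ?p n" by simp
  qed
qed

text \<open>Excess zero: the n^v choices of vertices exactly cancel the denominator of p^k.\<close>

lemma copy_weight_limit:
  assumes d: "d \<ge> 2" and c: "0 < c" and v: "v = (d - 1) * k"
  shows "(\<lambda>n. copy_weight d n v k (c / real n ^ (d - 1))) \<longlonglongrightarrow>
    c ^ k / fact v * exp (- (real v * (c / fact (d - 1))))"
proof -
  let ?p = "\<lambda>n. c / real n ^ (d - 1)"
  let ?m = "\<lambda>n. (n - v + v choose d) - (n - v choose d) - k"
  have s: "(\<lambda>n. real (n - v + i) / real n) \<longlonglongrightarrow> 1" for i
  proof -
    have "(\<lambda>n. real (n - v) / real n + real i / real n) \<longlonglongrightarrow> 1 + 0"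
      by (intro tendsto_add shift_ratio_limit lim_const_over_n)
    then show ?thesis by (simp add: add_divide_distrib)
  qed
  have "(\<lambda>n. (1 - ?p n) ^ ?m n) \<longlonglongrightarrow> exp (- (real v * (c / fact (d - 1))))"
    using c by (intro one_minus_power_limit edge_prob_limit d missing_edges_limit s) auto
  moreover have "(\<lambda>n. real (n choose v) / real n ^ v) \<longlonglongrightarrow> 1 / fact v"
    using choose_ratio_limit[OF shift_ratio_limit(1)[of 0], of v] by simp
  ultimately have "(\<lambda>n. (real (n choose v) / real n ^ v) * c ^ k * (1 - ?p n) ^ ?m n) \<longlonglongrightarrow>
      (1 / fact v) * c ^ k * exp (- (real v * (c / fact (d - 1))))"
    by (intro tendsto_mult tendsto_const)
  moreover have "\<forall>\<^sub>F n in sequentially. (real (n choose v) / real n ^ v) * c ^ k * (1 - ?p n) ^ ?m n =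
      copy_weight d n v k (?p n)"
    using eventually_ge_at_top[of v]
  proof eventually_elim
    case (elim n)
    have "real (n choose v) * ?p n ^ k = (real (n choose v) / real n ^ v) * c ^ k"
      unfolding v by (simp add: power_divide power_mult)
    then show ?case unfolding copy_weight_def using elim by (simp add: mult.assoc[symmetric])
  qed
  ultimately show ?thesis by (simp add: tendsto_cong)
qed

text \<open>Negative excess leaves a positive power of \<open>n\<close>. The edge probability
  belongs to \<open>n\<close>, not to \<open>n + v\<close>, because in
  \<open>prob_tree_count\<close> the hypergraph of interest is the one that remains on
  \<open>n\<close> vertices.\<close>

lemma copy_weight_at_top:
  assumes d: "d \<ge> 2" and c: "0 < c" and v: "(d - 1) * k < v"
  shows "filterlim (\<lambda>n. copy_weight d (n + v) v k (c / real n ^ (d - 1))) at_top sequentially"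
proof -
  let ?p = "\<lambda>n. c / real n ^ (d - 1)"
  let ?m = "\<lambda>n. (n + v choose d) - (n choose d) - k"
  define L where "L = (1 / fact v) * c ^ k * exp (- (real v * (c / fact (d - 1))))"
  have "(\<lambda>n. (1 - ?p n) ^ ?m n) \<longlonglongrightarrow> exp (- (real v * (c / fact (d - 1))))"
    using c by (intro one_minus_power_limit edge_prob_limit d missing_edges_limit shift_ratio_limit) auto
  moreover have "(\<lambda>n. real (n + v choose v) / real n ^ v) \<longlonglongrightarrow> 1 / fact v"
    by (intro choose_ratio_limit shift_ratio_limit)
  ultimately have lim: "(\<lambda>n. (real (n + v choose v) / real n ^ v) * c ^ k * (1 - ?p n) ^ ?m n) \<longlonglongrightarrow> L"
    unfolding L_def by (intro tendsto_mult tendsto_const)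
  have "0 < L" using c by (simp add: L_def)
  have "filterlim (\<lambda>n. real n ^ (v - (d - 1) * k)) at_top sequentially"
    using v by (intro filterlim_pow_at_top filterlim_real_sequentially) auto
  then have "filterlim (\<lambda>n. (real (n + v choose v) / real n ^ v) * c ^ k * (1 - ?p n) ^ ?m n * real n ^ (v - (d - 1) * k)) at_top sequentially"
    by (rule filterlim_tendsto_pos_mult_at_top[OF lim \<open>0 < L\<close>])
  moreover have ev: "\<forall>\<^sub>F n in sequentially.
      (real (n + v choose v) / real n ^ v) * c ^ k * (1 - ?p n) ^ ?m n * real n ^ (v - (d - 1) * k) =
      copy_weight d (n + v) v k (?p n)"
    using eventually_gt_at_top[of 0]
  proof eventually_elim
    case (elim n)
    have "?p n ^ k = c ^ k / real n ^ ((d - 1) * k)" by (simp add: power_divide power_mult)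
    moreover have "real n ^ v = real n ^ (v - (d - 1) * k) * real n ^ ((d - 1) * k)"
      using v by (simp add: power_add[symmetric])
    ultimately have e: "c ^ k / real n ^ v * real n ^ (v - (d - 1) * k) = ?p n ^ k" using elim by simp
    have "X / N * c ^ k * B * R = X * (c ^ k / N * R * B)" for X N B R :: real
      by (simp add: divide_inverse mult_ac)
    then show ?case unfolding copy_weight_def by (simp only: e add_diff_cancel_right')
  qed
  ultimately show ?thesis using filterlim_cong[OF refl refl ev] by (simp only:)
qed

section \<open>Finitely many classes of bounded size\<close>

text \<open>Excess is additive over components and vanishes on each of them.\<close>

lemma all_uni_card:
  assumes H: "all_uni d H" and d: "d \<ge> 1"
  shows "card (verts H) = (d - 1) * card (edges H)"
proof -
  have u: "uniform_hypergraph d H" using H by (simp add: all_uni_def)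
  note wf = uniform_wf[OF u] and ne = uniform_edges_ne[OF u d]
  let ?P = "verts H // linked H"
  let ?E = "\<lambda>W. {e \<in> edges H. e \<subseteq> W}"
  have fV: "finite (verts H)" using u by (simp add: uniform_hypergraph_def)
  have fE: "finite (edges H)" using wf fV by (meson Pow_iff finite_Pow_iff finite_subset subsetI)
  have UP: "\<Union>?P = verts H" by (rule Union_quotient[OF equiv_linked])
  have fP: "finite ?P" using fV UP by (metis finite_UnionD)
  have dj: "W \<inter> U = {}" if "W \<in> ?P" "U \<in> ?P" "W \<noteq> U" for W U
    using quotient_disj[OF equiv_linked that(1,2)] that(3) by blast
  have cl: "closed_in H W" if W: "W \<in> ?P" for W
    using W closed_in_link_class[OF wf] by (auto simp: quotient_def)
  have W: "card W = (d - 1) * card (?E W)" if W: "W \<in> ?P" for W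
  proof -
    have "(W, ?E W) \<in> components_of H" unfolding components_of_def using W by blast
    then have "excess d (W, ?E W) = 0" using H by (simp add: all_uni_def unicycle_def)
    then have "int (card W) = int ((d - 1) * card (?E W))" using d by (simp add: excess_def of_nat_diff)
    then show ?thesis by (simp only: of_nat_eq_iff)
  qed
  have "card (\<Union>?P) = (\<Sum>W\<in>?P. card W)"
  proof (rule card_Union_disjoint)
    show "pairwise disjnt ?P" using dj by (simp add: pairwise_def disjnt_def)
    show "finite W" if "W \<in> ?P" for W
      by (rule finite_subset[OF _ fV]) (use cl[OF that] in \<open>simp add: closed_in_def\<close>)
  qed
  also have "\<dots> = (\<Sum>W\<in>?P. (d - 1) * card (?E W))" by (rule sum.cong[OF refl]) (rule W)
  also have "\<dots> = (d - 1) * (\<Sum>W\<in>?P. card (?E W))" by (simp add: sum_distrib_left)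
  also have "(\<Sum>W\<in>?P. card (?E W)) = card (\<Union>W\<in>?P. ?E W)"
  proof (rule card_UN_disjoint[symmetric, OF fP])
    show "\<forall>W\<in>?P. finite (?E W)" using fE by simp
    show "\<forall>W\<in>?P. \<forall>U\<in>?P. W \<noteq> U \<longrightarrow> ?E W \<inter> ?E U = {}"
    proof (intro ballI impI equals0I)
      fix W U e assume h: "W \<in> ?P" "U \<in> ?P" "W \<noteq> U" "e \<in> ?E W \<inter> ?E U"
      then have "e \<subseteq> W \<inter> U" "e \<noteq> {}" using ne by simp_all
      then show False using dj[OF h(1-3)] by simp
    qed
  qed
  also have "(\<Union>W\<in>?P. ?E W) = edges H"
  proof (intro equalityI subsetI)
    fix e assume e: "e \<in> edges H"
    then have "e \<noteq> {}" "e \<subseteq> \<Union>?P" using ne wf UP by auto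
    then obtain W where W: "W \<in> ?P" "e \<inter> W \<noteq> {}" by blast
    then have "e \<subseteq> W" using cl[OF W(1)] e by (simp add: closed_in_def)
    then show "e \<in> (\<Union>W\<in>?P. ?E W)" using W(1) e by blast
  qed blast
  finally show ?thesis unfolding UP .
qed

definition small_classes :: "nat \<Rightarrow> nat \<Rightarrow> nat hypergraph set set" where
  "small_classes d M = {C \<in> unicyclic_family d. \<exists>H\<in>C. card (verts H) \<le> M}"

lemma family_iso: "C \<in> unicyclic_family d \<Longrightarrow> H \<in> C \<Longrightarrow> H \<simeq>\<^sub>H K \<Longrightarrow> K \<in> C"
  by (subst family_class_eq[of C d H]) simp_all

lemma family_iso_closed: "C \<in> unicyclic_family d \<Longrightarrow> iso_closed C"
  unfolding iso_closed_def by (intro allI impI) (erule family_iso, assumption, auto simp only: iso_hypergraph_iff)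

lemma family_card:
  assumes "C \<in> unicyclic_family d" "H \<in> C" "K \<in> C"
  shows "card (verts K) = card (verts H)" "card (edges K) = card (edges H)"
proof -
  have "H \<simeq>\<^sub>H K" using assms(3) unfolding family_class_eq[OF assms(1,2)] by simp
  then obtain f where f: "iso_via f H K" by (auto simp only: iso_hypergraph_iff)
  show "card (verts K) = card (verts H)" by (rule iso_via_card_verts[OF f])
  show "card (edges K) = card (edges H)"
    by (rule iso_via_card_edges[OF all_uni_wf[OF family_all_uni[OF assms(1,2)]] f])
qed

lemma iso_to_interval:
  fixes H :: "'a hypergraph"
  assumes "finite (verts H)"
  obtains f :: "'a \<Rightarrow> nat" and F where "iso_via f H ({1..card (verts H)}, F)"
proof -
  obtain f :: "'a \<Rightarrow> nat" where f: "bij_betw f (verts H) {1..card (verts H)}"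
    using finite_same_card_bij[of "verts H" "{1..card (verts H)}"] assms by auto
  then show ?thesis using that[of f "(`) f ` edges H"] by (simp add: iso_via_def)
qed

lemma finite_small_classes: "finite (small_classes d M)"
proof (rule finite_subset)
  let ?X = "\<Union>v\<le>M. Pair {1..v} ` Pow (Pow {1..v}) :: nat hypergraph set"
  show "finite ((\<lambda>H. {K :: nat hypergraph. H \<simeq>\<^sub>H K}) ` ?X)" by simp
  show "small_classes d M \<subseteq> (\<lambda>H. {K. H \<simeq>\<^sub>H K}) ` ?X"
  proof
    fix C assume "C \<in> small_classes d M"
    then obtain H where C: "C \<in> unicyclic_family d" and H: "H \<in> C" "card (verts H) \<le> M"
      by (auto simp: small_classes_def)
    have au: "all_uni d H" by (rule family_all_uni[OF C H(1)])
    then have "finite (verts H)" by (simp add: all_uni_def uniform_hypergraph_def)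
    then obtain f F where f: "iso_via f H ({1..card (verts H)}, F)" by (rule iso_to_interval)
    let ?K = "({1..card (verts H)}, F)"
    have "H \<simeq>\<^sub>H ?K" unfolding iso_hypergraph_iff by (rule exI[of _ f]) (rule f)
    then have K: "?K \<in> C" by (rule family_iso[OF C H(1)])
    have "wf_hypergraph ?K" by (rule all_uni_wf[OF family_all_uni[OF C K]])
    then have "F \<in> Pow (Pow {1..card (verts H)})" by (simp add: subset_iff)
    then have "?K \<in> ?X" using H(2) by (intro UN_I[of "card (verts H)"] imageI) auto
    then show "C \<in> (\<lambda>H. {K. H \<simeq>\<^sub>H K}) ` ?X" by (rule rev_image_eqI) (rule family_class_eq[OF C K])
  qed
qed

lemma labelings_pos:
  fixes C :: "nat hypergraph set"
  assumes "iso_closed C" "H \<in> C" "uniform_hypergraph d H" "card (verts H) = v"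
  shows "labelings d C v > 0"
proof -
  have "finite (verts H)" using assms(3) by (simp add: uniform_hypergraph_def)
  then obtain f F where f: "iso_via f H ({1..card (verts H)}, F)" by (rule iso_to_interval)
  have "({1..v}, F) \<in> C"
    using assms(1)[unfolded iso_closed_def, rule_format, OF assms(2) _ f] uniform_wf[OF assms(3)] assms(4)
    by (simp only: prod.collapse)
  moreover have "F \<subseteq> dsets d {1..v}"
    using iso_via_uniform[OF assms(3) f] assms(4) by (auto simp: uniform_hypergraph_def dsets_def)
  ultimately have "F \<in> {F. F \<subseteq> dsets d {1..v} \<and> ({1..v}, F) \<in> C}" by simp
  moreover have "finite {F. F \<subseteq> dsets d {1..v} \<and> ({1..v}, F) \<in> C}"
    by (rule finite_subset[of _ "Pow (dsets d {1..v})"]) auto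
  ultimately show ?thesis unfolding labelings_def card_gt_0_iff by blast
qed

section \<open>The limit law of the fragment\<close>

locale subcritical =
  fixes d :: nat and c :: real
  assumes d3: "d \<ge> 3" and c_pos: "0 < c" and c_less: "c < fact (d - 2)"
begin

definition edge_prob :: "nat \<Rightarrow> real" where
  "edge_prob n = c / real n ^ (d - 1)"

text \<open>Bounds the mean number of one-step extensions of a walk, for every \<open>n\<close>
  alike (\<open>edge_prob_branching\<close>); the hypothesis on \<open>c\<close> says that it is
  below 1.\<close>

definition branching :: real where
  "branching = c / fact (d - 2)"

text \<open>By \<open>expected_cyclic\<close>, a bound on the expected number of cyclic vertices
  that does not depend on \<open>n\<close>.\<close>

definition size_bound :: real where
  "size_bound = cyclic_bound d branching"

definition prob_of :: "nat \<Rightarrow> (nat hypergraph \<Rightarrow> bool) \<Rightarrow> real" where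
  "prob_of n Q = Pr (dsets d {1..n}) (edge_prob n) (\<lambda>E. Q ({1..n}, E))"

lemma d1: "d \<ge> 1" and d2: "d \<ge> 2" using d3 by auto

lemma branching_bounds: "0 \<le> branching" "branching < 1"
  using c_pos c_less by (auto simp: branching_def)

lemma edge_prob_nonneg: "0 \<le> edge_prob n"
  using c_pos by (simp add: edge_prob_def)

lemma edge_prob_le_1: "\<forall>\<^sub>F n in sequentially. n \<ge> 1 \<and> edge_prob n \<le> 1"
proof -
  have "edge_prob \<longlonglongrightarrow> 0" unfolding edge_prob_def by (rule edge_prob_limit[OF d2])
  then have "\<forall>\<^sub>F n in sequentially. edge_prob n < 1" by (rule order_tendstoD) simp
  then show ?thesis using eventually_ge_at_top[of 1] by eventually_elim simp
qed

lemma prob_G: "edge_prob n \<le> 1 \<Longrightarrow> measure_pmf.prob (G d c n) {H. Q H} = prob_of n Q"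
  unfolding G_def prob_of_def edge_prob_def[symmetric]
  by (rule prob_random_hypergraph[OF edge_prob_nonneg])

lemma edge_prob_branching:
  "n \<ge> 1 \<Longrightarrow> edge_prob n * (real n * (real n ^ (d - 2) / fact (d - 2))) = branching"
proof -
  assume n: "n \<ge> 1"
  have "d - 1 = Suc (d - 2)" using d3 by simp
  then have "real n * real n ^ (d - 2) = real n ^ (d - 1)" by simp
  then show ?thesis using n unfolding edge_prob_def branching_def by simp
qed

lemma expected_cyclic:
  "n \<ge> 1 \<Longrightarrow> edge_prob n \<le> 1 \<Longrightarrow>
    Expect (dsets d {1..n}) (edge_prob n) (\<lambda>E. real (card (cyclic_verts E))) \<le> size_bound"
  unfolding size_bound_def
  by (rule expected_cyclic_verts) (use edge_prob_branching[of n] edge_prob_nonneg branching_bounds in auto)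

lemma prob_of_mono:
  assumes "edge_prob n \<le> 1" "\<And>E. E \<subseteq> dsets d {1..n} \<Longrightarrow> Q ({1..n}, E) \<Longrightarrow> R ({1..n}, E)"
  shows "prob_of n Q \<le> prob_of n R"
  unfolding prob_of_def by (rule Pr_mono[OF edge_prob_nonneg assms(1)]) (rule assms(2))

lemma prob_of_nonneg: "edge_prob n \<le> 1 \<Longrightarrow> 0 \<le> prob_of n Q"
  unfolding prob_of_def by (rule Pr_nonneg[OF edge_prob_nonneg])

lemma prob_of_le_1: "edge_prob n \<le> 1 \<Longrightarrow> prob_of n Q \<le> 1"
  unfolding prob_of_def by (rule Pr_le_1[OF _ edge_prob_nonneg]) simp_all

lemma prob_of_abs_diff:
  assumes "edge_prob n \<le> 1"
    "\<And>E. E \<subseteq> dsets d {1..n} \<Longrightarrow> \<not> B ({1..n}, E) \<Longrightarrow> Q ({1..n}, E) \<longleftrightarrow> R ({1..n}, E)"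
  shows "\<bar>prob_of n Q - prob_of n R\<bar> \<le> prob_of n B"
  unfolding prob_of_def by (rule Pr_abs_diff[OF edge_prob_nonneg assms(1)]) (rule assms(2))

lemma prob_cyclic_tail:
  assumes n: "n \<ge> 1" "edge_prob n \<le> 1"
  shows "prob_of n (\<lambda>H. card (cyclic_verts (edges H)) > M) \<le> size_bound / real (Suc M)"
proof -
  have "prob_of n (\<lambda>H. card (cyclic_verts (edges H)) > M) =
      Pr (dsets d {1..n}) (edge_prob n) (\<lambda>E. real (card (cyclic_verts E)) \<ge> real (Suc M))"
    unfolding prob_of_def by (rule Pr_cong) (simp only: snd_conv of_nat_le_iff Suc_le_eq)
  also have "\<dots> \<le> Expect (dsets d {1..n}) (edge_prob n) (\<lambda>E. real (card (cyclic_verts E))) / real (Suc M)"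
    by (rule Pr_markov[OF edge_prob_nonneg n(2)]) simp_all
  also have "\<dots> \<le> size_bound / real (Suc M)" using expected_cyclic[OF n] by (intro divide_right_mono) auto
  finally show ?thesis .
qed

lemma prob_Frag_tail:
  assumes n: "n \<ge> 1" "edge_prob n \<le> 1"
  shows "prob_of n (\<lambda>H. card (verts (Frag d H)) > M) \<le> size_bound / real (Suc M)"
proof -
  have "prob_of n (\<lambda>H. card (verts (Frag d H)) > M) \<le> prob_of n (\<lambda>H. card (cyclic_verts (edges H)) > M)"
  proof (rule prob_of_mono[OF n(2)])
    fix E assume E: "E \<subseteq> dsets d {1..n}" and M: "card (verts (Frag d ({1..n}, E))) > M"
    have u: "uniform_hypergraph d ({1..n}, E)" by (rule uniform_dsets[OF _ E]) simp
    have "card (frag_verts d ({1..n}, E)) \<le> card (cyclic_verts E)"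
      using frag_verts_cyclic[OF u d1] finite_subset[OF cyclic_verts_subset[OF E]] by (intro card_mono) auto
    then show "card (cyclic_verts (edges ({1..n}, E))) > M"
      using M Frag_eq[OF u d1] by simp
  qed
  then show ?thesis using prob_cyclic_tail[OF n, of M] by linarith
qed

lemma prob_complex_component: "(\<lambda>n. prob_of n (complex_component d)) \<longlonglongrightarrow> 0"
proof (rule LIMSEQ_I)
  fix e :: real assume e: "0 < e"
  obtain M :: nat where M: "size_bound / (e / 2) < real M" using reals_Archimedean2 by blast
  have M1: "size_bound / real (Suc M) < e / 2"
  proof -
    have "size_bound < real M * (e / 2)" using M e by (simp add: field_simps)
    also have "\<dots> \<le> real (Suc M) * (e / 2)" using e by (intro mult_right_mono) auto
    finally show ?thesis by (simp add: field_simps)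
  qed
  let ?A = "real (Suc M) * (2 ^ (2 ^ M) * max 1 c ^ (2 ^ M))"
  have "(\<lambda>n. ?A / real n) \<longlonglongrightarrow> 0" by (rule lim_const_over_n)
  then have "\<forall>\<^sub>F n in sequentially. ?A / real n < e / 2" by (rule order_tendstoD) (use e in simp)
  then have "\<forall>\<^sub>F n in sequentially. norm (prob_of n (complex_component d) - 0) < e"
    using edge_prob_le_1
  proof eventually_elim
    case (elim n)
    then have n: "n \<ge> 1" "edge_prob n \<le> 1" by auto
    let ?big = "\<lambda>H. card (cyclic_verts (edges H)) > M"
    let ?small = "\<lambda>H. \<exists>W. W \<subseteq> {1..n} \<and> card W \<le> M \<and> card W < (d - 1) * card {e \<in> edges H. e \<subseteq> W}"
    have "prob_of n (complex_component d) \<le> prob_of n (\<lambda>H. ?big H \<or> ?small H)"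
    proof (rule prob_of_mono[OF n(2)])
      fix E assume E: "E \<subseteq> dsets d {1..n}" and "complex_component d ({1..n}, E)"
      then obtain U where U: "closed_in ({1..n}, E) U" "connected_hypergraph (induced ({1..n}, E) U)"
        "excess d (induced ({1..n}, E) U) > 0" unfolding complex_component_def by blast
      have u: "uniform_hypergraph d ({1..n}, E)" by (rule uniform_dsets[OF _ E]) simp
      have "U \<subseteq> cyclic_verts E" using excess_nonneg_cyclic_verts[OF u d1 U(1,2)] U(3) by simp
      then have 1: "card U \<le> card (cyclic_verts E)"
        using finite_subset[OF cyclic_verts_subset[OF E]] by (intro card_mono) auto
      have "int (card U) < int ((d - 1) * card {e \<in> E. e \<subseteq> U})"
        using U(3) d1 by (simp add: excess_def of_nat_diff induced_pair)
      then have "card U < (d - 1) * card {e \<in> E. e \<subseteq> U}" by (simp only: of_nat_less_iff)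
      moreover have "U \<subseteq> {1..n}" using U(1) by (simp add: closed_in_def)
      ultimately have "?small ({1..n}, E)" if "card U \<le> M" using that by (intro exI[of _ U]) simp
      then show "?big ({1..n}, E) \<or> ?small ({1..n}, E)"
        using 1 by (cases "card U \<le> M") simp_all
    qed
    also have "\<dots> \<le> prob_of n ?big + prob_of n ?small"
      unfolding prob_of_def by (rule Pr_union[OF edge_prob_nonneg n(2)])
    also have "prob_of n ?small \<le> ?A / real n"
      unfolding prob_of_def snd_conv
      by (rule prob_small_dense[OF d1 c_pos n(1) _ n(2)]) (simp add: edge_prob_def)
    also have "prob_of n ?big \<le> size_bound / real (Suc M)" by (rule prob_cyclic_tail[OF n])
    finally have "prob_of n (complex_component d) < e" using elim(1) M1 by linarith
    then show ?case using prob_of_nonneg[OF n(2)] by simp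
  qed
  then show "\<exists>no. \<forall>n\<ge>no. norm (prob_of n (complex_component d) - 0) < e"
    by (simp only: eventually_sequentially)
qed

text \<open>\<open>prob_copies_Suc\<close> read from right to left: the weight times the probability
  of \<open>j\<close> copies on \<open>n\<close> vertices is \<open>Suc j\<close> times some
  probability on \<open>n + v\<close> vertices, which is bounded by 1. The weight tends to
  infinity.\<close>

lemma prob_tree_count:
  fixes T :: "nat hypergraph"
  assumes T: "is_tree d T"
  shows "(\<lambda>n. prob_of n (\<lambda>H. card (comp_copies {K. T \<simeq>\<^sub>H K} H) = j)) \<longlonglongrightarrow> 0"
proof -
  let ?C = "{K :: nat hypergraph. T \<simeq>\<^sub>H K}"
  let ?v = "card (verts T)" and ?k = "card (edges T)"
  have u: "uniform_hypergraph d T" "connected_hypergraph T" "excess d T < 0"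
    using T by (auto simp: is_tree_def)
  note wf = uniform_wf[OF u(1)]
  have ic: "iso_closed ?C"
    unfolding iso_closed_def
  proof (intro allI impI)
    fix H K :: "nat hypergraph" and f assume "H \<in> ?C" "iso_via f H K"
    then have "T \<simeq>\<^sub>H H" "H \<simeq>\<^sub>H K" unfolding iso_hypergraph_iff by blast+
    then have "T \<simeq>\<^sub>H K" by (rule iso_hypergraph_trans)
    then show "K \<in> ?C" by simp
  qed
  have C: "connected_hypergraph H \<and> card (verts H) = ?v \<and> card (edges H) = ?k" if "H \<in> ?C" for H
  proof -
    have "T \<simeq>\<^sub>H H" using that by simp
    then obtain f where f: "iso_via f T H" unfolding iso_hypergraph_iff by blast
    show ?thesis using iso_via_connected[OF f u(2)] iso_via_card_verts[OF f] iso_via_card_edges[OF wf f] by simp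
  qed
  have "int ((d - 1) * ?k) < int ?v" using u(3) d1 by (simp add: excess_def of_nat_diff)
  then have v: "(d - 1) * ?k < ?v" by (simp only: of_nat_less_iff)
  let ?a = "real (labelings d ?C ?v)"
  let ?w = "\<lambda>n. copy_weight d (n + ?v) ?v ?k (c / real n ^ (d - 1))"
  have "T \<in> ?C" by (simp add: iso_hypergraph_refl)
  then have a: "?a > 0" unfolding of_nat_0_less_iff by (rule labelings_pos[OF ic _ u(1) refl])
  have "filterlim (\<lambda>n. ?a * ?w n) at_top sequentially"
    by (rule filterlim_tendsto_pos_mult_at_top[OF tendsto_const a copy_weight_at_top[OF d2 c_pos v]])
  then have lim0: "(\<lambda>n. real (Suc j) / (?a * ?w n)) \<longlonglongrightarrow> 0"
    by (intro tendsto_divide_0[OF tendsto_const] filterlim_at_top_imp_at_infinity)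
  have pos: "\<forall>\<^sub>F n in sequentially. ?a * ?w n > 0"
    using \<open>filterlim (\<lambda>n. ?a * ?w n) at_top sequentially\<close> by (simp only: filterlim_at_top_dense)
  show ?thesis
  proof (rule tendsto_sandwich[OF _ _ tendsto_const lim0])
    show "\<forall>\<^sub>F n in sequentially. 0 \<le> prob_of n (\<lambda>H. card (comp_copies ?C H) = j)"
      using edge_prob_le_1 by eventually_elim (simp add: prob_of_nonneg)
    show "\<forall>\<^sub>F n in sequentially. prob_of n (\<lambda>H. card (comp_copies ?C H) = j) \<le> real (Suc j) / (?a * ?w n)"
      using edge_prob_le_1 pos
    proof eventually_elim
      case (elim n)
      have "?a * ?w n * prob_copies d ?C n (edge_prob n) j =
          real (Suc j) * prob_copies d ?C (n + ?v) (edge_prob n) (Suc j)"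
        using prob_copies_Suc[OF ic C d1, of j "n + ?v" "edge_prob n"] by (simp add: edge_prob_def)
      also have "\<dots> \<le> real (Suc j) * 1"
        unfolding prob_copies_def using elim edge_prob_nonneg by (intro mult_left_mono Pr_le_1) auto
      finally have "prob_copies d ?C n (edge_prob n) j \<le> real (Suc j) / (?a * ?w n)"
        using elim(2) by (simp add: field_simps)
      then show ?case by (simp add: prob_of_def prob_copies_def)
    qed
  qed
qed

lemma prob_tree_few:
  fixes T :: "nat hypergraph"
  assumes T: "is_tree d T"
  shows "(\<lambda>n. prob_of n (\<lambda>H. card (comp_copies {K. T \<simeq>\<^sub>H K} H) < k)) \<longlonglongrightarrow> 0"
proof (rule tendsto_sandwich)
  show "\<forall>\<^sub>F n in sequentially. 0 \<le> prob_of n (\<lambda>H. card (comp_copies {K. T \<simeq>\<^sub>H K} H) < k)"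
    using edge_prob_le_1 by eventually_elim (simp add: prob_of_nonneg)
  show "\<forall>\<^sub>F n in sequentially. prob_of n (\<lambda>H. card (comp_copies {K. T \<simeq>\<^sub>H K} H) < k) \<le>
      (\<Sum>j<k. prob_of n (\<lambda>H. card (comp_copies {K. T \<simeq>\<^sub>H K} H) = j))"
    using edge_prob_le_1
  proof eventually_elim
    case (elim n)
    have "prob_of n (\<lambda>H. card (comp_copies {K. T \<simeq>\<^sub>H K} H) < k) =
        Pr (dsets d {1..n}) (edge_prob n) (\<lambda>E. \<exists>j\<in>{..<k}. card (comp_copies {K. T \<simeq>\<^sub>H K} ({1..n}, E)) = j)"
      unfolding prob_of_def by (rule Pr_cong) simp
    also have "\<dots> \<le> (\<Sum>j<k. prob_of n (\<lambda>H. card (comp_copies {K. T \<simeq>\<^sub>H K} H) = j))"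
      unfolding prob_of_def by (rule Pr_Bex[OF edge_prob_nonneg]) (use elim in auto)
    finally show ?case .
  qed
  have "(\<lambda>n. \<Sum>j<k. prob_of n (\<lambda>H. card (comp_copies {K. T \<simeq>\<^sub>H K} H) = j)) \<longlonglongrightarrow> (\<Sum>j<k. 0)"
    by (intro tendsto_sum prob_tree_count T)
  then show "(\<lambda>n. \<Sum>j<k. prob_of n (\<lambda>H. card (comp_copies {K. T \<simeq>\<^sub>H K} H) = j)) \<longlonglongrightarrow> 0" by simp
qed simp

section \<open>The probability of having no unicycle as normalising factor\<close>

definition prob_no_unicycle :: "nat \<Rightarrow> real" where
  "prob_no_unicycle n = prob_uni_free d n (edge_prob n)"

lemma prob_no_unicycle_bounds:
  "edge_prob n \<le> 1 \<Longrightarrow> 0 \<le> prob_no_unicycle n \<and> prob_no_unicycle n \<le> 1"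
  unfolding prob_no_unicycle_def prob_uni_free_def
  by (intro conjI Pr_nonneg Pr_le_1 edge_prob_nonneg) simp_all

lemma prob_uni_free_shift:
  "(\<lambda>n. prob_uni_free d (n - v) (edge_prob n) - prob_no_unicycle n) \<longlonglongrightarrow> 0"
proof (rule Lim_null_comparison)
  show "\<forall>\<^sub>F n in sequentially. norm (prob_uni_free d (n - v) (edge_prob n) - prob_no_unicycle n) \<le>
      real v * size_bound / real (Suc (n - v))"
    using edge_prob_le_1 eventually_ge_at_top[of v]
  proof eventually_elim
    case (elim n)
    have "\<bar>prob_uni_free d n (edge_prob n) - prob_uni_free d (n - v) (edge_prob n)\<bar> \<le>
        real (n - (n - v)) * (cyclic_bound d branching / real (Suc (n - v)))"
      using elim edge_prob_branching[of n] edge_prob_nonneg branching_bounds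
      by (intro prob_uni_free_diff d1) auto
    then show ?case using elim unfolding prob_no_unicycle_def size_bound_def
      by (simp add: abs_minus_commute)
  qed
  have "filterlim (\<lambda>n. Suc (n - v)) at_top sequentially"
    using filterlim_compose[OF filterlim_Suc filterlim_minus_const_nat_at_top] by simp
  then have "filterlim (\<lambda>n. real (Suc (n - v))) at_top sequentially"
    by (rule filterlim_compose[OF filterlim_real_sequentially])
  then show "(\<lambda>n. real v * size_bound / real (Suc (n - v))) \<longlonglongrightarrow> 0"
    by (intro tendsto_divide_0[OF tendsto_const] filterlim_at_top_imp_at_infinity)
qed

lemma frag_prob_formula:
  assumes C: "C \<in> unicyclic_family d" "H \<in> C" and n: "edge_prob n \<le> 1"
  shows "frag_prob d c C n = real (labelings d C (card (verts H))) *
    copy_weight d n (card (verts H)) (card (edges H)) (edge_prob n) *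
    prob_uni_free d (n - card (verts H)) (edge_prob n)"
proof -
  have "frag_prob d c C n = prob_of n (\<lambda>H. Frag d H \<in> C)"
    unfolding frag_prob_def by (rule prob_G[OF n])
  also have "\<dots> = real (labelings d C (card (verts H))) *
    copy_weight d n (card (verts H)) (card (edges H)) (edge_prob n) *
    prob_uni_free d (n - card (verts H)) (edge_prob n)"
    unfolding prob_of_def
  proof (rule prob_Frag_in_class[OF family_iso_closed[OF C(1)] _ d1])
    fix K assume "K \<in> C"
    then show "all_uni d K \<and> card (verts K) = card (verts H) \<and> card (edges K) = card (edges H)"
      using family_all_uni[OF C(1)] family_card[OF C] by simp
  qed
  finally show ?thesis .
qed

text \<open>An empty fragment has probability \<open>prob_no_unicycle\<close>, so the other classes
  are weighed against this one.\<close>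

definition empty_class :: "nat hypergraph set" where
  "empty_class = {K. (({}, {}) :: nat hypergraph) \<simeq>\<^sub>H K}"

lemma empty_class:
  shows "empty_class \<in> unicyclic_family d" "({}, {}) \<in> empty_class"
    "edge_prob n \<le> 1 \<Longrightarrow> frag_prob d c empty_class n = prob_no_unicycle n"
proof -
  have "all_uni d (({}, {}) :: nat hypergraph)"
    by (simp add: all_uni_def uniform_hypergraph_def components_of_def quotient_def)
  then show 1: "empty_class \<in> unicyclic_family d" unfolding empty_class_def by (rule iso_class_in_family)
  show 2: "({}, {}) \<in> empty_class" unfolding empty_class_def by (simp add: iso_hypergraph_refl)
  have "dsets d ({1..0} :: nat set) = {}" using d1 by (auto simp: dsets_def)
  then have "{F. F \<subseteq> dsets d {1..0} \<and> ({1..0}, F) \<in> empty_class} = {{}}" using 2 by auto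
  then have "labelings d empty_class 0 = 1" unfolding labelings_def by simp
  then show "edge_prob n \<le> 1 \<Longrightarrow> frag_prob d c empty_class n = prob_no_unicycle n"
    using frag_prob_formula[OF 1 2] by (simp add: copy_weight_def prob_no_unicycle_def)
qed

text \<open>Stated as a vanishing difference, since \<open>prob_no_unicycle\<close> is not yet known
  to converge. The error consists of the shift from \<open>n\<close> to \<open>n - v\<close>
  vertices, times a bounded weight, and of the error of the weight, times a probability. The clause
  on \<open>empty_class\<close> keeps the sum of the weights at least 1 later on.\<close>

lemma frag_prob_ratio:
  assumes C: "C \<in> unicyclic_family d"
  shows "\<exists>w\<ge>0. (\<lambda>n. frag_prob d c C n - w * prob_no_unicycle n) \<longlonglongrightarrow> 0 \<and> (C = empty_class \<longrightarrow> w = 1)"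
proof (cases "C = empty_class")
  case True
  have "\<forall>\<^sub>F n in sequentially. frag_prob d c C n - 1 * prob_no_unicycle n = 0"
    using edge_prob_le_1 by eventually_elim (simp add: True empty_class(3))
  then have "(\<lambda>n. frag_prob d c C n - 1 * prob_no_unicycle n) \<longlonglongrightarrow> 0" by (rule tendsto_eventually)
  then show ?thesis by (intro exI[of _ 1]) simp
next
  case False
  obtain H :: "nat hypergraph" where H0: "all_uni d H" "C = {K. H \<simeq>\<^sub>H K}" using C by (rule unicyclic_familyE)
  have HC: "H \<in> C" unfolding H0(2) by (simp add: iso_hypergraph_refl)
  let ?v = "card (verts H)" and ?k = "card (edges H)"
  let ?w = "\<lambda>n. real (labelings d C ?v) * copy_weight d n ?v ?k (edge_prob n)"
  define w where "w = real (labelings d C ?v) * (c ^ ?k / fact ?v * exp (- (real ?v * (c / fact (d - 1)))))"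
  have w: "?w \<longlonglongrightarrow> w" unfolding w_def edge_prob_def
    by (intro tendsto_mult tendsto_const copy_weight_limit[OF d2 c_pos] all_uni_card[OF H0(1) d1])
  have "(\<lambda>n. ?w n * (prob_uni_free d (n - ?v) (edge_prob n) - prob_no_unicycle n)) \<longlonglongrightarrow> w * 0"
    by (intro tendsto_mult w prob_uni_free_shift)
  moreover have "(\<lambda>n. (?w n - w) * prob_no_unicycle n) \<longlonglongrightarrow> 0"
  proof (rule Lim_null_comparison)
    show "\<forall>\<^sub>F n in sequentially. norm ((?w n - w) * prob_no_unicycle n) \<le> \<bar>?w n - w\<bar>"
      using edge_prob_le_1
    proof eventually_elim
      case (elim n)
      then have "\<bar>prob_no_unicycle n\<bar> \<le> 1" using prob_no_unicycle_bounds[of n] by simp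
      then have "\<bar>?w n - w\<bar> * \<bar>prob_no_unicycle n\<bar> \<le> \<bar>?w n - w\<bar> * 1" by (intro mult_left_mono) auto
      then show ?case by (simp add: abs_mult)
    qed
    have "(\<lambda>n. ?w n - w) \<longlonglongrightarrow> 0" using w by (simp only: LIM_zero_iff)
    then show "(\<lambda>n. \<bar>?w n - w\<bar>) \<longlonglongrightarrow> 0" by (rule tendsto_rabs_zero)
  qed
  ultimately have "(\<lambda>n. ?w n * (prob_uni_free d (n - ?v) (edge_prob n) - prob_no_unicycle n) +
      (?w n - w) * prob_no_unicycle n) \<longlonglongrightarrow> w * 0 + 0" by (rule tendsto_add)
  moreover have "\<forall>\<^sub>F n in sequentially. ?w n * (prob_uni_free d (n - ?v) (edge_prob n) - prob_no_unicycle n) +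
      (?w n - w) * prob_no_unicycle n = frag_prob d c C n - w * prob_no_unicycle n"
    using edge_prob_le_1
  proof eventually_elim
    case (elim n)
    then have "frag_prob d c C n = ?w n * prob_uni_free d (n - ?v) (edge_prob n)"
      using frag_prob_formula[OF C HC] by simp
    then show ?case by (simp only: algebra_simps)
  qed
  ultimately have "(\<lambda>n. frag_prob d c C n - w * prob_no_unicycle n) \<longlonglongrightarrow> 0"
    by (simp add: tendsto_cong)
  moreover have "w \<ge> 0" unfolding w_def using c_pos by simp
  ultimately show ?thesis using False by blast
qed

lemma Frag_class:
  assumes "E \<subseteq> dsets d {1..n}"
  shows "\<exists>C\<in>unicyclic_family d. Frag d ({1..n}, E) \<in> C"
proof -
  have "uniform_hypergraph d ({1..n}, E)" by (rule uniform_dsets[OF _ assms]) simp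
  then have "all_uni d (Frag d ({1..n}, E))" using d1 by (rule Frag_all_uni)
  then have "{K. Frag d ({1..n}, E) \<simeq>\<^sub>H K} \<in> unicyclic_family d" by (rule iso_class_in_family)
  then show ?thesis by (rule bexI[rotated]) (simp add: iso_hypergraph_refl)
qed

lemma sum_frag_prob:
  assumes A: "A \<subseteq> unicyclic_family d" "finite A" and n: "edge_prob n \<le> 1"
  shows "(\<Sum>C\<in>A. frag_prob d c C n) = prob_of n (\<lambda>H. \<exists>C\<in>A. Frag d H \<in> C)"
proof -
  have "prob_of n (\<lambda>H. \<exists>C\<in>A. Frag d H \<in> C) = (\<Sum>C\<in>A. prob_of n (\<lambda>H. Frag d H \<in> C))"
    unfolding prob_of_def
  proof (rule Pr_Bex_unique[OF A(2)])
    fix E i j assume "i \<in> A" "j \<in> A" "Frag d ({1..n}, E) \<in> i" "Frag d ({1..n}, E) \<in> j"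
    then show "i = j" using A(1) family_disjoint by blast
  qed
  also have "\<dots> = (\<Sum>C\<in>A. frag_prob d c C n)"
    by (rule sum.cong[OF refl]) (simp add: frag_prob_def prob_G[OF n])
  finally show ?thesis by simp
qed

lemma frag_prob_mass:
  assumes n: "n \<ge> 1" "edge_prob n \<le> 1"
  shows "1 - size_bound / real (Suc M) \<le> (\<Sum>C\<in>small_classes d M. frag_prob d c C n)"
    "(\<Sum>C\<in>small_classes d M. frag_prob d c C n) \<le> 1"
proof -
  have sub: "small_classes d M \<subseteq> unicyclic_family d" by (auto simp: small_classes_def)
  note eq = sum_frag_prob[OF sub finite_small_classes n(2)]
  show "(\<Sum>C\<in>small_classes d M. frag_prob d c C n) \<le> 1" unfolding eq by (rule prob_of_le_1[OF n(2)])
  have "prob_of n (\<lambda>H. \<not> (card (verts (Frag d H)) > M)) = 1 - prob_of n (\<lambda>H. card (verts (Frag d H)) > M)"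
    unfolding prob_of_def by (rule Pr_not) simp
  moreover have "prob_of n (\<lambda>H. \<not> (card (verts (Frag d H)) > M)) \<le> prob_of n (\<lambda>H. \<exists>C\<in>small_classes d M. Frag d H \<in> C)"
  proof (rule prob_of_mono[OF n(2)])
    fix E assume E: "E \<subseteq> dsets d {1..n}" and M: "\<not> (card (verts (Frag d ({1..n}, E))) > M)"
    obtain C where "C \<in> unicyclic_family d" "Frag d ({1..n}, E) \<in> C" using Frag_class[OF E] by blast
    moreover have "card (verts (Frag d ({1..n}, E))) \<le> M" using M by simp
    ultimately show "\<exists>C\<in>small_classes d M. Frag d ({1..n}, E) \<in> C" unfolding small_classes_def by blast
  qed
  ultimately show "1 - size_bound / real (Suc M) \<le> (\<Sum>C\<in>small_classes d M. frag_prob d c C n)"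
    using prob_Frag_tail[OF n, of M] unfolding eq by linarith
qed

lemma size_bound_small:
  assumes "e > 0"
  obtains M :: nat where "size_bound / real (Suc M) < e"
proof -
  obtain M :: nat where M: "size_bound / e < real M" using reals_Archimedean2 by blast
  have "size_bound < real M * e" using M assms by (simp add: field_simps)
  also have "\<dots> \<le> real (Suc M) * e" using assms by (intro mult_right_mono) auto
  finally show ?thesis using that[of M] by (simp add: field_simps)
qed

text \<open>For every \<open>M\<close>, the sum over the classes with at most \<open>M\<close> vertices of
  \<open>frag_prob\<close> is close to a constant times \<open>prob_no_unicycle\<close>, and it is close to \<open>1\<close>.  The constant
  is at least \<open>1\<close> because of the empty class, so that \<open>prob_no_unicycle\<close> is Cauchy.\<close>

lemma convergent_prob_no_unicycle: "convergent prob_no_unicycle"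
proof -
  have "Cauchy prob_no_unicycle"
  proof (rule metric_CauchyI)
    fix e :: real assume e: "0 < e"
    obtain M where M: "size_bound / real (Suc M) < e / 4" using size_bound_small[of "e / 4"] e by auto
    let ?A = "small_classes d M"
    have A: "?A \<subseteq> unicyclic_family d" "finite ?A"
      using finite_small_classes by (auto simp: small_classes_def)
    have eA: "empty_class \<in> ?A" unfolding small_classes_def
      using empty_class(1,2) by (auto intro!: bexI[of _ "({}, {})"])
    have "\<forall>C\<in>?A. \<exists>w\<ge>0. (\<lambda>n. frag_prob d c C n - w * prob_no_unicycle n) \<longlonglongrightarrow> 0 \<and> (C = empty_class \<longrightarrow> w = 1)"
      using frag_prob_ratio A(1) by blast
    then obtain w where w: "\<forall>C\<in>?A. w C \<ge> 0 \<and> (\<lambda>n. frag_prob d c C n - w C * prob_no_unicycle n) \<longlonglongrightarrow> 0 \<and>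
        (C = empty_class \<longrightarrow> w C = 1)" by metis
    define W where "W = (\<Sum>C\<in>?A. w C)"
    have W1: "W \<ge> 1"
    proof -
      have "w empty_class \<le> W" unfolding W_def using w eA A(2) by (intro member_le_sum) auto
      then show ?thesis using w eA by simp
    qed
    have "(\<lambda>n. \<Sum>C\<in>?A. (frag_prob d c C n - w C * prob_no_unicycle n)) \<longlonglongrightarrow> (\<Sum>C\<in>?A. 0)"
      using w by (intro tendsto_sum) blast
    then have "(\<lambda>n. (\<Sum>C\<in>?A. frag_prob d c C n) - W * prob_no_unicycle n) \<longlonglongrightarrow> 0"
      by (simp add: sum_subtractf W_def sum_distrib_right)
    then have "\<forall>\<^sub>F n in sequentially. dist ((\<Sum>C\<in>?A. frag_prob d c C n) - W * prob_no_unicycle n) 0 < e / 8"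
      by (rule tendstoD) (use e in simp)
    \<comment> \<open>The small classes miss mass less than e/4 and the weights are off by less than
      e/8, together 3e/8. Two such errors stay below e, also after division by
      \<open>W \<ge> 1\<close>.\<close>
    then have "\<forall>\<^sub>F n in sequentially. \<bar>W * prob_no_unicycle n - 1\<bar> < 3 * e / 8"
      using edge_prob_le_1
    proof eventually_elim
      case (elim n)
      have "1 - size_bound / real (Suc M) \<le> (\<Sum>C\<in>?A. frag_prob d c C n)"
        "(\<Sum>C\<in>?A. frag_prob d c C n) \<le> 1" using frag_prob_mass elim by auto
      moreover have "\<bar>(\<Sum>C\<in>?A. frag_prob d c C n) - W * prob_no_unicycle n\<bar> < e / 8"
        using elim(1) by (simp add: dist_real_def)
      ultimately show ?case using M by linarith
    qed
    then obtain N where N: "\<And>n. n \<ge> N \<Longrightarrow> \<bar>W * prob_no_unicycle n - 1\<bar> < 3 * e / 8"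
      by (auto simp: eventually_sequentially)
    have "dist (prob_no_unicycle m) (prob_no_unicycle n) < e" if "m \<ge> N" "n \<ge> N" for m n
    proof -
      have "\<bar>W * (prob_no_unicycle m - prob_no_unicycle n)\<bar> < e"
        unfolding right_diff_distrib using N[OF that(1)] N[OF that(2)] by linarith
      moreover have "1 * \<bar>prob_no_unicycle m - prob_no_unicycle n\<bar> \<le> W * \<bar>prob_no_unicycle m - prob_no_unicycle n\<bar>"
        using W1 by (intro mult_right_mono) auto
      ultimately show ?thesis using W1 by (simp add: abs_mult dist_real_def)
    qed
    then show "\<exists>N. \<forall>m\<ge>N. \<forall>n\<ge>N. dist (prob_no_unicycle m) (prob_no_unicycle n) < e" by blast
  qed
  then show ?thesis by (rule Cauchy_convergent)
qed

section \<open>Existence and total mass of the limits\<close>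

lemma convergent_frag_prob:
  assumes "C \<in> unicyclic_family d"
  shows "convergent (frag_prob d c C)" "frag_prob d c C \<longlonglongrightarrow> p_lim d c C"
proof -
  obtain w where "(\<lambda>n. frag_prob d c C n - w * prob_no_unicycle n) \<longlonglongrightarrow> 0"
    using frag_prob_ratio[OF assms] by blast
  moreover obtain q where "prob_no_unicycle \<longlonglongrightarrow> q"
    using convergent_prob_no_unicycle by (auto simp: convergent_def)
  ultimately have "(\<lambda>n. (frag_prob d c C n - w * prob_no_unicycle n) + w * prob_no_unicycle n) \<longlonglongrightarrow> 0 + w * q"
    by (intro tendsto_add tendsto_mult tendsto_const)
  then have "frag_prob d c C \<longlonglongrightarrow> w * q" by simp
  then show "convergent (frag_prob d c C)" by (rule convergentI)
  then show "frag_prob d c C \<longlonglongrightarrow> p_lim d c C" unfolding p_lim_def by (simp only: convergent_LIMSEQ_iff)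
qed

lemma sum_p_lim:
  assumes A: "A \<subseteq> unicyclic_family d"
  shows "(\<lambda>n. \<Sum>C\<in>A. frag_prob d c C n) \<longlonglongrightarrow> (\<Sum>C\<in>A. p_lim d c C)"
  using convergent_frag_prob(2) A by (intro tendsto_sum) blast

lemma p_lim_nonneg: "C \<in> unicyclic_family d \<Longrightarrow> 0 \<le> p_lim d c C"
  by (rule tendsto_lowerbound[OF convergent_frag_prob(2)]) (simp_all add: frag_prob_def)

lemma sum_p_lim_le_1:
  assumes A: "A \<subseteq> unicyclic_family d" "finite A"
  shows "(\<Sum>C\<in>A. p_lim d c C) \<le> 1"
proof (rule tendsto_upperbound[OF sum_p_lim[OF A(1)]])
  show "\<forall>\<^sub>F n in sequentially. (\<Sum>C\<in>A. frag_prob d c C n) \<le> 1"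
    using edge_prob_le_1 by eventually_elim (simp add: sum_frag_prob[OF A] prob_of_le_1)
qed simp

lemma sum_p_lim_small: "1 - size_bound / real (Suc M) \<le> (\<Sum>C\<in>small_classes d M. p_lim d c C)"
proof (rule tendsto_lowerbound[OF sum_p_lim])
  show "\<forall>\<^sub>F n in sequentially. 1 - size_bound / real (Suc M) \<le> (\<Sum>C\<in>small_classes d M. frag_prob d c C n)"
    using edge_prob_le_1 by eventually_elim (simp only: frag_prob_mass)
qed (auto simp: small_classes_def)

lemma p_lim_summable: "p_lim d c summable_on unicyclic_family d"
proof (rule nonneg_bdd_above_summable_on)
  show "bdd_above (sum (p_lim d c) ` {F. F \<subseteq> unicyclic_family d \<and> finite F})"
    by (rule bdd_aboveI[of _ 1]) (use sum_p_lim_le_1 in auto)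
qed (rule p_lim_nonneg)

lemma infsum_p_lim_le_1: "infsum (p_lim d c) (unicyclic_family d) \<le> 1"
  by (rule infsum_le_finite_sums[OF p_lim_summable]) (simp add: sum_p_lim_le_1)

text \<open>All classes together have mass at most 1 and the small ones at least 1 minus the bound;
  whatever lies outside the small classes is therefore at most the bound.\<close>

lemma infsum_p_lim_tail:
  assumes T: "T \<subseteq> unicyclic_family d"
  shows "\<bar>infsum (p_lim d c) T - (\<Sum>C\<in>T \<inter> small_classes d M. p_lim d c C)\<bar> \<le> size_bound / real (Suc M)"
proof -
  let ?A = "small_classes d M" and ?U = "unicyclic_family d"
  have A: "?A \<subseteq> ?U" by (auto simp: small_classes_def)
  have sm: "p_lim d c summable_on B" if "B \<subseteq> ?U" for B
    by (rule summable_on_subset_banach[OF p_lim_summable that])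
  have split: "infsum (p_lim d c) B = (\<Sum>C\<in>B \<inter> ?A. p_lim d c C) + infsum (p_lim d c) (B - ?A)" if B: "B \<subseteq> ?U" for B
  proof -
    have "infsum (p_lim d c) ((B \<inter> ?A) \<union> (B - ?A)) = infsum (p_lim d c) (B \<inter> ?A) + infsum (p_lim d c) (B - ?A)"
      by (rule infsum_Un_disjoint) (use B in \<open>auto intro!: sm\<close>)
    moreover have "(B \<inter> ?A) \<union> (B - ?A) = B" by blast
    ultimately show ?thesis using finite_small_classes by simp
  qed
  have "0 \<le> infsum (p_lim d c) (T - ?A)" by (rule infsum_nonneg) (use T p_lim_nonneg in blast)
  moreover have "infsum (p_lim d c) (T - ?A) \<le> infsum (p_lim d c) (?U - ?A)"
    by (rule infsum_mono_neutral) (use T p_lim_nonneg in \<open>auto intro!: sm\<close>)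
  moreover have "infsum (p_lim d c) (?U - ?A) \<le> size_bound / real (Suc M)"
  proof -
    have "?U \<inter> ?A = ?A" using A by blast
    then show ?thesis using split[OF order_refl] infsum_p_lim_le_1 sum_p_lim_small[of M] by simp
  qed
  ultimately show ?thesis using split[OF T] by linarith
qed

text \<open>Tightness permits the exchange of the limit with an infinite sum: truncation to
  fragments of at most \<open>M\<close> vertices costs at most the tail bound before the limit and
  after it, and the finite sum in between converges.\<close>

lemma Frag_law:
  assumes T: "T \<subseteq> unicyclic_family d"
  shows "(\<lambda>n. prob_of n (\<lambda>H. Frag d H \<in> \<Union>T)) \<longlonglongrightarrow> infsum (p_lim d c) T"
proof (rule LIMSEQ_I)
  fix e :: real assume e: "0 < e"
  obtain M where M: "size_bound / real (Suc M) < e / 3" using size_bound_small[of "e / 3"] e by auto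
  let ?B = "T \<inter> small_classes d M"
  have B: "?B \<subseteq> unicyclic_family d" "finite ?B" using T finite_small_classes by auto
  have "\<forall>\<^sub>F n in sequentially. dist (\<Sum>C\<in>?B. frag_prob d c C n) (\<Sum>C\<in>?B. p_lim d c C) < e / 3"
    by (rule tendstoD[OF sum_p_lim[OF B(1)]]) (use e in simp)
  then have "\<forall>\<^sub>F n in sequentially. norm (prob_of n (\<lambda>H. Frag d H \<in> \<Union>T) - infsum (p_lim d c) T) < e"
    using edge_prob_le_1
  proof eventually_elim
    case (elim n)
    then have n: "n \<ge> 1" "edge_prob n \<le> 1" by auto
    have "\<bar>prob_of n (\<lambda>H. Frag d H \<in> \<Union>T) - prob_of n (\<lambda>H. \<exists>C\<in>?B. Frag d H \<in> C)\<bar> \<le>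
        prob_of n (\<lambda>H. card (verts (Frag d H)) > M)"
    proof (rule prob_of_abs_diff[OF n(2)])
      fix E assume "\<not> card (verts (Frag d ({1..n}, E))) > M"
      then have M: "card (verts (Frag d ({1..n}, E))) \<le> M" by simp
      have "C \<in> ?B" if "C \<in> T" "Frag d ({1..n}, E) \<in> C" for C
        using that T M unfolding small_classes_def by blast
      then show "Frag d ({1..n}, E) \<in> \<Union>T \<longleftrightarrow> (\<exists>C\<in>?B. Frag d ({1..n}, E) \<in> C)" by blast
    qed
    then have "\<bar>prob_of n (\<lambda>H. Frag d H \<in> \<Union>T) - (\<Sum>C\<in>?B. frag_prob d c C n)\<bar> < e / 3"
      using prob_Frag_tail[OF n, of M] M sum_frag_prob[OF B n(2)] by linarith
    moreover have "\<bar>(\<Sum>C\<in>?B. frag_prob d c C n) - (\<Sum>C\<in>?B. p_lim d c C)\<bar> < e / 3"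
      using elim(1) by (simp add: dist_real_def)
    ultimately show ?case using infsum_p_lim_tail[OF T, of M] M unfolding real_norm_def by linarith
  qed
  then show "\<exists>no. \<forall>n\<ge>no. norm (prob_of n (\<lambda>H. Frag d H \<in> \<Union>T) - infsum (p_lim d c) T) < e"
    by (simp only: eventually_sequentially)
qed

end

section \<open>Types of bounded quantifier rank\<close>

primrec qrank :: "fo \<Rightarrow> nat" where
  "qrank (Eq x y) = 0"
| "qrank (Edge xs) = 0"
| "qrank (Neg \<phi>) = qrank \<phi>"
| "qrank (Conj \<phi> \<psi>) = max (qrank \<phi>) (qrank \<psi>)"
| "qrank (Ex x \<phi>) = Suc (qrank \<phi>)"

text \<open>In a tuple, \<open>None\<close> stands for an element chosen outside of the hypergraph; this lets the
  blocks of a partition carry tuples that are indexed alike.  Types are coded by natural numbers.\<close>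

definition eq_atoms :: "'a option list \<Rightarrow> (nat \<times> nat) set" where
  "eq_atoms as = {(i, j). i < length as \<and> j < length as \<and> as ! i \<noteq> None \<and> as ! i = as ! j}"

definition edge_atoms :: "'a hypergraph \<Rightarrow> 'a option list \<Rightarrow> nat set set" where
  "edge_atoms H as = {I. I \<subseteq> {..<length as} \<and> (\<exists>e\<in>edges H. (!) as ` I = Some ` e)}"

text \<open>Hintikka types of rank \<open>k\<close>. The successor clause also stores the type of
  rank \<open>k\<close> and the one after a \<open>None\<close> move, which makes
  \<open>tp_Suc_imp\<close> immediate. A set of codes is a number again, so all levels live in one
  type and structures over different vertex types can be compared.\<close>

primrec tp :: "nat \<Rightarrow> 'a hypergraph \<Rightarrow> 'a option list \<Rightarrow> nat" where
  "tp 0 H as = prod_encode (set_encode (prod_encode ` eq_atoms as), set_encode (set_encode ` edge_atoms H as))"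
| "tp (Suc k) H as = prod_encode (tp k H as, prod_encode (tp k H (None # as),
     set_encode ((\<lambda>a. tp k H (Some a # as)) ` verts H)))"

lemma finite_eq_atoms: "finite (eq_atoms as)"
  by (rule finite_subset[of _ "{..<length as} \<times> {..<length as}"]) (auto simp: eq_atoms_def)

lemma edge_atoms_subset: "edge_atoms H as \<subseteq> Pow {..<length as}"
  by (auto simp: edge_atoms_def)

lemma finite_edge_atoms: "finite (edge_atoms H as)"
  by (rule finite_subset[OF edge_atoms_subset]) simp

lemma edge_atoms_finite: "edge_atoms H as \<subseteq> Collect finite"
  using edge_atoms_subset[of H as] finite_subset[of _ "{..<length as}"] by blast

lemma tp_0_iff: "tp 0 H as = tp 0 K bs \<longleftrightarrow> eq_atoms as = eq_atoms bs \<and> edge_atoms H as = edge_atoms K bs"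
proof -
  have "set_encode (prod_encode ` eq_atoms as) = set_encode (prod_encode ` eq_atoms bs) \<longleftrightarrow>
      eq_atoms as = eq_atoms bs"
    using inj_image_eq_iff[OF inj_prod_encode] by (simp add: set_encode_eq finite_eq_atoms)
  moreover have "set_encode (set_encode ` edge_atoms H as) = set_encode (set_encode ` edge_atoms K bs) \<longleftrightarrow>
      edge_atoms H as = edge_atoms K bs"
    using inj_on_image_eq_iff[OF inj_on_set_encode edge_atoms_finite[of H as] edge_atoms_finite[of K bs]]
    by (simp add: set_encode_eq finite_edge_atoms)
  ultimately show ?thesis by (simp add: prod_encode_eq)
qed

lemma tp_Suc_iff:
  fixes H :: "'a hypergraph" and K :: "'b hypergraph"
  assumes "finite (verts H)" "finite (verts K)"
  shows "tp (Suc k) H as = tp (Suc k) K bs \<longleftrightarrow> tp k H as = tp k K bs \<and> tp k H (None # as) = tp k K (None # bs) \<and>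
    (\<forall>a\<in>verts H. \<exists>b\<in>verts K. tp k H (Some a # as) = tp k K (Some b # bs)) \<and>
    (\<forall>b\<in>verts K. \<exists>a\<in>verts H. tp k K (Some b # bs) = tp k H (Some a # as))"
proof -
  have "(f ` A = g ` B) \<longleftrightarrow> (\<forall>a\<in>A. \<exists>b\<in>B. f a = g b) \<and> (\<forall>b\<in>B. \<exists>a\<in>A. g b = f a)"
    for f :: "'a \<Rightarrow> nat" and g :: "'b \<Rightarrow> nat" and A B by blast
  then show ?thesis using assms by (simp add: prod_encode_eq set_encode_eq)
qed

lemma tp_Suc_imp: "tp (Suc k) H as = tp (Suc k) K bs \<Longrightarrow> tp k H as = tp k K bs"
  "tp (Suc k) H as = tp (Suc k) K bs \<Longrightarrow> tp k H (None # as) = tp k K (None # bs)"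
  by (simp_all add: prod_encode_eq)

lemma tp_imp_tp_0: "tp k H as = tp k K bs \<Longrightarrow> tp 0 H as = tp 0 K bs"
proof (induction k)
  case (Suc k)
  then show ?case using tp_Suc_imp(1)[of k H as K bs] by blast
qed

lemma finite_types:
  "finite {tp k H as |(H :: 'a hypergraph) as. length as = r}"
proof (induction k arbitrary: r)
  case 0
  let ?X = "prod_encode ` (set_encode ` Pow (prod_encode ` ({..<r} \<times> {..<r})) \<times> set_encode ` Pow (set_encode ` Pow {..<r}))"
  have "tp 0 H as \<in> ?X" if "length as = r" for H :: "'a hypergraph" and as
  proof -
    have "prod_encode ` eq_atoms as \<in> Pow (prod_encode ` ({..<r} \<times> {..<r}))"
      using that by (auto simp: eq_atoms_def)
    moreover have "set_encode ` edge_atoms H as \<in> Pow (set_encode ` Pow {..<r})"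
      using edge_atoms_subset[of H as] that by auto
    ultimately show ?thesis unfolding tp.simps by (intro imageI SigmaI)
  qed
  then have "{tp 0 H as |(H :: 'a hypergraph) as. length as = r} \<subseteq> ?X" by blast
  then show ?case by (rule finite_subset) simp
next
  case (Suc k)
  let ?T = "\<lambda>r. {tp k H as |(H :: 'a hypergraph) as. length as = r}"
  let ?X = "prod_encode ` (?T r \<times> prod_encode ` (?T (Suc r) \<times> set_encode ` Pow (?T (Suc r))))"
  have "tp (Suc k) H as \<in> ?X" if r: "length as = r" for H :: "'a hypergraph" and as
  proof -
    have 1: "tp k H as \<in> ?T r" using r by blast
    have 2: "tp k H (x # as) \<in> ?T (Suc r)" for x
    proof -
      have "length (x # as) = Suc r" using r by simp
      then show ?thesis by blast
    qed
    have 3: "(\<lambda>a. tp k H (Some a # as)) ` verts H \<in> Pow (?T (Suc r))"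
      by (rule PowI) (rule image_subsetI, rule 2)
    show ?thesis unfolding tp.simps by (intro imageI SigmaI 1 2 3)
  qed
  then have "{tp (Suc k) H as |(H :: 'a hypergraph) as. length as = r} \<subseteq> ?X" by blast
  moreover have "finite ?X" using Suc.IH[of r] Suc.IH[of "Suc r"] by simp
  ultimately show ?case by (rule finite_subset)
qed

lemma tp_iso:
  assumes f: "iso_via f H K" and wf: "wf_hypergraph H" and as: "\<forall>a. Some a \<in> set as \<longrightarrow> a \<in> verts H"
  shows "tp k K (map (map_option f) as) = tp k H as"
  using as
proof (induction k arbitrary: as)
  case 0
  have inj: "inj_on f (verts H)" and E: "edges K = (`) f ` edges H" using f by (auto simp: iso_via_def bij_betw_def)
  let ?g = "map_option f" and ?D = "insert None (Some ` verts H)"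
  have ginj: "inj_on ?g ?D" using inj by (auto simp: inj_on_def)
  have mem: "as ! i \<in> ?D" if "i < length as" for i
    using 0 that nth_mem[OF that] by (cases "as ! i") auto
  have "eq_atoms (map ?g as) = eq_atoms as"
    unfolding eq_atoms_def
    by (simp add: inj_on_eq_iff[OF ginj mem mem] del: not_None_eq cong: conj_cong)
  moreover have "edge_atoms K (map ?g as) = edge_atoms H as"
  proof -
    have "(\<exists>e\<in>edges K. (!) (map ?g as) ` I = Some ` e) \<longleftrightarrow> (\<exists>e\<in>edges H. (!) as ` I = Some ` e)"
      if I: "I \<subseteq> {..<length as}" for I
    proof -
      have 1: "(!) (map ?g as) ` I = ?g ` ((!) as ` I)" using I by (auto simp: image_image intro!: image_cong)
      have 2: "Some ` f ` e = ?g ` Some ` e" for e by (simp add: image_image)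
      have 3: "?g ` ((!) as ` I) = ?g ` (Some ` e) \<longleftrightarrow> (!) as ` I = Some ` e" if "e \<in> edges H" for e
      proof (rule inj_on_image_eq_iff[OF ginj])
        show "(!) as ` I \<subseteq> ?D" using mem I by (intro image_subsetI) auto
        show "Some ` e \<subseteq> ?D" using wf that by auto
      qed
      show ?thesis
      proof
        assume "\<exists>e\<in>edges K. (!) (map ?g as) ` I = Some ` e"
        then obtain e where e: "e \<in> edges H" "(!) (map ?g as) ` I = Some ` f ` e" unfolding E by blast
        then have "(!) as ` I = Some ` e" using 3[OF e(1)] unfolding 1 2 by simp
        with e(1) show "\<exists>e\<in>edges H. (!) as ` I = Some ` e" by blast
      next
        assume "\<exists>e\<in>edges H. (!) as ` I = Some ` e"
        then obtain e where e: "e \<in> edges H" "(!) as ` I = Some ` e" by blast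
        then have "(!) (map ?g as) ` I = Some ` f ` e" using 3[OF e(1)] unfolding 1 2 by simp
        with e(1) show "\<exists>e\<in>edges K. (!) (map ?g as) ` I = Some ` e" unfolding E by blast
      qed
    qed
    then show ?thesis unfolding edge_atoms_def length_map by (intro Collect_cong conj_cong refl)
  qed
  ultimately show ?case by (simp only: tp_0_iff)
next
  case (Suc k)
  have V: "verts K = f ` verts H" using f by (auto simp: iso_via_def bij_betw_def)
  have 1: "tp k K (map (map_option f) as) = tp k H as" using Suc by blast
  have 2: "tp k K (None # map (map_option f) as) = tp k H (None # as)"
    using Suc.IH[of "None # as"] Suc.prems by simp
  have 3: "tp k K (Some (f a) # map (map_option f) as) = tp k H (Some a # as)" if "a \<in> verts H" for a
    using Suc.IH[of "Some a # as"] Suc.prems that by simp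
  have "(\<lambda>a. tp k K (Some a # map (map_option f) as)) ` verts K = (\<lambda>a. tp k H (Some a # as)) ` verts H"
    unfolding V image_image by (rule image_cong) (simp_all add: 3)
  then show ?case by (simp only: tp.simps 1 2)
qed

text \<open>\<open>r\<close> gives for each free variable a position holding its value in both
  tuples. A quantifier puts its witness in front, so old positions move by one and \<open>x\<close>
  is redirected to 0; an overwritten value stays in the tuple without being referred to.\<close>

lemma tp_sat:
  assumes "finite (verts H)" "finite (verts K)"
  shows "tp k H as = tp k K bs \<Longrightarrow> qrank \<phi> \<le> k \<Longrightarrow>
    (\<And>x. x \<in> free_vars \<phi> \<Longrightarrow> r x < length as \<and> r x < length bs \<and> as ! r x = Some (\<sigma> x) \<and> bs ! r x = Some (\<tau> x)) \<Longrightarrow>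
    sat H \<sigma> \<phi> \<longleftrightarrow> sat K \<tau> \<phi>"
proof (induction \<phi> arbitrary: k as bs r \<sigma> \<tau>)
  case (Eq x y)
  have e: "eq_atoms as = eq_atoms bs" using tp_imp_tp_0[OF Eq.prems(1)] by (simp only: tp_0_iff)
  have "(r x, r y) \<in> eq_atoms as \<longleftrightarrow> \<sigma> x = \<sigma> y" "(r x, r y) \<in> eq_atoms bs \<longleftrightarrow> \<tau> x = \<tau> y"
    using Eq.prems(3)[of x] Eq.prems(3)[of y] by (auto simp: eq_atoms_def)
  then show ?case using e by simp
next
  case (Edge xs)
  have e: "eq_atoms as = eq_atoms bs" "edge_atoms H as = edge_atoms K bs"
    using tp_imp_tp_0[OF Edge.prems(1)] by (simp_all only: tp_0_iff)
  have v: "r x < length as \<and> r x < length bs \<and> as ! r x = Some (\<sigma> x) \<and> bs ! r x = Some (\<tau> x)" if "x \<in> set xs" for x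
    using Edge.prems(3)[of x] that by simp
  have "\<sigma> x = \<sigma> y \<longleftrightarrow> \<tau> x = \<tau> y" if "x \<in> set xs" "y \<in> set xs" for x y
  proof -
    have "(r x, r y) \<in> eq_atoms as \<longleftrightarrow> \<sigma> x = \<sigma> y" "(r x, r y) \<in> eq_atoms bs \<longleftrightarrow> \<tau> x = \<tau> y"
      using v[OF that(1)] v[OF that(2)] by (auto simp: eq_atoms_def)
    then show ?thesis using e by simp
  qed
  then have d: "distinct (map \<sigma> xs) \<longleftrightarrow> distinct (map \<tau> xs)"
    unfolding distinct_map inj_on_def by blast
  have inj_Some: "Some ` X = Some ` Y \<longleftrightarrow> X = Y" for X Y :: "'x set" by (simp add: inj_image_eq_iff)
  have "(!) as ` r ` set xs = Some ` set (map \<sigma> xs)"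
    unfolding set_map image_image by (rule image_cong[OF refl]) (simp add: v)
  then have "r ` set xs \<in> edge_atoms H as \<longleftrightarrow> set (map \<sigma> xs) \<in> edges H"
    unfolding edge_atoms_def mem_Collect_eq by (simp only: inj_Some) (use v in auto)
  moreover have "(!) bs ` r ` set xs = Some ` set (map \<tau> xs)"
    unfolding set_map image_image by (rule image_cong[OF refl]) (simp add: v)
  then have "r ` set xs \<in> edge_atoms K bs \<longleftrightarrow> set (map \<tau> xs) \<in> edges K"
    unfolding edge_atoms_def mem_Collect_eq by (simp only: inj_Some) (use v in auto)
  ultimately show ?case unfolding sat.simps using d e(2) by simp
next
  case (Neg \<phi>)
  have "sat H \<sigma> \<phi> \<longleftrightarrow> sat K \<tau> \<phi>"
    by (rule Neg.IH[OF Neg.prems(1), of r]) (use Neg.prems(2,3) in simp_all)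
  then show ?case by simp
next
  case (Conj \<phi> \<psi>)
  have "sat H \<sigma> \<phi> \<longleftrightarrow> sat K \<tau> \<phi>"
    by (rule Conj.IH(1)[OF Conj.prems(1), of r]) (use Conj.prems(2,3) in simp_all)
  moreover have "sat H \<sigma> \<psi> \<longleftrightarrow> sat K \<tau> \<psi>"
    by (rule Conj.IH(2)[OF Conj.prems(1), of r]) (use Conj.prems(2,3) in simp_all)
  ultimately show ?case by simp
next
  case (Ex x \<phi>)
  obtain k' where k: "k = Suc k'" using Ex.prems(2) by (cases k) auto
  have q: "qrank \<phi> \<le> k'" using Ex.prems(2) k by simp
  have step: "sat H (\<sigma>(x := a)) \<phi> \<longleftrightarrow> sat K (\<tau>(x := b)) \<phi>"
    if "tp k' H (Some a # as) = tp k' K (Some b # bs)" for a b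
  proof (rule Ex.IH[OF that q, of "\<lambda>y. if y = x then 0 else Suc (r y)"])
    fix y assume "y \<in> free_vars \<phi>"
    then show "(if y = x then 0 else Suc (r y)) < length (Some a # as) \<and>
        (if y = x then 0 else Suc (r y)) < length (Some b # bs) \<and>
        (Some a # as) ! (if y = x then 0 else Suc (r y)) = Some ((\<sigma>(x := a)) y) \<and>
        (Some b # bs) ! (if y = x then 0 else Suc (r y)) = Some ((\<tau>(x := b)) y)"
      using Ex.prems(3)[of y] by (cases "y = x") simp_all
  qed
  have t: "\<forall>a\<in>verts H. \<exists>b\<in>verts K. tp k' H (Some a # as) = tp k' K (Some b # bs)"
    "\<forall>b\<in>verts K. \<exists>a\<in>verts H. tp k' K (Some b # bs) = tp k' H (Some a # as)"
    using Ex.prems(1) unfolding k tp_Suc_iff[OF assms] by blast+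
  show ?case unfolding sat.simps
  proof
    assume "\<exists>a\<in>verts H. sat H (\<sigma>(x := a)) \<phi>"
    then obtain a where a: "a \<in> verts H" "sat H (\<sigma>(x := a)) \<phi>" by blast
    obtain b where b: "b \<in> verts K" "tp k' H (Some a # as) = tp k' K (Some b # bs)" using t(1) a(1) by blast
    then show "\<exists>b\<in>verts K. sat K (\<tau>(x := b)) \<phi>" using step[OF b(2)] a(2) by blast
  next
    assume "\<exists>b\<in>verts K. sat K (\<tau>(x := b)) \<phi>"
    then obtain b where b: "b \<in> verts K" "sat K (\<tau>(x := b)) \<phi>" by blast
    obtain a where a: "a \<in> verts H" "tp k' K (Some b # bs) = tp k' H (Some a # as)" using t(2) b(1) by blast
    then show "\<exists>a\<in>verts H. sat H (\<sigma>(x := a)) \<phi>" using step[OF a(2)[symmetric]] b(2) by blast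
  qed
qed

section \<open>Composition of types over a partition into closed blocks\<close>

definition closed_partition :: "'a hypergraph \<Rightarrow> 'a set set \<Rightarrow> bool" where
  "closed_partition H P \<longleftrightarrow> (\<forall>W\<in>P. closed_in H W) \<and> \<Union>P = verts H \<and> disjoint P"

definition restr :: "'a set \<Rightarrow> 'a option list \<Rightarrow> 'a option list" where
  "restr W as = map (\<lambda>x. case x of None \<Rightarrow> None | Some a \<Rightarrow> if a \<in> W then Some a else None) as"

lemma length_restr [simp]: "length (restr W as) = length as"
  by (simp add: restr_def)

lemma restr_nth_Some: "i < length as \<Longrightarrow> restr W as ! i = Some a \<longleftrightarrow> as ! i = Some a \<and> a \<in> W"
  by (auto simp: restr_def split: option.splits)

lemma restr_Cons [simp]: "restr W (None # as) = None # restr W as"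
  "restr W (Some a # as) = (if a \<in> W then Some a else None) # restr W as"
  by (simp_all add: restr_def)

lemma restr_outside:
  assumes "\<And>a. Some a \<in> set as \<Longrightarrow> a \<notin> W"
  shows "restr W as = replicate (length as) None"
  unfolding restr_def using assms by (induction as) (auto split: option.splits)

text \<open>The invariant of the Ehrenfeucht game: finitely many blocks have been touched and are matched
  with equal types, and every type of an untouched block occurs often enough on the other side.\<close>

definition plentiful :: "nat \<Rightarrow> nat \<Rightarrow> 'a hypergraph \<Rightarrow> 'a set set \<Rightarrow> 'b hypergraph \<Rightarrow> 'b set set \<Rightarrow> bool" where
  "plentiful k r H R K R' \<longleftrightarrow> (\<forall>W\<in>R. k \<le> card {W' \<in> R'.
     tp k (induced K W') (replicate r None) = tp k (induced H W) (replicate r None)})"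

definition matched :: "nat \<Rightarrow> 'a hypergraph \<Rightarrow> 'a set set \<Rightarrow> 'a option list \<Rightarrow>
    'b hypergraph \<Rightarrow> 'b set set \<Rightarrow> 'b option list \<Rightarrow> bool" where
  "matched k H P as K P' bs \<longleftrightarrow> length as = length bs \<and> (\<exists>Q Q' h. Q \<subseteq> P \<and> Q' \<subseteq> P' \<and> bij_betw h Q Q' \<and>
     (\<forall>a. Some a \<in> set as \<longrightarrow> a \<in> \<Union>Q) \<and> (\<forall>b. Some b \<in> set bs \<longrightarrow> b \<in> \<Union>Q') \<and>
     (\<forall>W\<in>Q. tp k (induced H W) (restr W as) = tp k (induced K (h W)) (restr (h W) bs)) \<and>
     plentiful k (length as) H (P - Q) K (P' - Q') \<and> plentiful k (length as) K (P' - Q') H (P - Q))"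

lemma matched_sym:
  assumes "matched k H P as K P' bs"
  shows "matched k K P' bs H P as"
proof -
  obtain Q Q' h where h: "length as = length bs" "Q \<subseteq> P" "Q' \<subseteq> P'" "bij_betw h Q Q'"
     "\<forall>a. Some a \<in> set as \<longrightarrow> a \<in> \<Union>Q" "\<forall>b. Some b \<in> set bs \<longrightarrow> b \<in> \<Union>Q'"
     "\<forall>W\<in>Q. tp k (induced H W) (restr W as) = tp k (induced K (h W)) (restr (h W) bs)"
     "plentiful k (length as) H (P - Q) K (P' - Q')" "plentiful k (length as) K (P' - Q') H (P - Q)"
    using assms unfolding matched_def by blast
  let ?g = "inv_into Q h"
  have g: "bij_betw ?g Q' Q" by (rule bij_betw_inv_into[OF h(4)])
  have "tp k (induced K W) (restr W bs) = tp k (induced H (?g W)) (restr (?g W) as)" if W: "W \<in> Q'" for W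
  proof -
    have "?g W \<in> Q" "h (?g W) = W"
      using W h(4) g by (auto simp: bij_betw_def f_inv_into_f)
    then show ?thesis using h(7) by metis
  qed
  then show ?thesis unfolding matched_def using h g by (intro conjI exI[of _ Q'] exI[of _ Q] exI[of _ ?g]) simp_all
qed

text \<open>Taking away one block on each side lowers every count by at most one, and the drop of
  the rank from \<open>Suc k\<close> to \<open>k\<close> pays for it. Untouched blocks see the move
  as \<open>None\<close>, hence \<open>Suc r\<close>.\<close>

lemma plentiful_step:
  assumes "plentiful (Suc k) r H R K R'" "finite R'"
  shows "plentiful k r H R K R'" "plentiful k (Suc r) H R K R'"
    "plentiful k (Suc r) H (R - {W0}) K (R' - {W1})"
proof -
  let ?S = "\<lambda>k r W. {W' \<in> R'. tp k (induced K W') (replicate r None) = tp k (induced H W) (replicate r None)}"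
  have c: "Suc k \<le> card (?S (Suc k) r W)" if "W \<in> R" for W
    using assms(1) that unfolding plentiful_def by blast
  have sub1: "?S (Suc k) r W \<subseteq> ?S k r W" for W using tp_Suc_imp(1) by blast
  have sub2: "?S (Suc k) r W \<subseteq> ?S k (Suc r) W" for W unfolding replicate_Suc using tp_Suc_imp(2) by blast
  have 1: "Suc k \<le> card (?S k r W)" if "W \<in> R" for W
    by (rule order_trans[OF c[OF that] card_mono[OF _ sub1]]) (simp add: assms(2))
  have 2: "Suc k \<le> card (?S k (Suc r) W)" if "W \<in> R" for W
    by (rule order_trans[OF c[OF that] card_mono[OF _ sub2]]) (simp add: assms(2))
  show "plentiful k r H R K R'" unfolding plentiful_def by (rule ballI, rule Suc_leD, rule 1)
  show "plentiful k (Suc r) H R K R'" unfolding plentiful_def by (rule ballI, rule Suc_leD, rule 2)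
  show "plentiful k (Suc r) H (R - {W0}) K (R' - {W1})"
    unfolding plentiful_def
  proof
    fix W assume "W \<in> R - {W0}"
    then have W: "W \<in> R" by simp
    have "{W' \<in> R' - {W1}. tp k (induced K W') (replicate (Suc r) None) = tp k (induced H W) (replicate (Suc r) None)} =
        ?S k (Suc r) W - {W1}" by blast
    moreover have "card (?S k (Suc r) W) - 1 \<le> card (?S k (Suc r) W - {W1})"
      using diff_card_le_card_Diff[of "{W1}" "?S k (Suc r) W"] by simp
    ultimately show "k \<le> card {W' \<in> R' - {W1}. tp k (induced K W') (replicate (Suc r) None) =
        tp k (induced H W) (replicate (Suc r) None)}" using 2[OF W] by simp
  qed
qed

lemma matched_None:
  assumes "matched (Suc k) H P as K P' bs" "finite P" "finite P'"
  shows "matched k H P as K P' bs" "matched k H P (None # as) K P' (None # bs)"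
proof -
  obtain Q Q' h where h: "length as = length bs" "Q \<subseteq> P" "Q' \<subseteq> P'" "bij_betw h Q Q'"
     "\<forall>a. Some a \<in> set as \<longrightarrow> a \<in> \<Union>Q" "\<forall>b. Some b \<in> set bs \<longrightarrow> b \<in> \<Union>Q'"
     "\<forall>W\<in>Q. tp (Suc k) (induced H W) (restr W as) = tp (Suc k) (induced K (h W)) (restr (h W) bs)"
     "plentiful (Suc k) (length as) H (P - Q) K (P' - Q')" "plentiful (Suc k) (length as) K (P' - Q') H (P - Q)"
    using assms(1) unfolding matched_def by blast
  have fin: "finite (P - Q)" "finite (P' - Q')" using assms by auto
  note s = plentiful_step[OF h(8) fin(2)] plentiful_step[OF h(9) fin(1)]
  have t: "\<forall>W\<in>Q. tp k (induced H W) (restr W as) = tp k (induced K (h W)) (restr (h W) bs)"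
    "\<forall>W\<in>Q. tp k (induced H W) (restr W (None # as)) = tp k (induced K (h W)) (restr (h W) (None # bs))"
    using h(7) tp_Suc_imp unfolding restr_Cons by blast+
  show "matched k H P as K P' bs" unfolding matched_def
    using h s t(1) by (intro conjI exI[of _ Q] exI[of _ Q'] exI[of _ h]) simp_all
  show "matched k H P (None # as) K P' (None # bs)" unfolding matched_def
    using h s by (intro conjI exI[of _ Q] exI[of _ Q'] exI[of _ h] t(2)) simp_all
qed

text \<open>If \<open>a\<close> lies in a touched block, the answer is sought in its partner;
  otherwise in an untouched block of the same type, supplied by \<open>plentiful\<close>, and the
  two blocks become partners. All other touched blocks see the move as \<open>None\<close>.\<close>

lemma matched_forth:
  assumes m: "matched (Suc k) H P as K P' bs" and fin: "finite (verts H)" "finite (verts K)" "finite P" "finite P'"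
    and P: "closed_partition H P" "closed_partition K P'" and a: "a \<in> verts H"
  shows "\<exists>b\<in>verts K. matched k H P (Some a # as) K P' (Some b # bs)"
proof -
  obtain Q Q' h where h: "length as = length bs" "Q \<subseteq> P" "Q' \<subseteq> P'" "bij_betw h Q Q'"
     "\<forall>a. Some a \<in> set as \<longrightarrow> a \<in> \<Union>Q" "\<forall>b. Some b \<in> set bs \<longrightarrow> b \<in> \<Union>Q'"
     "\<forall>W\<in>Q. tp (Suc k) (induced H W) (restr W as) = tp (Suc k) (induced K (h W)) (restr (h W) bs)"
     "plentiful (Suc k) (length as) H (P - Q) K (P' - Q')" "plentiful (Suc k) (length as) K (P' - Q') H (P - Q)"
    using m unfolding matched_def by blast
  have finR: "finite (P - Q)" "finite (P' - Q')" using fin by auto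
  note s = plentiful_step[OF h(8) finR(2)] plentiful_step[OF h(9) finR(1)]
  have dP: "W = U" if "W \<in> P" "U \<in> P" "x \<in> W" "x \<in> U" for W U x
    using P(1) that unfolding closed_partition_def disjoint_def by blast
  have dP': "W = U" if "W \<in> P'" "U \<in> P'" "x \<in> W" "x \<in> U" for W U x
    using P(2) that unfolding closed_partition_def disjoint_def by blast
  have sub: "W \<subseteq> verts H" if "W \<in> P" for W using P(1) that unfolding closed_partition_def by blast
  have sub': "W \<subseteq> verts K" if "W \<in> P'" for W using P(2) that unfolding closed_partition_def by blast
  have finW: "finite (verts (induced H W))" if "W \<in> P" for W
    using finite_subset[OF sub[OF that] fin(1)] by simp
  have finW': "finite (verts (induced K W))" if "W \<in> P'" for W
    using finite_subset[OF sub'[OF that] fin(2)] by simp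
  obtain W where W: "W \<in> P" "a \<in> W" using a P(1) unfolding closed_partition_def by blast
  have other: "tp k (induced H U) (None # restr U as) = tp k (induced K (h U)) (None # restr (h U) bs)" if "U \<in> Q" for U
    using h(7) that tp_Suc_imp(2) by blast
  show ?thesis
  proof (cases "W \<in> Q")
    case True
    then have hW: "h W \<in> Q'" "h W \<in> P'" using h(3,4) by (auto simp: bij_betw_def)
    have "\<exists>b\<in>verts (induced K (h W)). tp k (induced H W) (Some a # restr W as) =
        tp k (induced K (h W)) (Some b # restr (h W) bs)"
      using h(7)[rule_format, OF True, unfolded tp_Suc_iff[OF finW[OF W(1)] finW'[OF hW(2)]]] W(2)
      unfolding verts_induced by blast
    then obtain b where b: "b \<in> h W" "tp k (induced H W) (Some a # restr W as) =
        tp k (induced K (h W)) (Some b # restr (h W) bs)" by auto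
    have t: "tp k (induced H U) (restr U (Some a # as)) = tp k (induced K (h U)) (restr (h U) (Some b # bs))"
      if U: "U \<in> Q" for U
    proof (cases "U = W")
      case True
      then show ?thesis using b W(2) by simp
    next
      case False
      have "U \<in> P" using U h(2) by blast
      then have "a \<notin> U" using dP[of U W a] W False by blast
      moreover have "b \<notin> h U"
      proof
        assume "b \<in> h U"
        moreover have "h U \<in> P'" using U h(3,4) by (auto simp: bij_betw_def)
        ultimately have "h U = h W" using dP'[of "h U" "h W" b] hW b(1) by blast
        then show False using h(4) U \<open>W \<in> Q\<close> False by (auto simp: bij_betw_def inj_on_def)
      qed
      ultimately show ?thesis using other[OF U] by simp
    qed
    have "matched k H P (Some a # as) K P' (Some b # bs)"
      unfolding matched_def
    proof (intro conjI exI[of _ Q] exI[of _ Q'] exI[of _ h])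
      show "\<forall>x. Some x \<in> set (Some a # as) \<longrightarrow> x \<in> \<Union>Q" using h(5) True W(2) by auto
      show "\<forall>x. Some x \<in> set (Some b # bs) \<longrightarrow> x \<in> \<Union>Q'" using h(6) hW(1) b(1) by auto
    qed (use h s t in simp_all)
    then show ?thesis using b(1) sub'[OF hW(2)] by blast
  next
    case False
    let ?r = "length as"
    have "Suc k \<le> card {W' \<in> P' - Q'. tp (Suc k) (induced K W') (replicate ?r None) = tp (Suc k) (induced H W) (replicate ?r None)}"
      using h(8) W(1) False unfolding plentiful_def by blast
    then have "{W' \<in> P' - Q'. tp (Suc k) (induced K W') (replicate ?r None) = tp (Suc k) (induced H W) (replicate ?r None)} \<noteq> {}"
      by (metis (no_types, lifting) card.empty not_less_eq_eq zero_le)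
    then obtain W' where W': "W' \<in> P'" "W' \<notin> Q'"
      "tp (Suc k) (induced H W) (replicate ?r None) = tp (Suc k) (induced K W') (replicate ?r None)" by auto
    \<comment> \<open>An untouched block contains none of the elements chosen so far, so its tuple
      is that of the blank position, for which \<open>plentiful\<close> is formulated.\<close>
    have "restr W as = replicate ?r None"
    proof (rule restr_outside)
      fix x assume "Some x \<in> set as"
      then obtain U where "U \<in> Q" "x \<in> U" using h(5) by blast
      then show "x \<notin> W" using dP[of U W x] h(2) W(1) False by blast
    qed
    moreover have "restr W' bs = replicate ?r None"
      unfolding h(1)
    proof (rule restr_outside)
      fix x assume "Some x \<in> set bs"
      then obtain U where "U \<in> Q'" "x \<in> U" using h(6) by blast
      then show "x \<notin> W'" using dP'[of U W' x] h(3) W' by blast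
    qed
    ultimately have eq: "tp (Suc k) (induced H W) (restr W as) = tp (Suc k) (induced K W') (restr W' bs)"
      using W'(3) by simp
    have "\<exists>b\<in>verts (induced K W'). tp k (induced H W) (Some a # restr W as) = tp k (induced K W') (Some b # restr W' bs)"
      using eq[unfolded tp_Suc_iff[OF finW[OF W(1)] finW'[OF W'(1)]]] W(2)
      unfolding verts_induced by blast
    then obtain b where b: "b \<in> W'" "tp k (induced H W) (Some a # restr W as) =
        tp k (induced K W') (Some b # restr W' bs)" by auto
    let ?h = "h(W := W')"
    have bij: "bij_betw ?h (insert W Q) (insert W' Q')"
    proof -
      have "bij_betw ?h Q Q'" using h(4) False by (subst bij_betw_cong[of Q ?h h]) auto
      then have "bij_betw ?h (Q \<union> {W}) (Q' \<union> {W'})"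
        using False W'(2) by (intro bij_betw_combine) (auto simp: bij_betw_def)
      then show ?thesis by simp
    qed
    have t: "tp k (induced H U) (restr U (Some a # as)) = tp k (induced K (?h U)) (restr (?h U) (Some b # bs))"
      if U: "U \<in> insert W Q" for U
    proof (cases "U = W")
      case True
      then show ?thesis using b W(2) by simp
    next
      case F: False
      then have UQ: "U \<in> Q" using U by simp
      then have "a \<notin> U" using dP[of U W a] W F h(2) by blast
      moreover have "b \<notin> h U"
      proof
        assume "b \<in> h U"
        moreover have hU: "h U \<in> Q'" using UQ h(4) by (auto simp: bij_betw_def)
        ultimately have "h U = W'" using dP'[of "h U" W' b] W'(1) b(1) h(3) by blast
        then show False using hU W'(2) by simp
      qed
      ultimately show ?thesis using other[OF UQ] F by simp
    qed
    have R: "P - insert W Q = (P - Q) - {W}" "P' - insert W' Q' = (P' - Q') - {W'}" by blast+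
    have "matched k H P (Some a # as) K P' (Some b # bs)"
      unfolding matched_def
    proof (intro conjI exI[of _ "insert W Q"] exI[of _ "insert W' Q'"] exI[of _ ?h])
      show "\<forall>x. Some x \<in> set (Some a # as) \<longrightarrow> x \<in> \<Union>(insert W Q)" using h(5) W(2) by auto
      show "\<forall>x. Some x \<in> set (Some b # bs) \<longrightarrow> x \<in> \<Union>(insert W' Q')" using h(6) b(1) by auto
      show "plentiful k (length (Some a # as)) H (P - insert W Q) K (P' - insert W' Q')"
        unfolding R using s(3) by simp
      show "plentiful k (length (Some a # as)) K (P' - insert W' Q') H (P - insert W Q)"
        unfolding R using s(6) by simp
    qed (use h W W' bij t in simp_all)
    then show ?thesis using b(1) sub'[OF W'(1)] by blast
  qed
qed

text \<open>An equality or an edge among chosen elements is seen within one block: a nonempty edge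
  lies entirely in the block of any of its vertices, blocks being closed. The reverse inclusions
  come from \<open>matched_sym\<close>.\<close>

lemma matched_0_atoms:
  assumes m: "matched 0 H P as K P' bs" and P: "closed_partition H P" and ne: "\<forall>e\<in>edges H. e \<noteq> {}"
  shows "eq_atoms as \<subseteq> eq_atoms bs" "edge_atoms H as \<subseteq> edge_atoms K bs"
proof -
  obtain Q Q' h where h: "length as = length bs" "Q \<subseteq> P"
     "\<forall>a. Some a \<in> set as \<longrightarrow> a \<in> \<Union>Q"
     "\<forall>W\<in>Q. tp 0 (induced H W) (restr W as) = tp 0 (induced K (h W)) (restr (h W) bs)"
    using m unfolding matched_def by blast
  have at: "eq_atoms (restr W as) = eq_atoms (restr (h W) bs)"
    "edge_atoms (induced H W) (restr W as) = edge_atoms (induced K (h W)) (restr (h W) bs)" if "W \<in> Q" for W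
    using h(4) that unfolding tp_0_iff by blast+
  show "eq_atoms as \<subseteq> eq_atoms bs"
  proof clarify
    fix i j assume "(i, j) \<in> eq_atoms as"
    then have ij0: "i < length as \<and> j < length as \<and> as ! i \<noteq> None \<and> as ! i = as ! j"
      unfolding eq_atoms_def by blast
    then obtain a where "as ! i = Some a" by blast
    with ij0 have ij: "i < length as" "j < length as" "as ! i = Some a" "as ! j = Some a" by simp_all
    have "Some a \<in> set as" using ij by (metis nth_mem)
    then obtain W where W: "W \<in> Q" "a \<in> W" using h(3) by blast
    have "restr W as ! i = Some a" "restr W as ! j = Some a" using ij W by (simp_all add: restr_nth_Some)
    then have "(i, j) \<in> eq_atoms (restr W as)" using ij by (simp add: eq_atoms_def)
    then have "(i, j) \<in> eq_atoms (restr (h W) bs)" using at(1)[OF W(1)] by simp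
    then have "restr (h W) bs ! i \<noteq> None \<and> restr (h W) bs ! i = restr (h W) bs ! j"
      unfolding eq_atoms_def by blast
    then obtain b where "restr (h W) bs ! i = Some b" "restr (h W) bs ! j = Some b" by force
    then have "bs ! i = Some b" "bs ! j = Some b" using ij h(1) by (simp_all add: restr_nth_Some)
    then show "(i, j) \<in> eq_atoms bs" using ij h(1) by (simp add: eq_atoms_def)
  qed
  show "edge_atoms H as \<subseteq> edge_atoms K bs"
  proof
    fix I assume "I \<in> edge_atoms H as"
    then obtain e where I: "I \<subseteq> {..<length as}" "e \<in> edges H" "(!) as ` I = Some ` e" by (auto simp: edge_atoms_def)
    have ex: "\<exists>a\<in>e. as ! i = Some a" if "i \<in> I" for i using I(3) that by blast
    obtain x where x: "x \<in> e" using ne I(2) by blast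
    then obtain i where i: "i \<in> I" "as ! i = Some x" using I(3) by (metis imageE imageI)
    then have "Some x \<in> set as" using I(1) by (metis lessThan_iff nth_mem subsetD)
    then obtain W where W: "W \<in> Q" "x \<in> W" using h(3) by blast
    have "closed_in H W" using P W(1) h(2) unfolding closed_partition_def by blast
    then have eW: "e \<subseteq> W" using I(2) x W(2) unfolding closed_in_def by blast
    have "restr W as ! j = as ! j" if j: "j \<in> I" for j
    proof -
      obtain a where "a \<in> e" "as ! j = Some a" using ex[OF j] by blast
      then show ?thesis using restr_nth_Some[of j as W a] eW I(1) j by auto
    qed
    then have "(!) (restr W as) ` I = Some ` e" unfolding I(3)[symmetric] by (rule image_cong[OF refl])
    then have "I \<in> edge_atoms (induced H W) (restr W as)"
      unfolding edge_atoms_def using I(1,2) eW by auto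
    then have "I \<in> edge_atoms (induced K (h W)) (restr (h W) bs)" using at(2)[OF W(1)] by simp
    then obtain e' where e': "e' \<in> edges K" "(!) (restr (h W) bs) ` I = Some ` e'" by (auto simp: edge_atoms_def)
    have "bs ! j = restr (h W) bs ! j" if j: "j \<in> I" for j
    proof -
      obtain b where "restr (h W) bs ! j = Some b" using e'(2) j by blast
      then show ?thesis using restr_nth_Some[of j bs "h W" b] I(1) h(1) j by auto
    qed
    then have "(!) bs ` I = Some ` e'" unfolding e'(2)[symmetric] by (rule image_cong[OF refl])
    then show "I \<in> edge_atoms K bs" unfolding edge_atoms_def using I(1) e'(1) h(1) by auto
  qed
qed

text \<open>A Feferman-Vaught composition: the rank-\<open>k\<close> types of the blocks, with
  multiplicities counted up to \<open>k\<close>, determine the rank-\<open>k\<close> type of the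
  whole.\<close>

lemma matched_tp:
  assumes fin: "finite (verts H)" "finite (verts K)" "finite P" "finite P'"
    and P: "closed_partition H P" "closed_partition K P'"
    and ne: "\<forall>e\<in>edges H. e \<noteq> {}" "\<forall>e\<in>edges K. e \<noteq> {}"
  shows "matched k H P as K P' bs \<Longrightarrow> tp k H as = tp k K bs"
proof (induction k arbitrary: as bs)
  case 0
  then show ?case unfolding tp_0_iff
    using matched_0_atoms[OF 0 P(1) ne(1)] matched_0_atoms[OF matched_sym[OF 0] P(2) ne(2)] by blast
next
  case (Suc k)
  note m = Suc.prems
  show ?case unfolding tp_Suc_iff[OF fin(1,2)]
  proof (intro conjI ballI)
    show "tp k H as = tp k K bs" by (rule Suc.IH[OF matched_None(1)[OF m fin(3,4)]])
    show "tp k H (None # as) = tp k K (None # bs)" by (rule Suc.IH[OF matched_None(2)[OF m fin(3,4)]])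
    show "\<exists>b\<in>verts K. tp k H (Some a # as) = tp k K (Some b # bs)" if "a \<in> verts H" for a
      using matched_forth[OF m fin P that] Suc.IH by blast
    show "\<exists>a\<in>verts H. tp k K (Some b # bs) = tp k H (Some a # as)" if b: "b \<in> verts K" for b
      using matched_forth[OF matched_sym[OF m] fin(2,1,4,3) P(2,1) b] Suc.IH matched_sym by metis
  qed
qed

section \<open>The first order theory is determined by the fragment\<close>

definition tree_blocks :: "nat \<Rightarrow> 'a hypergraph \<Rightarrow> 'a set set" where
  "tree_blocks d H = {W. closed_in H W \<and> is_tree d (induced H W)}"

lemma unicycle_not_tree: "is_tree d H \<Longrightarrow> \<not> unicycle d H"
  by (simp add: is_tree_def unicycle_def)

lemma tree_block_disjoint_frag:
  assumes W: "W \<in> tree_blocks d H"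
  shows "W \<inter> frag_verts d H = {}"
proof (rule ccontr)
  assume "W \<inter> frag_verts d H \<noteq> {}"
  then obtain x U where x: "x \<in> W" "x \<in> U" "closed_in H U" "unicycle d (induced H U)"
    unfolding frag_verts_def by blast
  have W': "closed_in H W" "is_tree d (induced H W)" using W by (auto simp: tree_blocks_def)
  have "W = linked H `` {x}" using W' x by (intro connected_closed_eq_link_class) (simp_all add: is_tree_def)
  moreover have "U = linked H `` {x}" using x by (intro connected_closed_eq_link_class) (simp_all add: unicycle_def)
  ultimately show False using unicycle_not_tree[OF W'(2)] x(4) by simp
qed

lemma tree_block_ne: "W \<in> tree_blocks d H \<Longrightarrow> W \<noteq> {}"
  by (auto simp: tree_blocks_def is_tree_def connected_hypergraph_def)

lemma frag_not_tree_block: "frag_verts d H \<notin> tree_blocks d H"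
  using tree_block_disjoint_frag[of "frag_verts d H" d H] tree_block_ne[of "frag_verts d H" d H] by blast

text \<open>In the absence of positive excess every component is a unicycle, inside the fragment, or
  a tree. The fragment is kept as one block because it will be matched as a whole, by an
  isomorphism.\<close>

lemma closed_partition_blocks:
  assumes H: "uniform_hypergraph d H" and nc: "\<not> complex_component d H"
  shows "closed_partition H (insert (frag_verts d H) (tree_blocks d H))"
  unfolding closed_partition_def
proof (intro conjI)
  show "\<forall>W\<in>insert (frag_verts d H) (tree_blocks d H). closed_in H W"
    using closed_in_frag_verts[of H d] by (simp add: tree_blocks_def)
  then have sub: "\<Union>(insert (frag_verts d H) (tree_blocks d H)) \<subseteq> verts H"
    unfolding closed_in_def by blast
  show "\<Union>(insert (frag_verts d H) (tree_blocks d H)) = verts H"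
  proof (rule equalityI[OF sub subsetI])
    fix x assume x: "x \<in> verts H"
    let ?U = "linked H `` {x}"
    have "x \<in> ?U" using x by (simp add: linked_adj)
    note U = closed_in_link_class[OF uniform_wf[OF H], of x] connected_link_class[OF uniform_wf[OF H] x] this
    have u: "uniform_hypergraph d (induced H ?U)"
      using U(1) by (intro uniform_induced[OF H]) (simp add: closed_in_def)
    have "\<not> excess d (induced H ?U) > 0" using nc U(1,2) unfolding complex_component_def by blast
    then consider "excess d (induced H ?U) = 0" | "excess d (induced H ?U) < 0" by linarith
    then show "x \<in> \<Union>(insert (frag_verts d H) (tree_blocks d H))"
    proof cases
      case 1
      then have "unicycle d (induced H ?U)" using U u by (simp add: unicycle_def)
      then have "x \<in> frag_verts d H" unfolding frag_verts_def using U by blast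
      then show ?thesis by simp
    next
      case 2
      then have "?U \<in> tree_blocks d H" using U u unfolding tree_blocks_def is_tree_def by simp
      then show ?thesis using U(3) by blast
    qed
  qed
  have "W \<inter> U = {}" if WU: "W \<in> tree_blocks d H" "U \<in> tree_blocks d H" "W \<noteq> U" for W U
  proof (rule ccontr)
    assume "W \<inter> U \<noteq> {}"
    then obtain x where x: "x \<in> W" "x \<in> U" by blast
    have "W = linked H `` {x}" using WU(1) x
      by (intro connected_closed_eq_link_class) (simp_all add: tree_blocks_def is_tree_def)
    moreover have "U = linked H `` {x}" using WU(2) x
      by (intro connected_closed_eq_link_class) (simp_all add: tree_blocks_def is_tree_def)
    ultimately show False using WU(3) by simp
  qed
  then show "disjoint (insert (frag_verts d H) (tree_blocks d H))"
    using tree_block_disjoint_frag[of _ d H] unfolding disjoint_def by (simp add: Int_commute)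
qed

lemma iso_via_is_tree:
  assumes "iso_via f H K" "is_tree d H"
  shows "is_tree d K"
  using assms iso_via_uniform[of d H f K] iso_via_connected[of f H K] iso_via_card_verts[of f H K]
    iso_via_card_edges[of H f K] uniform_wf[of d H]
  by (simp add: is_tree_def excess_def)

text \<open>\<open>k\<close> copies suffice because a game of \<open>k\<close> rounds touches at
  most \<open>k\<close> tree blocks.\<close>

definition tree_rich :: "nat \<Rightarrow> nat \<Rightarrow> nat hypergraph set \<Rightarrow> nat hypergraph \<Rightarrow> bool" where
  "tree_rich d k \<T> H \<longleftrightarrow> \<not> complex_component d H \<and> (\<forall>T\<in>\<T>. k \<le> card (comp_copies {K. T \<simeq>\<^sub>H K} H))"

text \<open>There are infinitely many trees but finitely many types of rank \<open>k\<close>. One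
  tree for each type is enough, so only finitely many events of vanishing probability have to be
  excluded.\<close>

lemma tree_representatives:
  "\<exists>\<T> :: nat hypergraph set. finite \<T> \<and> (\<forall>T\<in>\<T>. is_tree d T) \<and>
    (\<forall>T :: nat hypergraph. is_tree d T \<longrightarrow> (\<exists>T'\<in>\<T>. tp k T' [] = tp k T []))"
proof -
  let ?f = "\<lambda>T :: nat hypergraph. tp k T []"
  have "?f ` {T :: nat hypergraph. is_tree d T} \<subseteq> {tp k H as |(H :: nat hypergraph) as. length as = 0}" by auto
  then have "finite (?f ` {T :: nat hypergraph. is_tree d T})" by (rule finite_subset[OF _ finite_types])
  from finite_subset_image[OF this order_refl] obtain \<T> where
    T: "\<T> \<subseteq> {T :: nat hypergraph. is_tree d T}" "finite \<T>" "?f ` {T :: nat hypergraph. is_tree d T} = ?f ` \<T>" by blast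
  have "\<exists>T'\<in>\<T>. tp k T' [] = tp k T []" if "is_tree d T" for T :: "nat hypergraph"
  proof -
    have "?f T \<in> ?f ` \<T>" unfolding T(3)[symmetric] using that by simp
    then show ?thesis by force
  qed
  then show ?thesis using T(1,2) by blast
qed

lemma plentiful_tree_blocks:
  fixes H K :: "nat hypergraph"
  assumes K: "finite (verts K)" and \<T>: "\<forall>T\<in>\<T>. is_tree d T"
      "\<forall>T :: nat hypergraph. is_tree d T \<longrightarrow> (\<exists>T'\<in>\<T>. tp k T' [] = tp k T [])"
    and r: "\<forall>T\<in>\<T>. k \<le> card (comp_copies {K. T \<simeq>\<^sub>H K} K)"
  shows "plentiful k 0 H (tree_blocks d H) K (tree_blocks d K)"
  unfolding plentiful_def
proof
  fix W assume "W \<in> tree_blocks d H"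
  then have "is_tree d (induced H W)" by (simp add: tree_blocks_def)
  then obtain T where T: "T \<in> \<T>" "tp k T [] = tp k (induced H W) []" using \<T>(2) by blast
  let ?S = "{W' \<in> tree_blocks d K. tp k (induced K W') (replicate 0 None) = tp k (induced H W) (replicate 0 None)}"
  have tT: "is_tree d T" using T(1) \<T>(1) by blast
  have "comp_copies {K. T \<simeq>\<^sub>H K} K \<subseteq> ?S"
  proof
    fix W' assume "W' \<in> comp_copies {K. T \<simeq>\<^sub>H K} K"
    then have W': "closed_in K W'" "T \<simeq>\<^sub>H induced K W'" by (auto simp: comp_copies_def)
    then obtain f where f: "iso_via f T (induced K W')" unfolding iso_hypergraph_iff by blast
    have "uniform_hypergraph d T" using tT by (simp add: is_tree_def)
    from tp_iso[OF f uniform_wf[OF this], of "[]" k] have "tp k (induced K W') [] = tp k T []" by simp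
    then show "W' \<in> ?S" using T(2) W'(1) iso_via_is_tree[OF f tT] by (simp add: tree_blocks_def)
  qed
  moreover have "finite ?S"
    by (rule finite_subset[of _ "Pow (verts K)"]) (auto simp: tree_blocks_def closed_in_def K)
  ultimately have "card (comp_copies {K. T \<simeq>\<^sub>H K} K) \<le> card ?S" by (intro card_mono)
  then show "k \<le> card ?S" using r T(1) by (meson order_trans)
qed

lemma tree_rich_tp:
  fixes H K :: "nat hypergraph"
  assumes H: "uniform_hypergraph d H" "tree_rich d k \<T> H" and K: "uniform_hypergraph d K" "tree_rich d k \<T> K"
    and d: "d \<ge> 1" and \<T>: "\<forall>T\<in>\<T>. is_tree d T"
      "\<forall>T :: nat hypergraph. is_tree d T \<longrightarrow> (\<exists>T'\<in>\<T>. tp k T' [] = tp k T [])"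
    and iso: "Frag d H \<simeq>\<^sub>H Frag d K"
  shows "tp k H [] = tp k K []"
proof -
  let ?P = "\<lambda>H :: nat hypergraph. insert (frag_verts d H) (tree_blocks d H)"
  have fin: "finite (verts H)" "finite (verts K)" using H K by (auto simp: uniform_hypergraph_def)
  have finP: "finite (?P H)" if "finite (verts H)" for H
    by (rule finite_subset[of _ "Pow (verts H)"])
      (use that closed_in_frag_verts[of H d] in \<open>auto simp: tree_blocks_def closed_in_def\<close>)
  have P: "closed_partition H (?P H)" "closed_partition K (?P K)"
    using closed_partition_blocks[OF H(1)] closed_partition_blocks[OF K(1)] H(2) K(2)
    by (simp_all add: tree_rich_def)
  have R: "?P H - {frag_verts d H} = tree_blocks d H" for H using frag_not_tree_block[of d H] by blast
  obtain f where f: "iso_via f (induced H (frag_verts d H)) (induced K (frag_verts d K))"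
    using iso unfolding Frag_eq[OF H(1) d] Frag_eq[OF K(1) d] iso_hypergraph_iff by blast
  have wf: "wf_hypergraph (induced H (frag_verts d H))" by simp
  from tp_iso[OF f wf, of "[]" k]
  have t: "tp k (induced H (frag_verts d H)) [] = tp k (induced K (frag_verts d K)) []" by simp
  have pl: "plentiful k 0 H (tree_blocks d H) K (tree_blocks d K)"
    "plentiful k 0 K (tree_blocks d K) H (tree_blocks d H)"
    using plentiful_tree_blocks[OF fin(2) \<T>] plentiful_tree_blocks[OF fin(1) \<T>] H(2) K(2)
    by (simp_all add: tree_rich_def)
  \<comment> \<open>Initial position of the game: the fragments are partners, and all tree blocks
    are untouched.\<close>
  have "matched k H (?P H) [] K (?P K) []"
    unfolding matched_def
    by (intro conjI exI[of _ "{frag_verts d H}"] exI[of _ "{frag_verts d K}"] exI[of _ "\<lambda>_. frag_verts d K"])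
      (use t pl in \<open>simp_all only: R length_map list.size, simp_all add: restr_def bij_betw_def\<close>)
  then show ?thesis
    by (rule matched_tp[OF fin finP[OF fin(1)] finP[OF fin(2)] P
          uniform_edges_ne[OF H(1) d] uniform_edges_ne[OF K(1) d]])
qed

section \<open>Limits of the probabilities of sentences\<close>

context subcritical
begin

lemma prob_not_tree_rich:
  assumes "finite \<T>" "\<forall>T\<in>\<T>. is_tree d T"
  shows "(\<lambda>n. prob_of n (\<lambda>H. \<not> tree_rich d k \<T> H)) \<longlonglongrightarrow> 0"
proof (rule tendsto_sandwich)
  let ?few = "\<lambda>T H. card (comp_copies {K. T \<simeq>\<^sub>H K} H) < k"
  show "\<forall>\<^sub>F n in sequentially. 0 \<le> prob_of n (\<lambda>H. \<not> tree_rich d k \<T> H)"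
    using edge_prob_le_1 by eventually_elim (simp add: prob_of_nonneg)
  show "\<forall>\<^sub>F n in sequentially. prob_of n (\<lambda>H. \<not> tree_rich d k \<T> H) \<le>
      prob_of n (complex_component d) + (\<Sum>T\<in>\<T>. prob_of n (?few T))"
    using edge_prob_le_1
  proof eventually_elim
    case (elim n)
    then have n: "edge_prob n \<le> 1" by simp
    have "prob_of n (\<lambda>H. \<not> tree_rich d k \<T> H) = prob_of n (\<lambda>H. complex_component d H \<or> (\<exists>T\<in>\<T>. ?few T H))"
      unfolding tree_rich_def by (simp add: not_le)
    also have "\<dots> \<le> prob_of n (complex_component d) + prob_of n (\<lambda>H. \<exists>T\<in>\<T>. ?few T H)"
      unfolding prob_of_def by (rule Pr_union[OF edge_prob_nonneg n])
    also have "prob_of n (\<lambda>H. \<exists>T\<in>\<T>. ?few T H) \<le> (\<Sum>T\<in>\<T>. prob_of n (?few T))"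
      unfolding prob_of_def by (rule Pr_Bex[OF edge_prob_nonneg n assms(1)])
    finally show ?case by simp
  qed
  have "(\<lambda>n. prob_of n (complex_component d) + (\<Sum>T\<in>\<T>. prob_of n (?few T))) \<longlonglongrightarrow> 0 + (\<Sum>T\<in>\<T>. 0)"
    using assms(2) by (intro tendsto_add tendsto_sum prob_complex_component prob_tree_few) blast
  then show "(\<lambda>n. prob_of n (complex_component d) + (\<Sum>T\<in>\<T>. prob_of n (?few T))) \<longlonglongrightarrow> 0" by simp
qed simp

lemma fo_prob_law:
  assumes \<phi>: "fo_sentence d \<phi>"
  shows "\<exists>T\<subseteq>unicyclic_family d. fo_prob d c \<phi> \<longlonglongrightarrow> infsum (p_lim d c) T"
proof -
  define k where "k = qrank \<phi>"
  obtain \<T> :: "nat hypergraph set" where \<T>: "finite \<T>" "\<forall>T\<in>\<T>. is_tree d T"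
    "\<forall>T :: nat hypergraph. is_tree d T \<longrightarrow> (\<exists>T'\<in>\<T>. tp k T' [] = tp k T [])"
    using tree_representatives[of d k] by blast
  define good where "good H \<longleftrightarrow> uniform_hypergraph d H \<and> tree_rich d k \<T> H" for H :: "nat hypergraph"
  \<comment> \<open>The classes that occur as fragment of some good model of \<phi>. By
    \<open>same\<close> below, it does not matter which good hypergraph with this fragment is
    taken.\<close>
  define T where "T = {C \<in> unicyclic_family d. \<exists>H\<in>Collect good. Frag d H \<in> C \<and> H \<Turnstile>\<^sub>H \<phi>}"
  have TU: "T \<subseteq> unicyclic_family d" by (auto simp: T_def)
  have same: "H \<Turnstile>\<^sub>H \<phi> \<longleftrightarrow> K \<Turnstile>\<^sub>H \<phi>" if "good H" "good K" "Frag d H \<simeq>\<^sub>H Frag d K" for H K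
  proof -
    have HK: "uniform_hypergraph d H" "tree_rich d k \<T> H" "uniform_hypergraph d K" "tree_rich d k \<T> K"
      using that by (auto simp: good_def)
    have t: "tp k H [] = tp k K []" by (rule tree_rich_tp[OF HK d1 \<T>(2,3) that(3)])
    have fin: "finite (verts H)" "finite (verts K)" using HK by (auto simp: uniform_hypergraph_def)
    have "sat H (\<lambda>_. 0) \<phi> \<longleftrightarrow> sat K (\<lambda>_. 0) \<phi>"
      by (rule tp_sat[OF fin t]) (use \<phi> in \<open>simp_all add: k_def fo_sentence_def\<close>)
    then show ?thesis using models_iff_sat[OF \<phi>] by metis
  qed
  have iff: "({1..n}, E) \<Turnstile>\<^sub>H \<phi> \<longleftrightarrow> Frag d ({1..n}, E) \<in> \<Union>T"
    if E: "E \<subseteq> dsets d {1..n}" "tree_rich d k \<T> ({1..n}, E)" for n E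
  proof -
    let ?H = "({1..n}, E)"
    have g: "good ?H" using uniform_dsets[OF _ E(1)] E(2) by (simp add: good_def)
    show ?thesis
    proof
      assume m: "?H \<Turnstile>\<^sub>H \<phi>"
      obtain C where "C \<in> unicyclic_family d" "Frag d ?H \<in> C" using Frag_class[OF E(1)] by blast
      then show "Frag d ?H \<in> \<Union>T" unfolding T_def using g m by blast
    next
      assume "Frag d ?H \<in> \<Union>T"
      then obtain C K where C: "C \<in> unicyclic_family d" "Frag d ?H \<in> C" "good K" "Frag d K \<in> C" "K \<Turnstile>\<^sub>H \<phi>"
        unfolding T_def by blast
      have "Frag d ?H \<simeq>\<^sub>H Frag d K" using C(4) unfolding family_class_eq[OF C(1,2)] by simp
      then show "?H \<Turnstile>\<^sub>H \<phi>" using same[OF g C(3)] C(5) by simp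
    qed
  qed
  have "(\<lambda>n. prob_of n (\<lambda>H. H \<Turnstile>\<^sub>H \<phi>) - prob_of n (\<lambda>H. Frag d H \<in> \<Union>T)) \<longlonglongrightarrow> 0"
  proof (rule Lim_null_comparison[OF _ prob_not_tree_rich[OF \<T>(1,2), of k]])
    show "\<forall>\<^sub>F n in sequentially. norm (prob_of n (\<lambda>H. H \<Turnstile>\<^sub>H \<phi>) - prob_of n (\<lambda>H. Frag d H \<in> \<Union>T)) \<le>
        prob_of n (\<lambda>H. \<not> tree_rich d k \<T> H)"
      using edge_prob_le_1
    proof eventually_elim
      case (elim n)
      show ?case unfolding real_norm_def
        by (rule prob_of_abs_diff) (use elim iff in blast)+
    qed
  qed
  then have "(\<lambda>n. prob_of n (\<lambda>H. H \<Turnstile>\<^sub>H \<phi>)) \<longlonglongrightarrow> infsum (p_lim d c) T"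
    by (rule Lim_transform[OF Frag_law[OF TU]])
  moreover have "\<forall>\<^sub>F n in sequentially. fo_prob d c \<phi> n = prob_of n (\<lambda>H. H \<Turnstile>\<^sub>H \<phi>)"
    using edge_prob_le_1 by eventually_elim (simp add: fo_prob_def prob_G)
  ultimately have "fo_prob d c \<phi> \<longlonglongrightarrow> infsum (p_lim d c) T" by (simp add: tendsto_cong)
  then show ?thesis using TU by blast
qed

end

section \<open>Describing a union of components by a sentence\<close>

text \<open>A tautology without free variables, so that the empty conjunction is a sentence; it
  holds also when there are no vertices.\<close>

definition truth :: fo where
  "truth = Neg (Conj (Neg (Ex 0 (Eq 0 0))) (Ex 0 (Eq 0 0)))"

definition conj_of :: "fo set \<Rightarrow> fo" where
  "conj_of A = foldr Conj (SOME xs. set xs = A) truth"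

definition disj_of :: "fo set \<Rightarrow> fo" where
  "disj_of A = Neg (conj_of (Neg ` A))"

lemma foldr_Conj:
  "sat H \<sigma> (foldr Conj xs truth) \<longleftrightarrow> (\<forall>\<phi>\<in>set xs. sat H \<sigma> \<phi>)"
  "fo_formula d (foldr Conj xs truth) \<longleftrightarrow> (\<forall>\<phi>\<in>set xs. fo_formula d \<phi>)"
  "free_vars (foldr Conj xs truth) = (\<Union>\<phi>\<in>set xs. free_vars \<phi>)"
  by (induction xs) (auto simp: truth_def)

lemma conj_of:
  assumes "finite A"
  shows "sat H \<sigma> (conj_of A) \<longleftrightarrow> (\<forall>\<phi>\<in>A. sat H \<sigma> \<phi>)"
    "fo_formula d (conj_of A) \<longleftrightarrow> (\<forall>\<phi>\<in>A. fo_formula d \<phi>)"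
    "free_vars (conj_of A) = (\<Union>\<phi>\<in>A. free_vars \<phi>)"
proof -
  have "set (SOME xs. set xs = A) = A" using someI_ex[OF finite_list[OF assms]] .
  then show "sat H \<sigma> (conj_of A) \<longleftrightarrow> (\<forall>\<phi>\<in>A. sat H \<sigma> \<phi>)"
    "fo_formula d (conj_of A) \<longleftrightarrow> (\<forall>\<phi>\<in>A. fo_formula d \<phi>)"
    "free_vars (conj_of A) = (\<Union>\<phi>\<in>A. free_vars \<phi>)"
    unfolding conj_of_def by (simp_all add: foldr_Conj)
qed

lemma disj_of:
  assumes "finite A"
  shows "sat H \<sigma> (disj_of A) \<longleftrightarrow> (\<exists>\<phi>\<in>A. sat H \<sigma> \<phi>)"
    "fo_formula d (disj_of A) \<longleftrightarrow> (\<forall>\<phi>\<in>A. fo_formula d \<phi>)"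
    "free_vars (disj_of A) = (\<Union>\<phi>\<in>A. free_vars \<phi>)"
  unfolding disj_of_def
  using conj_of(1)[of "Neg ` A" H \<sigma>] conj_of(2,3)[of "Neg ` A"] assms by simp_all

primrec exs :: "nat list \<Rightarrow> fo \<Rightarrow> fo" where
  "exs [] \<phi> = \<phi>"
| "exs (x # xs) \<phi> = Ex x (exs xs \<phi>)"

lemma exs_formula [simp]: "fo_formula d (exs xs \<phi>) \<longleftrightarrow> fo_formula d \<phi>"
  by (induction xs) auto

lemma exs_free_vars [simp]: "free_vars (exs xs \<phi>) = free_vars \<phi> - set xs"
  by (induction xs) auto

lemma sat_exs:
  "distinct xs \<Longrightarrow> sat H \<sigma> (exs xs \<phi>) \<longleftrightarrow>
    (\<exists>\<tau>. (\<forall>x\<in>set xs. \<tau> x \<in> verts H) \<and> (\<forall>x. x \<notin> set xs \<longrightarrow> \<tau> x = \<sigma> x) \<and> sat H \<tau> \<phi>)"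
proof (induction xs arbitrary: \<sigma>)
  case Nil
  have "(\<forall>x. \<tau> x = \<sigma> x) \<longleftrightarrow> \<tau> = \<sigma>" for \<tau> :: "nat \<Rightarrow> 'a" by (simp add: fun_eq_iff)
  then show ?case by simp
next
  case (Cons x xs)
  then have IH: "sat H \<rho> (exs xs \<phi>) \<longleftrightarrow>
      (\<exists>\<tau>. (\<forall>y\<in>set xs. \<tau> y \<in> verts H) \<and> (\<forall>y. y \<notin> set xs \<longrightarrow> \<tau> y = \<rho> y) \<and> sat H \<tau> \<phi>)" for \<rho> by simp
  have x: "x \<notin> set xs" using Cons.prems by simp
  show ?case
  proof
    assume "sat H \<sigma> (exs (x # xs) \<phi>)"
    then obtain a \<tau> where a: "a \<in> verts H" and t: "\<forall>y\<in>set xs. \<tau> y \<in> verts H"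
      "\<forall>y. y \<notin> set xs \<longrightarrow> \<tau> y = (\<sigma>(x := a)) y" "sat H \<tau> \<phi>" by (auto simp only: exs.simps sat.simps IH)
    show "\<exists>\<tau>. (\<forall>y\<in>set (x # xs). \<tau> y \<in> verts H) \<and> (\<forall>y. y \<notin> set (x # xs) \<longrightarrow> \<tau> y = \<sigma> y) \<and> sat H \<tau> \<phi>"
      by (rule exI[of _ \<tau>]) (use a t x in auto)
  next
    assume "\<exists>\<tau>. (\<forall>y\<in>set (x # xs). \<tau> y \<in> verts H) \<and> (\<forall>y. y \<notin> set (x # xs) \<longrightarrow> \<tau> y = \<sigma> y) \<and> sat H \<tau> \<phi>"
    then obtain \<tau> where t: "\<tau> x \<in> verts H" "\<forall>y\<in>set xs. \<tau> y \<in> verts H"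
      "\<forall>y. y \<notin> set (x # xs) \<longrightarrow> \<tau> y = \<sigma> y" "sat H \<tau> \<phi>" by auto
    have "\<forall>y. y \<notin> set xs \<longrightarrow> \<tau> y = (\<sigma>(x := \<tau> x)) y" using t(3) by auto
    then have "sat H (\<sigma>(x := \<tau> x)) (exs xs \<phi>)" unfolding IH using t by blast
    then show "sat H \<sigma> (exs (x # xs) \<phi>)" using t(1) by auto
  qed
qed

text \<open>All orders are listed because in \<open>stray_edge\<close> the vertices of an edge are
  enumerated in an arbitrary order.\<close>

definition edge_lists :: "nat set set \<Rightarrow> nat list set" where
  "edge_lists F = {l. distinct l \<and> set l \<in> F}"

lemma finite_edge_lists:
  assumes "F \<subseteq> dsets d {1..v}"
  shows "finite (edge_lists F)"
proof (rule finite_subset)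
  show "edge_lists F \<subseteq> {l. set l \<subseteq> {1..v} \<and> distinct l}" using assms by (auto simp: edge_lists_def dsets_def)
  show "finite {l. set l \<subseteq> {1..v} \<and> distinct l}" by (rule finite_subset_distinct) simp
qed

lemma edge_lists_props:
  assumes "F \<subseteq> dsets d {1..v}" "l \<in> edge_lists F"
  shows "distinct l" "set l \<in> F" "set l \<subseteq> {1..v}" "length l = d"
  using assms distinct_card[of l] by (auto simp: edge_lists_def dsets_def)

abbreviation edge_vars :: "nat \<Rightarrow> nat \<Rightarrow> nat list" where
  "edge_vars d v \<equiv> [Suc v..<Suc (v + d)]"

text \<open>The image of vertex \<open>i\<close> lies in an edge, enumerated by the variables \<open>Suc v, \<dots>, v + d\<close>, that is
  not the image of a member of \<open>F\<close>.\<close>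

definition stray_edge :: "nat \<Rightarrow> nat \<Rightarrow> nat set set \<Rightarrow> nat \<Rightarrow> fo" where
  "stray_edge d v F i = exs (edge_vars d v) (Conj (Edge (edge_vars d v)) (Conj (Eq (Suc v) i)
     (Neg (disj_of ((\<lambda>l. conj_of ((\<lambda>j. Eq (Suc (v + j)) (l ! j)) ` {..<d})) ` edge_lists F)))))"

lemma sat_stray_edge:
  assumes H: "uniform_hypergraph d H" and d: "d \<ge> 1" and F: "F \<subseteq> dsets d {1..v}" and i: "i \<in> {1..v}"
  shows "sat H \<sigma> (stray_edge d v F i) \<longleftrightarrow> (\<exists>e\<in>edges H. \<sigma> i \<in> e \<and> e \<notin> (`) \<sigma> ` F)"
proof -
  let ?ys = "edge_vars d v"
  have fin: "finite ((\<lambda>l. conj_of ((\<lambda>j. Eq (Suc (v + j)) (l ! j)) ` {..<d})) ` edge_lists F)"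
    using finite_edge_lists[OF F] by simp
  have body: "sat H \<tau> (Neg (disj_of ((\<lambda>l. conj_of ((\<lambda>j. Eq (Suc (v + j)) (l ! j)) ` {..<d})) ` edge_lists F))) \<longleftrightarrow>
      \<not> (\<exists>l\<in>edge_lists F. \<forall>j<d. \<tau> (Suc (v + j)) = \<tau> (l ! j))" for \<tau>
    by (auto simp add: disj_of(1)[OF fin] conj_of)
  have set_ys: "set ?ys = {Suc v..v + d}" by auto
  have nth_ys: "?ys ! j = Suc (v + j)" if "j < d" for j using that by (simp del: upt_Suc)
  have len: "length ?ys = d" by simp
  show ?thesis
  proof
    assume "sat H \<sigma> (stray_edge d v F i)"
    then obtain \<tau> where t: "\<forall>x\<in>set ?ys. \<tau> x \<in> verts H" "\<forall>x. x \<notin> set ?ys \<longrightarrow> \<tau> x = \<sigma> x"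
      "sat H \<tau> (Conj (Edge ?ys) (Conj (Eq (Suc v) i)
         (Neg (disj_of ((\<lambda>l. conj_of ((\<lambda>j. Eq (Suc (v + j)) (l ! j)) ` {..<d})) ` edge_lists F)))))"
      unfolding stray_edge_def sat_exs[OF distinct_upt] by blast
    have t': "distinct (map \<tau> ?ys)" "set (map \<tau> ?ys) \<in> edges H" "\<tau> (Suc v) = \<tau> i"
      "\<not> (\<exists>l\<in>edge_lists F. \<forall>j<d. \<tau> (Suc (v + j)) = \<tau> (l ! j))"
      using t(3) unfolding sat.simps(2,4) sat.simps(1)[of H \<tau> "Suc v" i] body by blast+
    have low: "\<tau> x = \<sigma> x" if "x \<in> {1..v}" for x using t(2) that unfolding set_ys by simp
    let ?e = "set (map \<tau> ?ys)"
    have "\<tau> (Suc v) \<in> ?e" using d by (simp add: set_ys del: set_upt upt_Suc)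
    then have 1: "\<sigma> i \<in> ?e" using t'(3) low[OF i] by simp
    \<comment> \<open>If the enumerated edge were the image of \<open>g\<close>, its enumeration
      could be pulled back to an ordering of \<open>g\<close>, a member of
      \<open>edge_lists F\<close> that the formula forbids.\<close>
    have "?e \<notin> (`) \<sigma> ` F"
    proof
      assume "?e \<in> (`) \<sigma> ` F"
      then obtain g where g: "g \<in> F" "?e = \<sigma> ` g" by blast
      have gV: "g \<subseteq> {1..v}" "card g = d" "finite g"
        using g(1) F finite_subset[of g "{1..v}"] by (auto simp: dsets_def)
      have "\<forall>j<d. \<exists>x\<in>g. \<tau> (Suc (v + j)) = \<sigma> x"
      proof (intro allI impI)
        fix j assume j: "j < d"
        have "map \<tau> ?ys ! j \<in> ?e" by (rule nth_mem) (use j in simp)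
        then have "\<tau> (Suc (v + j)) \<in> \<sigma> ` g" using g(2) j nth_ys[OF j] len by (simp only: nth_map length_map)
        then show "\<exists>x\<in>g. \<tau> (Suc (v + j)) = \<sigma> x" by blast
      qed
      then obtain f where f: "\<forall>j<d. f j \<in> g \<and> \<tau> (Suc (v + j)) = \<sigma> (f j)" by metis
      let ?l = "map f [0..<d]"
      have "map \<sigma> ?l = map \<tau> ?ys"
        by (rule nth_equalityI) (use f in \<open>auto simp del: upt_Suc\<close>)
      then have "distinct (map \<sigma> ?l)" using t'(1) by simp
      then have dl: "distinct ?l" using distinct_map[of \<sigma> ?l] by blast
      have "set ?l \<subseteq> g" using f by auto
      moreover have "card (set ?l) = d" using distinct_card[OF dl] by simp
      ultimately have "set ?l = g" using gV by (intro card_subset_eq) auto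
      then have "?l \<in> edge_lists F" using dl g(1) by (simp add: edge_lists_def)
      moreover have "\<forall>j<d. \<tau> (Suc (v + j)) = \<tau> (?l ! j)"
        using f low gV(1) by auto
      ultimately show False using t'(4) by blast
    qed
    then show "\<exists>e\<in>edges H. \<sigma> i \<in> e \<and> e \<notin> (`) \<sigma> ` F" using 1 t'(2) by blast
  next
    assume "\<exists>e\<in>edges H. \<sigma> i \<in> e \<and> e \<notin> (`) \<sigma> ` F"
    then obtain e where e: "e \<in> edges H" "\<sigma> i \<in> e" "e \<notin> (`) \<sigma> ` F" by blast
    have eV: "e \<subseteq> verts H" "card e = d" "finite e"
      using H e(1) finite_subset[of e "verts H"] by (auto simp: uniform_hypergraph_def)
    obtain bs where bs: "set bs = e - {\<sigma> i}" "distinct bs"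
      using finite_distinct_list[of "e - {\<sigma> i}"] eV(3) by auto
    \<comment> \<open>The formula wants the image of \<open>i\<close> to be the first vertex
      listed.\<close>
    define as where "as = \<sigma> i # bs"
    have as: "distinct as" "set as = e" "as ! 0 = \<sigma> i" using bs e(2) by (auto simp: as_def)
    then have las: "length as = d" using distinct_card[of as] eV(2) by simp
    define \<tau> where "\<tau> x = (if x \<in> set ?ys then as ! (x - Suc v) else \<sigma> x)" for x
    have ty: "\<tau> (Suc (v + j)) = as ! j" if "j < d" for j using that by (simp add: \<tau>_def del: upt_Suc)
    have low: "\<tau> x = \<sigma> x" if "x \<in> {1..v}" for x using that by (simp add: \<tau>_def del: upt_Suc)
    have mp: "map \<tau> ?ys = as"
      by (rule nth_equalityI) (use las ty in \<open>simp_all add: nth_append del: upt_Suc\<close>)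
    have "\<not> (\<exists>l\<in>edge_lists F. \<forall>j<d. \<tau> (Suc (v + j)) = \<tau> (l ! j))"
    proof
      assume "\<exists>l\<in>edge_lists F. \<forall>j<d. \<tau> (Suc (v + j)) = \<tau> (l ! j)"
      then obtain l where l: "l \<in> edge_lists F" "\<forall>j<d. \<tau> (Suc (v + j)) = \<tau> (l ! j)" by blast
      note lp = edge_lists_props[OF F l(1)]
      have "as = map \<sigma> l"
      proof (rule nth_equalityI)
        show "length as = length (map \<sigma> l)" using las lp(4) by simp
        fix j assume "j < length as"
        then have j: "j < d" using las by simp
        then have "l ! j \<in> set l" using lp(4) by simp
        then have "l ! j \<in> {1..v}" using lp(3) by blast
        then show "as ! j = map \<sigma> l ! j" using l(2) j ty[OF j] low lp(4) by simp
      qed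
      then have "e = \<sigma> ` set l" using as(2) by simp
      then show False using e(3) lp(2) by blast
    qed
    moreover have "\<tau> (Suc v) = \<tau> i" using ty[of 0] d as(3) low[OF i] by simp
    ultimately have "sat H \<tau> (Conj (Edge ?ys) (Conj (Eq (Suc v) i)
         (Neg (disj_of ((\<lambda>l. conj_of ((\<lambda>j. Eq (Suc (v + j)) (l ! j)) ` {..<d})) ` edge_lists F)))))"
      unfolding sat.simps(2,4) sat.simps(1)[of H \<tau> "Suc v" i] body mp using as(1,2) e(1) by simp
    moreover have "\<forall>x\<in>set ?ys. \<tau> x \<in> verts H"
    proof
      fix x assume "x \<in> set ?ys"
      then have "\<tau> x \<in> set (map \<tau> ?ys)" by (simp only: set_map imageI)
      then show "\<tau> x \<in> verts H" unfolding mp using as(2) eV(1) by blast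
    qed
    moreover have "\<forall>x. x \<notin> set ?ys \<longrightarrow> \<tau> x = \<sigma> x" by (simp add: \<tau>_def del: set_upt upt_Suc)
    ultimately show "sat H \<sigma> (stray_edge d v F i)"
      unfolding stray_edge_def sat_exs[OF distinct_upt] by blast
  qed
qed

text \<open>Excluding stray edges does double duty: it makes the image closed, and it forbids
  further edges inside the image, so that the copy is induced.\<close>

definition contains_body :: "nat \<Rightarrow> nat \<Rightarrow> nat set set \<Rightarrow> fo" where
  "contains_body d v F = conj_of (
     (\<lambda>(i, j). Neg (Eq i j)) ` {(i, j) \<in> {1..v} \<times> {1..v}. i \<noteq> j} \<union> Edge ` edge_lists F \<union>
     (\<lambda>i. Neg (stray_edge d v F i)) ` {1..v})"

definition contains :: "nat \<Rightarrow> nat \<Rightarrow> nat set set \<Rightarrow> fo" where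
  "contains d v F = exs [1..<Suc v] (contains_body d v F)"

lemma finite_contains:
  assumes "F \<subseteq> dsets d {1..v}"
  shows "finite ((\<lambda>(i, j). Neg (Eq i j)) ` {(i, j) \<in> {1..v} \<times> {1..v}. i \<noteq> j} \<union> Edge ` edge_lists F \<union>
     (\<lambda>i. Neg (stray_edge d v F i)) ` {1..v})"
proof (intro finite_UnI finite_imageI finite_edge_lists[OF assms])
  show "finite {(i, j) \<in> {1..v} \<times> {1..v}. i \<noteq> j}"
    by (rule finite_subset[of _ "{1..v} \<times> {1..v}"]) auto
qed simp

lemma contains_sentence:
  assumes d: "d \<ge> 1" and F: "F \<subseteq> dsets d {1..v}"
  shows "fo_sentence d (contains d v F)"
proof -
  have fin: "finite ((\<lambda>l. conj_of ((\<lambda>j. Eq (Suc (v + j)) (l ! j)) ` {..<d})) ` edge_lists F)"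
    using finite_edge_lists[OF F] by simp
  have 1: "fo_formula d (stray_edge d v F i)" for i
    unfolding stray_edge_def by (simp add: disj_of(2)[OF fin] conj_of)
  have "free_vars (disj_of ((\<lambda>l. conj_of ((\<lambda>j. Eq (Suc (v + j)) (l ! j)) ` {..<d})) ` edge_lists F)) \<subseteq>
      {1..v} \<union> set (edge_vars d v)"
  proof -
    have "l ! j \<in> {1..v}" if "l \<in> edge_lists F" "j < d" for l j
      using edge_lists_props[OF F that(1)] nth_mem[of j l] that(2) by blast
    then show ?thesis unfolding disj_of(3)[OF fin] by (auto simp: conj_of)
  qed
  moreover have "Suc v \<in> set (edge_vars d v)" unfolding set_upt using d by simp
  ultimately have 2: "free_vars (stray_edge d v F i) \<subseteq> {1..v}" if "i \<in> {1..v}" for i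
    using that unfolding stray_edge_def exs_free_vars free_vars.simps by blast
  have "fo_formula d (contains d v F)"
    unfolding contains_def contains_body_def exs_formula conj_of(2)[OF finite_contains[OF F]]
    using edge_lists_props(4)[OF F] 1 by auto
  moreover have "free_vars (contains_body d v F) \<subseteq> {1..v}"
    unfolding contains_body_def conj_of(3)[OF finite_contains[OF F]]
  proof (rule UN_least)
    fix \<phi> assume "\<phi> \<in> (\<lambda>(i, j). Neg (Eq i j)) ` {(i, j) \<in> {1..v} \<times> {1..v}. i \<noteq> j} \<union> Edge ` edge_lists F \<union>
     (\<lambda>i. Neg (stray_edge d v F i)) ` {1..v}"
    then consider i j where "\<phi> = Neg (Eq i j)" "i \<in> {1..v}" "j \<in> {1..v}"
      | l where "\<phi> = Edge l" "l \<in> edge_lists F"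
      | i where "\<phi> = Neg (stray_edge d v F i)" "i \<in> {1..v}" by (elim UnE imageE) auto
    then show "free_vars \<phi> \<subseteq> {1..v}"
    proof cases
      case 2
      then show ?thesis using edge_lists_props(3)[OF F 2(2)] by simp
    next
      case 3
      then show ?thesis using \<open>\<And>i. i \<in> {1..v} \<Longrightarrow> free_vars (stray_edge d v F i) \<subseteq> {1..v}\<close>[of i] by simp
    qed simp
  qed
  then have "free_vars (contains d v F) = {}" unfolding contains_def exs_free_vars by auto
  ultimately show ?thesis by (simp add: fo_sentence_def)
qed

lemma sat_contains_body:
  assumes H: "uniform_hypergraph d H" and d: "d \<ge> 1" and F: "F \<subseteq> dsets d {1..v}"
  shows "sat H \<sigma> (contains_body d v F) \<longleftrightarrow> inj_on \<sigma> {1..v} \<and> (\<forall>e\<in>F. \<sigma> ` e \<in> edges H) \<and>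
    (\<forall>e\<in>edges H. e \<inter> \<sigma> ` {1..v} \<noteq> {} \<longrightarrow> e \<in> (`) \<sigma> ` F)"
proof -
  have 0: "sat H \<sigma> (contains_body d v F) \<longleftrightarrow>
      (\<forall>i\<in>{1..v}. \<forall>j\<in>{1..v}. i \<noteq> j \<longrightarrow> \<sigma> i \<noteq> \<sigma> j) \<and> (\<forall>l\<in>edge_lists F. sat H \<sigma> (Edge l)) \<and>
      (\<forall>i\<in>{1..v}. \<not> sat H \<sigma> (stray_edge d v F i))"
    unfolding contains_body_def conj_of(1)[OF finite_contains[OF F]] ball_Un by (auto simp del: sat.simps(2))
  have 1: "(\<forall>i\<in>{1..v}. \<forall>j\<in>{1..v}. i \<noteq> j \<longrightarrow> \<sigma> i \<noteq> \<sigma> j) \<longleftrightarrow> inj_on \<sigma> {1..v}"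
    unfolding inj_on_def by blast
  have 2: "(\<forall>l\<in>edge_lists F. sat H \<sigma> (Edge l)) \<longleftrightarrow> (\<forall>e\<in>F. \<sigma> ` e \<in> edges H)" if inj: "inj_on \<sigma> {1..v}"
  proof
    assume a: "\<forall>l\<in>edge_lists F. sat H \<sigma> (Edge l)"
    show "\<forall>e\<in>F. \<sigma> ` e \<in> edges H"
    proof
      fix e assume e: "e \<in> F"
      then have "finite e" using F finite_subset[of e "{1..v}"] by (auto simp: dsets_def)
      then obtain l where l: "set l = e" "distinct l" using finite_distinct_list by blast
      then have "l \<in> edge_lists F" using e by (simp add: edge_lists_def)
      then have "sat H \<sigma> (Edge l)" using a by blast
      then show "\<sigma> ` e \<in> edges H" using l(1) by simp
    qed
  next
    assume a: "\<forall>e\<in>F. \<sigma> ` e \<in> edges H"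
    show "\<forall>l\<in>edge_lists F. sat H \<sigma> (Edge l)"
    proof
      fix l assume "l \<in> edge_lists F"
      note lp = edge_lists_props[OF F this]
      have "distinct (map \<sigma> l)" unfolding distinct_map using lp inj inj_on_subset by blast
      then show "sat H \<sigma> (Edge l)" using a lp(2) by simp
    qed
  qed
  have 3: "(\<forall>i\<in>{1..v}. \<not> sat H \<sigma> (stray_edge d v F i)) \<longleftrightarrow>
      (\<forall>e\<in>edges H. e \<inter> \<sigma> ` {1..v} \<noteq> {} \<longrightarrow> e \<in> (`) \<sigma> ` F)"
  proof -
    have "(\<forall>i\<in>{1..v}. \<not> sat H \<sigma> (stray_edge d v F i)) \<longleftrightarrow>
        (\<forall>i\<in>{1..v}. \<not> (\<exists>e\<in>edges H. \<sigma> i \<in> e \<and> e \<notin> (`) \<sigma> ` F))"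
      by (rule ball_cong[OF refl]) (simp only: sat_stray_edge[OF H d F])
    also have "\<dots> \<longleftrightarrow> (\<forall>e\<in>edges H. (\<exists>i\<in>{1..v}. \<sigma> i \<in> e) \<longrightarrow> e \<in> (`) \<sigma> ` F)" by blast
    also have "\<dots> \<longleftrightarrow> (\<forall>e\<in>edges H. e \<inter> \<sigma> ` {1..v} \<noteq> {} \<longrightarrow> e \<in> (`) \<sigma> ` F)"
      by (rule ball_cong[OF refl]) (rule imp_cong, blast, rule refl)
    finally show ?thesis .
  qed
  show ?thesis unfolding 0 1 3 using 2 by blast
qed

lemma sat_contains:
  assumes H: "uniform_hypergraph d H" and d: "d \<ge> 1" and F: "F \<subseteq> dsets d {1..v}"
  shows "sat H \<sigma> (contains d v F) \<longleftrightarrow> (\<exists>W. closed_in H W \<and> ({1..v}, F) \<simeq>\<^sub>H induced H W)"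
proof
  have FV: "e \<subseteq> {1..v}" if "e \<in> F" for e using F that by (auto simp: dsets_def)
  have set_upt: "set [1..<Suc v] = {1..v}" by auto
  {
    assume "sat H \<sigma> (contains d v F)"
    then obtain \<tau> where t: "\<forall>x\<in>{1..v}. \<tau> x \<in> verts H" "sat H \<tau> (contains_body d v F)"
      unfolding contains_def sat_exs[OF distinct_upt] set_upt by blast
    have b: "inj_on \<tau> {1..v}" "\<forall>e\<in>F. \<tau> ` e \<in> edges H"
      "\<forall>e\<in>edges H. e \<inter> \<tau> ` {1..v} \<noteq> {} \<longrightarrow> e \<in> (`) \<tau> ` F"
      using t(2) unfolding sat_contains_body[OF H d F] by blast+
    let ?W = "\<tau> ` {1..v}"
    have img: "\<tau> ` e \<subseteq> ?W" if "e \<in> F" for e using FV[OF that] by (rule image_mono)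
    have cl: "closed_in H ?W" unfolding closed_in_def
    proof (intro conjI ballI impI)
      show "?W \<subseteq> verts H" using t(1) by blast
      fix e assume "e \<in> edges H" "e \<inter> ?W \<noteq> {}"
      then obtain g where "g \<in> F" "e = \<tau> ` g" using b(3) by blast
      then show "e \<subseteq> ?W" using img by simp
    qed
    have "{e \<in> edges H. e \<subseteq> ?W} = (`) \<tau> ` F"
    proof (intro equalityI subsetI)
      fix e assume e: "e \<in> {e \<in> edges H. e \<subseteq> ?W}"
      then have "e \<noteq> {}" using uniform_edges_ne[OF H d] by blast
      then have "e \<inter> ?W \<noteq> {}" using e by blast
      then show "e \<in> (`) \<tau> ` F" using b(3) e by blast
    next
      fix e assume "e \<in> (`) \<tau> ` F"
      then show "e \<in> {e \<in> edges H. e \<subseteq> ?W}" using b(2) img by blast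
    qed
    then have "iso_via \<tau> ({1..v}, F) (induced H ?W)"
      using b(1) by (simp add: iso_via_def bij_betw_def)
    then show "\<exists>W. closed_in H W \<and> ({1..v}, F) \<simeq>\<^sub>H induced H W"
      unfolding iso_hypergraph_iff using cl by blast
  }
  assume "\<exists>W. closed_in H W \<and> ({1..v}, F) \<simeq>\<^sub>H induced H W"
  then obtain W f where W: "closed_in H W" and f: "iso_via f ({1..v}, F) (induced H W)"
    unfolding iso_hypergraph_iff by blast
  have f': "inj_on f {1..v}" "f ` {1..v} = W" "{e \<in> edges H. e \<subseteq> W} = (`) f ` F"
    using f by (auto simp only: iso_via_def bij_betw_def fst_conv snd_conv verts_induced edges_induced)
  define \<tau> where "\<tau> x = (if x \<in> {1..v} then f x else \<sigma> x)" for x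
  have te: "\<tau> ` e = f ` e" if "e \<subseteq> {1..v}" for e
    by (rule image_cong[OF refl]) (use that in \<open>auto simp: \<tau>_def\<close>)
  have tF: "(`) \<tau> ` F = (`) f ` F" by (rule image_cong[OF refl]) (rule te[OF FV])
  have "inj_on \<tau> {1..v}" using f'(1) by (subst inj_on_cong[of _ _ f]) (simp_all add: \<tau>_def)
  moreover have "\<forall>e\<in>F. \<tau> ` e \<in> edges H"
  proof
    fix e assume e: "e \<in> F"
    then have "f ` e \<in> {e \<in> edges H. e \<subseteq> W}" unfolding f'(3) by blast
    then show "\<tau> ` e \<in> edges H" using te[OF FV[OF e]] by simp
  qed
  moreover have "\<forall>e\<in>edges H. e \<inter> \<tau> ` {1..v} \<noteq> {} \<longrightarrow> e \<in> (`) \<tau> ` F"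
    unfolding te[OF order_refl] tF f'(2) f'(3)[symmetric] using W by (simp add: closed_in_def)
  ultimately have "sat H \<tau> (contains_body d v F)" unfolding sat_contains_body[OF H d F] by blast
  moreover have "\<forall>x\<in>{1..v}. \<tau> x \<in> verts H"
    using f'(2) W unfolding closed_in_def \<tau>_def by auto
  moreover have "\<forall>x. x \<notin> {1..v} \<longrightarrow> \<tau> x = \<sigma> x" unfolding \<tau>_def by simp
  ultimately show "sat H \<sigma> (contains d v F)"
    unfolding contains_def sat_exs[OF distinct_upt] set_upt by blast
qed

section \<open>Sentences approximating the events on the fragment\<close>

definition class_size :: "nat hypergraph set \<Rightarrow> nat" where
  "class_size C = card (verts (SOME H. H \<in> C))"

text \<open>With \<open>class_size\<close>, a fixed representative on an initial segment of the
  positive numbers, whose vertices can serve as names of variables.\<close>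

definition class_edges :: "nat hypergraph set \<Rightarrow> nat set set" where
  "class_edges C = (SOME F. ({1..class_size C}, F) \<in> C)"

lemma family_ne: "C \<in> unicyclic_family d \<Longrightarrow> \<exists>H. H \<in> C"
  by (elim unicyclic_familyE) (auto intro: iso_hypergraph_refl)

lemma class_size: "C \<in> unicyclic_family d \<Longrightarrow> H \<in> C \<Longrightarrow> card (verts H) = class_size C"
  unfolding class_size_def by (rule family_card(1)[of C d _ H]) (auto intro: someI)

lemma class_edges:
  assumes C: "C \<in> unicyclic_family d"
  shows "({1..class_size C}, class_edges C) \<in> C" "class_edges C \<subseteq> dsets d {1..class_size C}"
proof -
  obtain H where H: "H \<in> C" using family_ne[OF C] by blast
  have au: "all_uni d H" by (rule family_all_uni[OF C H])
  then have "finite (verts H)" by (simp add: all_uni_def uniform_hypergraph_def)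
  then obtain f F where f: "iso_via f H ({1..card (verts H)}, F)" by (rule iso_to_interval)
  then have "H \<simeq>\<^sub>H ({1..class_size C}, F)"
    unfolding class_size[OF C H] iso_hypergraph_iff by blast
  then have "({1..class_size C}, F) \<in> C" by (rule family_iso[OF C H])
  then show 1: "({1..class_size C}, class_edges C) \<in> C" unfolding class_edges_def by (rule someI)
  show "class_edges C \<subseteq> dsets d {1..class_size C}"
    using family_all_uni[OF C 1] by (auto simp: all_uni_def uniform_hypergraph_def dsets_def)
qed

definition contains_class :: "nat \<Rightarrow> nat hypergraph set \<Rightarrow> fo" where
  "contains_class d C = contains d (class_size C) (class_edges C)"

lemma sat_contains_class:
  fixes H :: "nat hypergraph"
  assumes "C \<in> unicyclic_family d" "uniform_hypergraph d H" "d \<ge> 1"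
  shows "sat H \<sigma> (contains_class d C) \<longleftrightarrow> (\<exists>W. closed_in H W \<and> induced H W \<in> C)"
proof -
  have "K \<in> C \<longleftrightarrow> ({1..class_size C}, class_edges C) \<simeq>\<^sub>H K" for K
    proof
    assume "K \<in> C"
    then have "K \<in> {K. ({1..class_size C}, class_edges C) \<simeq>\<^sub>H K}"
      by (rule subsetD[OF equalityD1[OF family_class_eq[OF assms(1) class_edges(1)[OF assms(1)]]]])
    then show "({1..class_size C}, class_edges C) \<simeq>\<^sub>H K" by (rule CollectD)
  qed (rule family_iso[OF assms(1) class_edges(1)[OF assms(1)]])
  then show ?thesis
    unfolding contains_class_def sat_contains[OF assms(2,3) class_edges(2)[OF assms(1)]] by simp
qed

text \<open>The fragment is the largest union of components all of which are unicycles.  Its size is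
  maximal among the sizes of such unions, and if it is at most \<open>M\<close>, maximality is a first order
  condition.\<close>

definition frag_sentence :: "nat \<Rightarrow> nat \<Rightarrow> nat hypergraph set set \<Rightarrow> fo" where
  "frag_sentence d M T = disj_of ((\<lambda>C. conj_of (insert (contains_class d C)
     ((\<lambda>C'. Neg (contains_class d C')) ` {C' \<in> small_classes d M. class_size C < class_size C'}))) ` T)"

lemma frag_sentence:
  fixes H :: "nat hypergraph"
  assumes T: "T \<subseteq> small_classes d M" and d: "d \<ge> 1"
  shows "fo_sentence d (frag_sentence d M T)"
    and "uniform_hypergraph d H \<Longrightarrow> card (verts (Frag d H)) \<le> M \<Longrightarrow>
      H \<Turnstile>\<^sub>H frag_sentence d M T \<longleftrightarrow> Frag d H \<in> \<Union>T"
proof -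
  have fin: "finite T" using T finite_small_classes finite_subset by blast
  have sU: "small_classes d M \<subseteq> unicyclic_family d" by (auto simp: small_classes_def)
  let ?N = "\<lambda>C. {C' \<in> small_classes d M. class_size C < class_size C'}"
  have finN: "finite (insert (contains_class d C) ((\<lambda>C'. Neg (contains_class d C')) ` ?N C))" for C
    using finite_small_classes by simp
  have cs: "fo_formula d (contains_class d C)" "free_vars (contains_class d C) = {}"
    if "C \<in> small_classes d M" for C
    using contains_sentence[OF d class_edges(2)] that sU unfolding contains_class_def fo_sentence_def by blast+
  show sent: "fo_sentence d (frag_sentence d M T)"
  proof -
    have a: "fo_formula d \<phi> \<and> free_vars \<phi> = {}" if "C \<in> T"
      "\<phi> \<in> insert (contains_class d C) ((\<lambda>C'. Neg (contains_class d C')) ` ?N C)" for C \<phi>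
      using that cs T by auto
    let ?\<psi> = "\<lambda>C. conj_of (insert (contains_class d C) ((\<lambda>C'. Neg (contains_class d C')) ` ?N C))"
    have "fo_formula d (?\<psi> C)" "free_vars (?\<psi> C) = {}" if "C \<in> T" for C
    proof -
      show "fo_formula d (?\<psi> C)" unfolding conj_of(2)[OF finN] by (rule ballI) (rule a[OF that, THEN conjunct1])
      have "free_vars \<phi> \<subseteq> {}" if "\<phi> \<in> insert (contains_class d C) ((\<lambda>C'. Neg (contains_class d C')) ` ?N C)" for \<phi>
        using a[OF \<open>C \<in> T\<close> that] by simp
      then have "free_vars (?\<psi> C) \<subseteq> {}" unfolding conj_of(3)[OF finN] by (rule UN_least)
      then show "free_vars (?\<psi> C) = {}" by simp
    qed
    then show ?thesis unfolding fo_sentence_def frag_sentence_def disj_of(2,3)[OF finite_imageI[OF fin]] by simp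
  qed
  assume H: "uniform_hypergraph d H" and M: "card (verts (Frag d H)) \<le> M"
  let ?F = "frag_verts d H"
  have Fr: "Frag d H = induced H ?F" by (rule Frag_eq[OF H d])
  have cF: "closed_in H ?F" by (rule closed_in_frag_verts)
  have finF: "finite ?F" using cF H finite_subset by (auto simp: closed_in_def uniform_hypergraph_def)
  have au: "all_uni d (induced H ?F)" using Frag_all_uni[OF H d] Fr by simp
  let ?C0 = "{K :: nat hypergraph. Frag d H \<simeq>\<^sub>H K}"
  have C0: "?C0 \<in> unicyclic_family d" using iso_class_in_family[OF Frag_all_uni[OF H d]] .
  have FC0: "Frag d H \<in> ?C0" by (simp add: iso_hypergraph_refl)
  have sC0: "class_size ?C0 = card ?F" using class_size[OF C0 FC0] Fr by simp
  have C0s: "?C0 \<in> small_classes d M" unfolding small_classes_def using C0 FC0 M by blast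
  have sub: "W \<subseteq> ?F \<and> class_size C = card W"
    if "C \<in> unicyclic_family d" "closed_in H W" "induced H W \<in> C" for C W
    using closed_all_uni_subset_frag[OF H d that(2) family_all_uni[OF that(1,3)]] class_size[OF that(1,3)] by simp
  have "H \<Turnstile>\<^sub>H frag_sentence d M T \<longleftrightarrow> (\<exists>C\<in>T. (\<exists>W. closed_in H W \<and> induced H W \<in> C) \<and>
      (\<forall>C'\<in>?N C. \<not> (\<exists>W. closed_in H W \<and> induced H W \<in> C')))"
  proof -
    have s: "sat H \<sigma> (contains_class d C) \<longleftrightarrow> (\<exists>W. closed_in H W \<and> induced H W \<in> C)" if "C \<in> small_classes d M" for C \<sigma>
      using sat_contains_class[OF _ H d] that sU by blast
    have "sat H \<sigma> (frag_sentence d M T) \<longleftrightarrow> (\<exists>C\<in>T. sat H \<sigma> (contains_class d C) \<and>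
        (\<forall>C'\<in>?N C. \<not> sat H \<sigma> (contains_class d C')))" for \<sigma>
    proof -
      have "sat H \<sigma> (conj_of (insert (contains_class d C) ((\<lambda>C'. Neg (contains_class d C')) ` ?N C))) \<longleftrightarrow>
          sat H \<sigma> (contains_class d C) \<and> (\<forall>C'\<in>?N C. \<not> sat H \<sigma> (contains_class d C'))" for C
        using conj_of(1)[OF finN, of H \<sigma> C] by simp
      then show ?thesis unfolding frag_sentence_def disj_of(1)[OF finite_imageI[OF fin]] by simp
    qed
    moreover have "(\<exists>C\<in>T. sat H \<sigma> (contains_class d C) \<and> (\<forall>C'\<in>?N C. \<not> sat H \<sigma> (contains_class d C'))) \<longleftrightarrow>
       (\<exists>C\<in>T. (\<exists>W. closed_in H W \<and> induced H W \<in> C) \<and> (\<forall>C'\<in>?N C. \<not> (\<exists>W. closed_in H W \<and> induced H W \<in> C')))" for \<sigma>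
    proof (rule bex_cong[OF refl])
      fix C assume "C \<in> T"
      then have C: "C \<in> small_classes d M" using T by blast
      have "(\<forall>C'\<in>?N C. \<not> sat H \<sigma> (contains_class d C')) \<longleftrightarrow> (\<forall>C'\<in>?N C. \<not> (\<exists>W. closed_in H W \<and> induced H W \<in> C'))"
        by (rule ball_cong[OF refl]) (simp add: s)
      then show "sat H \<sigma> (contains_class d C) \<and> (\<forall>C'\<in>?N C. \<not> sat H \<sigma> (contains_class d C')) \<longleftrightarrow>
        (\<exists>W. closed_in H W \<and> induced H W \<in> C) \<and> (\<forall>C'\<in>?N C. \<not> (\<exists>W. closed_in H W \<and> induced H W \<in> C'))"
        unfolding s[OF C] by blast
    qed
    ultimately show ?thesis unfolding models_iff_sat[OF sent, of H "\<lambda>_. 0"] by simp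
  qed
  also have "\<dots> \<longleftrightarrow> Frag d H \<in> \<Union>T"
  proof
    assume "\<exists>C\<in>T. (\<exists>W. closed_in H W \<and> induced H W \<in> C) \<and>
      (\<forall>C'\<in>?N C. \<not> (\<exists>W. closed_in H W \<and> induced H W \<in> C'))"
    then obtain C W where C: "C \<in> T" "closed_in H W" "induced H W \<in> C"
      "\<forall>C'\<in>?N C. \<not> (\<exists>W. closed_in H W \<and> induced H W \<in> C')" by blast
    have CU: "C \<in> unicyclic_family d" using C(1) T sU by blast
    note s = sub[OF CU C(2,3)]
    have "induced H ?F \<in> ?C0" using FC0 Fr by simp
    \<comment> \<open>The fragment itself is a closed set with its class in
      \<open>small_classes\<close>, so the maximality demanded of \<open>C\<close> prevents
      \<open>W\<close> from being smaller than the fragment.\<close>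
    then have "?C0 \<notin> ?N C" using C(4) cF by blast
    then have "card ?F \<le> card W" using C0s sC0 s by simp
    then have "W = ?F" using s finF by (intro card_seteq) auto
    then show "Frag d H \<in> \<Union>T" using C(1,3) Fr by auto
  next
    assume "Frag d H \<in> \<Union>T"
    then obtain C where C: "C \<in> T" "induced H ?F \<in> C" using Fr by auto
    have CU: "C \<in> unicyclic_family d" using C(1) T sU by blast
    have size: "class_size C = card ?F" using sub[OF CU cF C(2)] by simp
    have "\<not> (\<exists>W. closed_in H W \<and> induced H W \<in> C')" if C': "C' \<in> ?N C" for C'
    proof
      assume "\<exists>W. closed_in H W \<and> induced H W \<in> C'"
      then obtain W where W: "closed_in H W" "induced H W \<in> C'" by blast
      have "C' \<in> unicyclic_family d" using C' sU by blast
      then have "W \<subseteq> ?F" "class_size C' = card W" using sub[OF _ W] by blast+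
      then have "class_size C' \<le> card ?F" using finF by (simp add: card_mono)
      then show False using C' size by simp
    qed
    then show "\<exists>C\<in>T. (\<exists>W. closed_in H W \<and> induced H W \<in> C) \<and>
      (\<forall>C'\<in>?N C. \<not> (\<exists>W. closed_in H W \<and> induced H W \<in> C'))" using C cF by blast
  qed
  finally show "H \<Turnstile>\<^sub>H frag_sentence d M T \<longleftrightarrow> Frag d H \<in> \<Union>T" .
qed

section \<open>The closure of the limits\<close>

context subcritical
begin

lemma S_eq: "S d c = infsum (p_lim d c) ` Pow (unicyclic_family d)"
  unfolding S_def by auto

lemma L_subset_S: "L d c \<subseteq> S d c"
proof
  fix x assume "x \<in> L d c"
  then obtain \<phi> where \<phi>: "fo_sentence d \<phi>" "x = lim (fo_prob d c \<phi>)" unfolding L_def by blast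
  obtain T where "T \<subseteq> unicyclic_family d" "fo_prob d c \<phi> \<longlonglongrightarrow> infsum (p_lim d c) T"
    using fo_prob_law[OF \<phi>(1)] by blast
  then show "x \<in> S d c" unfolding S_eq \<phi>(2) using limI by blast
qed

text \<open>The part of \<open>T\<close> with at most \<open>M\<close> vertices is expressed by
  \<open>frag_sentence\<close>, correctly unless the fragment is larger than \<open>M\<close>. The
  limit for this sentence and the full sum over \<open>T\<close> each lie within the tail bound of
  the finite sum, hence e/2 twice.\<close>

lemma S_subset_closure_L: "S d c \<subseteq> closure (L d c)"
proof
  fix x assume "x \<in> S d c"
  then obtain T where T: "T \<subseteq> unicyclic_family d" "x = infsum (p_lim d c) T" unfolding S_eq by blast
  show "x \<in> closure (L d c)" unfolding closure_approachable
  proof (intro allI impI)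
    fix e :: real assume e: "0 < e"
    obtain M where M: "size_bound / real (Suc M) < e / 2" using size_bound_small[of "e / 2"] e by auto
    let ?T = "T \<inter> small_classes d M"
    let ?\<phi> = "frag_sentence d M ?T"
    have sent: "fo_sentence d ?\<phi>" by (rule frag_sentence(1)[OF _ d1]) blast
    have TU: "?T \<subseteq> unicyclic_family d" using T(1) by blast
    obtain l where l: "fo_prob d c ?\<phi> \<longlonglongrightarrow> l" using fo_prob_law[OF sent] by blast
    then have "l = lim (fo_prob d c ?\<phi>)" by (rule limI[symmetric])
    then have lL: "l \<in> L d c" unfolding L_def using sent by blast
    have "(\<lambda>n. fo_prob d c ?\<phi> n - prob_of n (\<lambda>H. Frag d H \<in> \<Union>?T)) \<longlonglongrightarrow> l - infsum (p_lim d c) ?T"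
      by (rule tendsto_diff[OF l Frag_law[OF TU]])
    then have "(\<lambda>n. \<bar>fo_prob d c ?\<phi> n - prob_of n (\<lambda>H. Frag d H \<in> \<Union>?T)\<bar>) \<longlonglongrightarrow> \<bar>l - infsum (p_lim d c) ?T\<bar>"
      by (rule tendsto_rabs)
    moreover have "\<forall>\<^sub>F n in sequentially. \<bar>fo_prob d c ?\<phi> n - prob_of n (\<lambda>H. Frag d H \<in> \<Union>?T)\<bar> \<le> size_bound / real (Suc M)"
      using edge_prob_le_1
    proof eventually_elim
      case (elim n)
      then have n: "n \<ge> 1" "edge_prob n \<le> 1" by auto
      have "\<bar>prob_of n (\<lambda>H. H \<Turnstile>\<^sub>H ?\<phi>) - prob_of n (\<lambda>H. Frag d H \<in> \<Union>?T)\<bar> \<le>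
          prob_of n (\<lambda>H. card (verts (Frag d H)) > M)"
      proof (rule prob_of_abs_diff[OF n(2)])
        fix E assume E: "E \<subseteq> dsets d {1..n}" "\<not> card (verts (Frag d ({1..n}, E))) > M"
        have "uniform_hypergraph d ({1..n}, E)" by (rule uniform_dsets[OF _ E(1)]) simp
        then show "({1..n}, E) \<Turnstile>\<^sub>H ?\<phi> \<longleftrightarrow> Frag d ({1..n}, E) \<in> \<Union>?T"
          using E(2) by (intro frag_sentence(2)[OF _ d1]) auto
      qed
      then show ?case using prob_Frag_tail[OF n, of M] by (simp add: fo_prob_def prob_G[OF n(2)])
    qed
    ultimately have "\<bar>l - infsum (p_lim d c) ?T\<bar> \<le> size_bound / real (Suc M)"
      by (intro tendsto_upperbound) auto
    moreover have "infsum (p_lim d c) ?T = (\<Sum>C\<in>?T. p_lim d c C)"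
      using finite_small_classes by (intro infsum_finite) simp
    ultimately have "dist l x < e"
      using infsum_p_lim_tail[OF T(1), of M] M unfolding T(2) dist_real_def by linarith
    then show "\<exists>y\<in>L d c. dist y x < e" using lL by blast
  qed
qed

text \<open>\<open>S\<close> is the image of a cube of 0-1 functions, compact by Tychonoff, under
  the subsum map. The tail bound does not depend on the set of classes, so this map is a uniform
  limit of finite sums of coordinates and thus continuous.\<close>

lemma closed_S: "closed (S d c)"
proof -
  let ?U = "unicyclic_family d"
  \<comment> \<open>The coordinates are all sets of hypergraphs, not only the classes, so that the
    product topology is the topology of the function type.\<close>
  define X where "X = (\<Pi>\<^sub>E C\<in>(UNIV :: nat hypergraph set set). {0, 1 :: real})"
  define F where "F x = infsum (p_lim d c) {C \<in> ?U. x C = 1}" for x :: "nat hypergraph set \<Rightarrow> real"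
  have "compactin (product_topology (\<lambda>_. euclidean) (UNIV :: nat hypergraph set set)) X"
    unfolding X_def compactin_PiE by (simp add: finite_imp_compact)
  then have X: "compact X" by (simp add: euclidean_product_topology)
  have eq: "{C \<in> ?U. x C = 1} \<inter> small_classes d M = {C \<in> small_classes d M. x C = 1}" for x :: "nat hypergraph set \<Rightarrow> real" and M
    by (auto simp: small_classes_def)
  have "continuous_on X F"
  proof (rule uniform_limit_theorem)
    show "\<forall>\<^sub>F M in sequentially. continuous_on X (\<lambda>x. \<Sum>C\<in>small_classes d M. x C * p_lim d c C)"
      by (intro always_eventually allI continuous_intros continuous_on_subset[OF continuous_on_product_coordinates]) auto
    show "uniform_limit X (\<lambda>M x. \<Sum>C\<in>small_classes d M. x C * p_lim d c C) F sequentially"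
    proof (rule uniform_limitI)
      fix e :: real assume e: "0 < e"
      have "(\<lambda>M. size_bound / real (Suc M)) \<longlonglongrightarrow> 0"
        by (rule LIMSEQ_Suc[OF lim_const_over_n])
      then have "\<forall>\<^sub>F M in sequentially. size_bound / real (Suc M) < e" by (rule order_tendstoD) (rule e)
      then show "\<forall>\<^sub>F M in sequentially. \<forall>x\<in>X. dist (\<Sum>C\<in>small_classes d M. x C * p_lim d c C) (F x) < e"
      proof eventually_elim
        case (elim M)
        show ?case
        proof
          fix x assume x: "x \<in> X"
          have "(\<Sum>C\<in>small_classes d M. x C * p_lim d c C) = (\<Sum>C\<in>small_classes d M. if x C = 1 then p_lim d c C else 0)"
          proof (rule sum.cong[OF refl])
            fix C
            have "x C \<in> {0, 1}" using x unfolding X_def by (rule PiE_mem) simp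
            then show "x C * p_lim d c C = (if x C = 1 then p_lim d c C else 0)" by auto
          qed
          also have "\<dots> = (\<Sum>C\<in>{C \<in> ?U. x C = 1} \<inter> small_classes d M. p_lim d c C)"
            unfolding eq using finite_small_classes by (simp add: sum.inter_filter)
          finally show "dist (\<Sum>C\<in>small_classes d M. x C * p_lim d c C) (F x) < e"
            using infsum_p_lim_tail[of "{C \<in> ?U. x C = 1}" M] elim unfolding F_def dist_real_def by auto
        qed
      qed
    qed
  qed simp
  then have "compact (F ` X)" using X by (rule compact_continuous_image)
  moreover have "F ` X = S d c"
  proof (intro equalityI subsetI)
    fix y assume "y \<in> F ` X"
    then show "y \<in> S d c" unfolding S_eq F_def by blast
  next
    fix y assume "y \<in> S d c"
    then obtain T where T: "T \<subseteq> ?U" "y = infsum (p_lim d c) T" unfolding S_eq by blast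
    let ?x = "\<lambda>C. if C \<in> T then 1 else 0 :: real"
    have "{C \<in> ?U. ?x C = 1} = T" using T(1) by (auto split: if_splits)
    then have "F ?x = y" unfolding F_def T(2) by simp
    moreover have "?x \<in> X" unfolding X_def by (rule PiE_I) simp_all
    ultimately show "y \<in> F ` X" by blast
  qed
  ultimately show ?thesis using compact_imp_closed by simp
qed

lemma L_subset_unit: "L d c \<subseteq> {0..1}"
proof
  fix x assume "x \<in> L d c"
  then obtain \<phi> where \<phi>: "fo_sentence d \<phi>" "x = lim (fo_prob d c \<phi>)" unfolding L_def by blast
  obtain l where l: "fo_prob d c \<phi> \<longlonglongrightarrow> l" using fo_prob_law[OF \<phi>(1)] by blast
  have "0 \<le> l" by (rule tendsto_lowerbound[OF l]) (simp_all add: fo_prob_def)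
  moreover have "l \<le> 1" by (rule tendsto_upperbound[OF l]) (simp_all add: fo_prob_def)
  ultimately show "x \<in> {0..1}" unfolding \<phi>(2) limI[OF l] by simp
qed

text \<open>The unit interval is closed, so the closures in it and in the reals agree.\<close>

lemma closure_of_L: "top_of_set {0..1} closure_of L d c = S d c"
proof -
  have "closure (L d c) = S d c"
    using closure_minimal[OF L_subset_S closed_S] S_subset_closure_L by blast
  moreover have "closure (L d c) \<subseteq> {0..1}" by (rule closure_minimal[OF L_subset_unit]) simp
  ultimately show ?thesis
    using L_subset_unit by (simp add: closure_of_subtopology Int_absorb1 euclidean_closure_of)
qed

end

theorem theorem23:
  fixes d :: nat and c :: real
  assumes "d \<ge> 3" and "0 < c" and "c < fact (d - 2)"
  shows "(\<forall>\<phi>. fo_sentence d \<phi> \<longrightarrow> convergent (fo_prob d c \<phi>)) \<and>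
         (\<forall>C\<in>unicyclic_family d. convergent (frag_prob d c C)) \<and>
         top_of_set {0..1} closure_of L d c = S d c"
proof -
  interpret subcritical d c by unfold_locales (use assms in auto)
  have "convergent (fo_prob d c \<phi>)" if "fo_sentence d \<phi>" for \<phi>
    using fo_prob_law[OF that] by (auto simp: convergent_def)
  then show ?thesis using convergent_frag_prob(1) closure_of_L by blast
qed

end
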